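(* Let $U=\mathbf F_4^2$, $W=\mathbf F_8$, $V=U\oplus W$, let $G=B\rtimes V$ with $B=\{f:V\to\mathbf F_2\}$, and let $A=\langle a\rangle\cong C_{21}$ act on $G$ via $T(x_1,x_2,y)=(\omega x_1,\omega x_2,\zeta y)$ (all as specified in the context), and put $C=C_G(A)$. Then there are $2368$ characters $\chi\in\operatorname{Irr}_A(G)$ with $\chi^*(1)=1$ for which $\chi_C$ nevertheless has a zero, i.e. $\chi(c)=0$ for some $c\in C$. Consequently the following question has a negative answer: if a finite group $A$ acts coprimely on a finite group $G$, $C=C_G(A)$, and $\chi\in\operatorname{Irr}_A(G)$, is it true that $\chi^*(1)=1$ if and only if $\chi_C$ is never zero?
   Context: Groups are finite and characters complex. For a coprime action of $A$ on $G$ (action by automorphisms, $\gcd(|A|,|G|)=1$), $\operatorname{Irr}_A(G)$ is the set of $A$-invariant irreducible characters of $G$, and $\chi\mapsto\chi^*$ is the Glauberman--Isaacs correspondence, a canonical bijection $\operatorname{Irr}_A(G)\to\operatorname{Irr}(C_G(A))$. When $A$ is a $p$-group, $\chi^*$ is the unique irreducible constituent of $\chi_{C_G(A)}$ whose multiplicity is not divisible by $p$; for solvable $A$ it is obtained by composing such maps along a subnormal series of $A$ with factors of prime power order (the result is independent of the series). The specific action: $V=U\oplus W$ with $U=\mathbf F_4^2$, $W=\mathbf F_8$ is an $\mathbf F_2$-space of dimension $7$; $B$ is the additive group of all functions $f:V\to\mathbf F_2$; for $t\in V$, $(\tau_tf)(x)=f(x+t)$; $G=B\rtimes V$ has multiplication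 $(f,t)(g,s)=(f+\tau_tg,\,t+s)$, so $|G|=2^{135}$. Choose $\omega\in\mathbf F_4^\times$ of order $3$ and $\zeta\in\mathbf F_8^\times$ of order $7$, and let $T(x_1,x_2,y)=(\omega x_1,\omega x_2,\zeta y)$, of order $21$. $A=\langle a\rangle\cong C_{21}$ acts on $V$ with $a$ acting as $T$, and on $G$ by $b\cdot(f,t)=(f\circ b^{-1},b\cdot t)$ for $b\in A$. *)

theory Defs
  imports
    "Jordan_Normal_Form.VS_Connect"
    "HOL-Algebra.Bij"
    "HOL-Algebra.Elementary_Groups"
    "HOL-Algebra.Solvable_Groups"
    "HOL-Library.Z2"
    "HOL-Library.Function_Algebras"
    "HOL-Library.Product_Plus"
begin

section \<open>Complex characters of finite groups\<close>

definition GL :: "nat \<Rightarrow> complex mat monoid" where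
  "GL n = units_of (ring_mat TYPE(complex) n ())"

definition representation :: "('g, 'm) monoid_scheme \<Rightarrow> nat \<Rightarrow> ('g \<Rightarrow> complex mat) \<Rightarrow> bool" where
  "representation G n \<rho> \<longleftrightarrow> \<rho> \<in> hom G (GL n)"

definition irreducible_rep :: "('g, 'm) monoid_scheme \<Rightarrow> nat \<Rightarrow> ('g \<Rightarrow> complex mat) \<Rightarrow> bool" where
  "irreducible_rep G n \<rho> \<longleftrightarrow> representation G n \<rho> \<and> n > 0 \<and>
     (\<forall>W. subspace class_ring W (module_vec TYPE(complex) n) \<and>
          (\<forall>g \<in> carrier G. \<forall>w \<in> W. \<rho> g *\<^sub>v w \<in> W)
        \<longrightarrow> W = {0\<^sub>v n} \<or> W = carrier_vec n)"

definition mat_trace :: "complex mat \<Rightarrow> complex" where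
  "mat_trace M = (\<Sum>i<dim_row M. M $$ (i, i))"

text \<open>Characters are made extensional (\<open>undefined\<close> off the carrier), so that equality of
  characters of a group or subgroup is equality of HOL functions.\<close>

definition Irr :: "('g, 'm) monoid_scheme \<Rightarrow> ('g \<Rightarrow> complex) set" where
  "Irr G = {(\<lambda>g \<in> carrier G. mat_trace (\<rho> g)) |n \<rho>. irreducible_rep G n \<rho>}"

definition char_inner :: "('g, 'm) monoid_scheme \<Rightarrow> ('g \<Rightarrow> complex) \<Rightarrow> ('g \<Rightarrow> complex) \<Rightarrow> complex" where
  "char_inner G \<chi> \<psi> =
     (\<Sum>g \<in> carrier G. \<chi> g * cnj (\<psi> g)) / of_nat (card (carrier G))"

text \<open>The multiplicity of \<open>\<psi> \<in> Irr G\<close> in a character \<open>\<chi>\<close>; the inner product is then a natural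
  number. Only the values of \<open>\<chi>\<close> on the carrier of \<open>G\<close> enter, so for a subgroup \<open>H\<close> the
  multiplicity in the restriction of \<open>\<chi>\<close> to \<open>H\<close> is \<open>multiplicity_in (G\<lparr>carrier := H\<rparr>) \<chi> \<psi>\<close>.\<close>

definition multiplicity_in :: "('g, 'm) monoid_scheme \<Rightarrow> ('g \<Rightarrow> complex) \<Rightarrow> ('g \<Rightarrow> complex) \<Rightarrow> nat" where
  "multiplicity_in G \<chi> \<psi> = (THE m. of_nat m = char_inner G \<chi> \<psi>)"


section \<open>Coprime actions\<close>

definition coprime_action ::
    "('a, 'n) monoid_scheme \<Rightarrow> ('g, 'm) monoid_scheme \<Rightarrow> ('a \<Rightarrow> 'g \<Rightarrow> 'g) \<Rightarrow> bool" where
  "coprime_action A G \<phi> \<longleftrightarrow>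
     group A \<and> finite (carrier A) \<and> group G \<and> finite (carrier G) \<and>
     \<phi> \<in> hom A (AutoGroup G) \<and> coprime (card (carrier A)) (card (carrier G))"

definition fixed_points :: "'a set \<Rightarrow> ('g, 'm) monoid_scheme \<Rightarrow> ('a \<Rightarrow> 'g \<Rightarrow> 'g) \<Rightarrow> 'g set" where
  "fixed_points K G \<phi> = {g \<in> carrier G. \<forall>b \<in> K. \<phi> b g = g}"

definition Irr_inv ::
    "('a, 'n) monoid_scheme \<Rightarrow> ('g, 'm) monoid_scheme \<Rightarrow> ('a \<Rightarrow> 'g \<Rightarrow> 'g) \<Rightarrow> ('g \<Rightarrow> complex) set" where
  "Irr_inv A G \<phi> =
     {\<chi> \<in> Irr G. \<forall>b \<in> carrier A. \<forall>g \<in> carrier G. \<chi> (\<phi> b g) = \<chi> g}"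


section \<open>The Glauberman--Isaacs correspondence\<close>

definition the_p'_constituent ::
    "nat \<Rightarrow> ('g, 'm) monoid_scheme \<Rightarrow> ('g \<Rightarrow> complex) set \<Rightarrow> ('g \<Rightarrow> complex) \<Rightarrow> ('g \<Rightarrow> complex) \<Rightarrow> bool" where
  "the_p'_constituent p H S \<psi> \<theta> \<longleftrightarrow>
     \<theta> \<in> S \<and> \<not> p dvd multiplicity_in H \<psi> \<theta> \<and>
     (\<forall>\<theta>' \<in> S. \<not> p dvd multiplicity_in H \<psi> \<theta>' \<longrightarrow> \<theta>' = \<theta>)"

text \<open>\<open>glauberman_chain A G \<phi> \<chi> K \<theta>\<close>: there is a series \<open>1 = A\<^sub>0 \<lhd> A\<^sub>1 \<lhd> \<dots> \<lhd> A\<^sub>k = K\<close> of subgroups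
  of \<open>A\<close> with factors of prime power order along which \<open>\<chi>\<close> is sent to \<open>\<theta> \<in> Irr (C\<^sub>G(K))\<close>. The
  factor \<open>A\<^sub>i / A\<^sub>i\<^sub>-\<^sub>1\<close> acts on the fixed points of \<open>A\<^sub>i\<^sub>-\<^sub>1\<close>, with fixed points those of \<open>A\<^sub>i\<close>.\<close>

inductive glauberman_chain ::
    "('a, 'n) monoid_scheme \<Rightarrow> ('g, 'm) monoid_scheme \<Rightarrow> ('a \<Rightarrow> 'g \<Rightarrow> 'g) \<Rightarrow>
     ('g \<Rightarrow> complex) \<Rightarrow> 'a set \<Rightarrow> ('g \<Rightarrow> complex) \<Rightarrow> bool"
  for A G \<phi> \<chi> where
  start: "glauberman_chain A G \<phi> \<chi> {\<one>\<^bsub>A\<^esub>} \<chi>"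
| step: "glauberman_chain A G \<phi> \<chi> K \<theta>"
    if "glauberman_chain A G \<phi> \<chi> H \<psi>"
      and "subgroup K A" and "H \<lhd> A\<lparr>carrier := K\<rparr>"
      and "prime p" and "card K = p ^ n * card H"
      and "the_p'_constituent p (G\<lparr>carrier := fixed_points K G \<phi>\<rparr>)
             (Irr (G\<lparr>carrier := fixed_points K G \<phi>\<rparr>)) \<psi> \<theta>"

text \<open>If \<open>A\<close> is not solvable, then \<open>G\<close> has odd order, and the correspondence is due to Isaacs: with
  \<open>C = C\<^sub>G(A)\<close> and \<open>N = [G,A]'C\<close>, the restriction of \<open>\<chi>\<close> to \<open>N\<close> has exactly one \<open>A\<close>-invariant
  irreducible constituent of odd multiplicity. Replace \<open>G\<close> by \<open>N\<close> and \<open>\<chi>\<close> by that constituent,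
  and repeat until \<open>C\<close> is reached.\<close>

definition act_commutator ::
    "('a, 'n) monoid_scheme \<Rightarrow> ('g, 'm) monoid_scheme \<Rightarrow> ('a \<Rightarrow> 'g \<Rightarrow> 'g) \<Rightarrow> 'g set \<Rightarrow> 'g set" where
  "act_commutator A G \<phi> H = generate G {inv\<^bsub>G\<^esub> h \<otimes>\<^bsub>G\<^esub> \<phi> b h |h b. h \<in> H \<and> b \<in> carrier A}"

inductive isaacs_chain ::
    "('a, 'n) monoid_scheme \<Rightarrow> ('g, 'm) monoid_scheme \<Rightarrow> ('a \<Rightarrow> 'g \<Rightarrow> 'g) \<Rightarrow>
     ('g \<Rightarrow> complex) \<Rightarrow> 'g set \<Rightarrow> ('g \<Rightarrow> complex) \<Rightarrow> bool"
  for A G \<phi> \<chi> where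
  start: "isaacs_chain A G \<phi> \<chi> (carrier G) \<chi>"
| step: "isaacs_chain A G \<phi> \<chi> N \<theta>"
    if "isaacs_chain A G \<phi> \<chi> H \<psi>"
      and "N = derived G (act_commutator A G \<phi> H) <#>\<^bsub>G\<^esub> fixed_points (carrier A) G \<phi>"
      and "the_p'_constituent 2 (G\<lparr>carrier := N\<rparr>) (Irr_inv A (G\<lparr>carrier := N\<rparr>) \<phi>) \<psi> \<theta>"

text \<open>The outcome of a Glauberman chain ending at \<open>A\<close> does not depend on the series
  (and an Isaacs chain ending at \<open>C\<^sub>G(A)\<close> has only one outcome), so
  \<open>SOME\<close> is not a genuine choice here.\<close>

definition GI_correspondent ::
    "('a, 'n) monoid_scheme \<Rightarrow> ('g, 'm) monoid_scheme \<Rightarrow> ('a \<Rightarrow> 'g \<Rightarrow> 'g) \<Rightarrow>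
     ('g \<Rightarrow> complex) \<Rightarrow> ('g \<Rightarrow> complex)" where
  "GI_correspondent A G \<phi> \<chi> =
     (SOME \<theta>. if solvable A then glauberman_chain A G \<phi> \<chi> (carrier A) \<theta>
              else isaacs_chain A G \<phi> \<chi> (fixed_points (carrier A) G \<phi>) \<theta>)"

text \<open>An affirmative answer to the question for groups \<open>A\<close> and \<open>G\<close> whose elements have types \<open>'a\<close>
  and \<open>'g\<close>. For any choice of types, its negation refutes the unrestricted statement.\<close>

definition linear_iff_nonvanishing :: "'a itself \<Rightarrow> 'g itself \<Rightarrow> bool" where
  "linear_iff_nonvanishing TA TG \<longleftrightarrow>
     (\<forall>(A :: 'a monoid) (G :: 'g monoid) \<phi>. coprime_action A G \<phi> \<longrightarrow>
        (\<forall>\<chi> \<in> Irr_inv A G \<phi>.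
           GI_correspondent A G \<phi> \<chi> \<one>\<^bsub>G\<^esub> = 1 \<longleftrightarrow>
           (\<forall>c \<in> fixed_points (carrier A) G \<phi>. \<chi> c \<noteq> 0)))"


section \<open>The fields with four and eight elements\<close>

lemma UNIV_bit: "(UNIV :: bit set) = {0, 1}"
  using bit_not_one_iff by auto

lemma all_bit: "(\<forall>x :: bit. P x) \<longleftrightarrow> P 0 \<and> P 1"
  by (metis bit_not_one_iff)

text \<open>\<open>GF4 a b\<close> is \<open>a + b \<alpha>\<close> where \<open>\<alpha>\<^sup>2 = \<alpha> + 1\<close>.\<close>

datatype gf4 = GF4 bit bit

instantiation gf4 :: comm_ring_1
begin

definition "0 = GF4 0 0"
definition "1 = GF4 1 0"
fun plus_gf4 where "GF4 a b + GF4 c d = GF4 (a + c) (b + d)"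
fun uminus_gf4 where "- GF4 a b = GF4 (- a) (- b)"
definition "x - y = x + - (y :: gf4)"
fun times_gf4 where "GF4 a b * GF4 c d = GF4 (a * c + b * d) (a * d + b * c + b * d)"

instance
proof
  fix x y z :: gf4
  show "x + y + z = x + (y + z)" by (cases x; cases y; cases z) (simp only: plus_gf4.simps times_gf4.simps gf4.inject distrib_left distrib_right ac_simps)
  show "x + y = y + x" by (cases x; cases y) (simp only: plus_gf4.simps times_gf4.simps gf4.inject distrib_left distrib_right ac_simps)
  show "0 + x = x" by (cases x) (simp add: zero_gf4_def)
  show "- x + x = 0" by (cases x) (simp add: zero_gf4_def)
  show "x - y = x + - y" by (simp add: minus_gf4_def)
  show "x * y * z = x * (y * z)" by (cases x; cases y; cases z) (simp only: plus_gf4.simps times_gf4.simps gf4.inject distrib_left distrib_right ac_simps)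
  show "x * y = y * x" by (cases x; cases y) (simp only: plus_gf4.simps times_gf4.simps gf4.inject distrib_left distrib_right ac_simps)
  show "1 * x = x" by (cases x) (simp add: one_gf4_def)
  show "(x + y) * z = x * z + y * z" by (cases x; cases y; cases z) (simp only: plus_gf4.simps times_gf4.simps gf4.inject distrib_left distrib_right ac_simps)
  show "(0 :: gf4) \<noteq> 1" by (simp add: zero_gf4_def one_gf4_def)
qed

end

lemma UNIV_gf4: "(UNIV :: gf4 set) = (\<lambda>(a, b). GF4 a b) ` (UNIV \<times> UNIV)"
  by (auto simp: image_iff split: prod.splits) (metis gf4.exhaust)

lemma CARD_gf4: "card (UNIV :: gf4 set) = 4"
  unfolding UNIV_gf4 by (subst card_image) (auto simp: inj_on_def card_cartesian_product UNIV_bit)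

instantiation gf4 :: field
begin

definition "inverse x = (x :: gf4) ^ 2"
definition "x div y = x * inverse (y :: gf4)"

instance
proof
  fix x y :: gf4
  have "\<forall>a b. GF4 a b \<noteq> 0 \<longrightarrow> inverse (GF4 a b) * GF4 a b = 1"
    unfolding all_bit by (simp add: zero_gf4_def one_gf4_def inverse_gf4_def power2_eq_square)
  then show "x \<noteq> 0 \<Longrightarrow> inverse x * x = 1" by (cases x) blast
  show "x div y = x * inverse y" by (simp add: divide_gf4_def)
  show "inverse (0 :: gf4) = 0" by (simp add: inverse_gf4_def)
qed

end

text \<open>\<open>GF8 a b c\<close> is \<open>a + b \<beta> + c \<beta>\<^sup>2\<close> where \<open>\<beta>\<^sup>3 = \<beta> + 1\<close>.\<close>

datatype gf8 = GF8 bit bit bit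

instantiation gf8 :: comm_ring_1
begin

definition "0 = GF8 0 0 0"
definition "1 = GF8 1 0 0"
fun plus_gf8 where "GF8 a b c + GF8 d e f = GF8 (a + d) (b + e) (c + f)"
fun uminus_gf8 where "- GF8 a b c = GF8 (- a) (- b) (- c)"
definition "x - y = x + - (y :: gf8)"
fun times_gf8 where
  "GF8 a b c * GF8 d e f =
     GF8 (a * d + (b * f + c * e))
         (a * e + b * d + (b * f + c * e) + c * f)
         (a * f + b * e + c * d + c * f)"

instance
proof
  fix x y z :: gf8
  show "x + y + z = x + (y + z)" by (cases x; cases y; cases z) (simp only: plus_gf8.simps times_gf8.simps gf8.inject distrib_left distrib_right ac_simps)
  show "x + y = y + x" by (cases x; cases y) (simp only: plus_gf8.simps times_gf8.simps gf8.inject distrib_left distrib_right ac_simps)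
  show "0 + x = x" by (cases x) (simp add: zero_gf8_def)
  show "- x + x = 0" by (cases x) (simp add: zero_gf8_def)
  show "x - y = x + - y" by (simp add: minus_gf8_def)
  show "x * y * z = x * (y * z)" by (cases x; cases y; cases z) (simp only: plus_gf8.simps times_gf8.simps gf8.inject distrib_left distrib_right ac_simps)
  show "x * y = y * x" by (cases x; cases y) (simp only: plus_gf8.simps times_gf8.simps gf8.inject distrib_left distrib_right ac_simps)
  show "1 * x = x" by (cases x) (simp add: one_gf8_def)
  show "(x + y) * z = x * z + y * z" by (cases x; cases y; cases z) (simp only: plus_gf8.simps times_gf8.simps gf8.inject distrib_left distrib_right ac_simps)
  show "(0 :: gf8) \<noteq> 1" by (simp add: zero_gf8_def one_gf8_def)
qed

end

lemma UNIV_gf8: "(UNIV :: gf8 set) = (\<lambda>(a, b, c). GF8 a b c) ` (UNIV \<times> UNIV \<times> UNIV)"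
  by (auto simp: image_iff split: prod.splits) (metis gf8.exhaust)

lemma CARD_gf8: "card (UNIV :: gf8 set) = 8"
  unfolding UNIV_gf8 by (subst card_image) (auto simp: inj_on_def card_cartesian_product UNIV_bit)

instantiation gf8 :: field
begin

definition "inverse x = (x :: gf8) ^ 6"
definition "x div y = x * inverse (y :: gf8)"

instance
proof
  fix x y :: gf8
  have "\<forall>a b c. GF8 a b c \<noteq> 0 \<longrightarrow> inverse (GF8 a b c) * GF8 a b c = 1"
    unfolding all_bit by (simp add: zero_gf8_def one_gf8_def inverse_gf8_def eval_nat_numeral)
  then show "x \<noteq> 0 \<Longrightarrow> inverse x * x = 1" by (cases x) blast
  show "x div y = x * inverse y" by (simp add: divide_gf8_def)
  show "inverse (0 :: gf8) = 0" by (simp add: inverse_gf8_def)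
qed

end

definition has_order :: "'k :: monoid_mult \<Rightarrow> nat \<Rightarrow> bool" where
  "has_order x n \<longleftrightarrow> n > 0 \<and> x ^ n = 1 \<and> (\<forall>m. 0 < m \<and> m < n \<longrightarrow> x ^ m \<noteq> 1)"


section \<open>The group \<open>B \<rtimes> V\<close> and the action of the cyclic group of order 21\<close>

type_synonym V = "(gf4 \<times> gf4) \<times> gf8"
type_synonym B = "V \<Rightarrow> bit"

definition translate :: "V \<Rightarrow> B \<Rightarrow> B" where
  "translate t f = (\<lambda>x. f (x + t))"

definition BV :: "(B \<times> V) monoid" where
  "BV = \<lparr>carrier = UNIV,
         monoid.mult = (\<lambda>(f, t) (g, s). (f + translate t g, t + s)),
         one = (0, 0)\<rparr>"

fun T :: "gf4 \<Rightarrow> gf8 \<Rightarrow> V \<Rightarrow> V" where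
  "T \<omega> \<zeta> ((x1, x2), y) = ((\<omega> * x1, \<omega> * x2), \<zeta> * y)"

abbreviation C21 :: "int monoid" where
  "C21 \<equiv> integer_mod_group 21"

text \<open>The generator of \<open>C21\<close> is \<open>1\<close>, and the element \<open>k\<close> with \<open>0 \<le> k < 21\<close> acts on \<open>V\<close> as \<open>T ^^ k\<close>.\<close>

definition act_V :: "gf4 \<Rightarrow> gf8 \<Rightarrow> int \<Rightarrow> V \<Rightarrow> V" where
  "act_V \<omega> \<zeta> k = T \<omega> \<zeta> ^^ nat k"

definition act_BV :: "gf4 \<Rightarrow> gf8 \<Rightarrow> int \<Rightarrow> B \<times> V \<Rightarrow> B \<times> V" where
  "act_BV \<omega> \<zeta> k = (\<lambda>(f, t). (f \<circ> inv_into UNIV (act_V \<omega> \<zeta> k), act_V \<omega> \<zeta> k t))"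

end

theory Submission
  imports Defs
begin

text \<open>
  Write \<open>\<lambda>\<^sub>s f = (-1)\<^bsup>\<langle>s, f\<rangle>\<^esup>\<close> with \<open>\<langle>s, f\<rangle> = \<Sum>\<^sub>x s x f x\<close>; these are the characters of \<open>B\<close>, one for
  each function \<open>s\<close> from \<open>V\<close> to the field with two elements, and \<open>V\<close> permutes them by translating \<open>s\<close>.
  An irreducible character of \<open>G = B \<rtimes> V\<close> is induced from the stabiliser of some \<open>\<lambda>\<^sub>s\<close>, where it
  extends \<open>\<lambda>\<^sub>s\<close> by a character \<open>\<mu>\<close> of \<open>Stab\<^sub>V s\<close> (lemma \<open>irreducible_character\<close>). Since \<open>T\<close> fixes no
  nonzero vector, \<open>T - 1\<close> is a bijection on \<open>V\<close> and on each \<open>T\<close>-invariant subgroup of \<open>V\<close>. Therefore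
  an invariant orbit contains exactly one invariant \<open>s\<close>, and invariance of the character forces
  \<open>\<mu> = 1\<close>: the invariant irreducible characters are \<open>\<chi>\<^sub>s\<close> for the \<open>2\<^sup>1\<^sup>2\<close> functions \<open>s\<close> with
  \<open>s \<circ> T = s\<close> (lemmas \<open>Irr_inv_eq\<close> and \<open>inj_on_chi\<close>).

  The group \<open>C\<close> of fixed points is \<open>{(f, 0). f \<circ> T = f}\<close>, which is abelian, so every correspondent is
  linear. To know that there is a correspondent, follow \<open>\<chi>\<^sub>s\<close> along \<open>1 < C\<^sub>3 < C\<^sub>2\<^sub>1\<close>. The fixed points
  of \<open>T\<^sup>7\<close> and of \<open>T\<close> have the same shape as \<open>G\<close>, and the multiplicity of one of their
  irreducible characters in the restriction of \<open>\<chi>\<^sub>s\<close> is 0 or, up to a factor prime to \<open>p\<close>, the size of a set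
  on which a cyclic group of order \<open>p\<close> acts; modulo \<open>p\<close> only the fixed points of that action count,
  and they single out the character that belongs to the same \<open>s\<close> (theorem \<open>p'_constituent_chi\<close>).

  It remains to count the invariant \<open>s\<close> for which \<open>\<chi>\<^sub>s\<close> vanishes at some invariant \<open>f\<close>. Up to a
  nonzero factor \<open>\<chi>\<^sub>s(f, 0) = \<Sum>\<^sub>r (-1)\<^bsup>(s * f) r\<^esup>\<close>, where \<open>s * f\<close> is the convolution. As \<open>s * f\<close> is constant
  on the orbits of \<open>T\<close>, which have sizes 1, 3 (five times), 7 and 21 (five times), such a sum vanishes
  for exactly 20 functions \<open>s * f\<close>, called balanced below. Under convolution the invariant functions
  form a local algebra over the field with two elements, generated by the indicators of the five
  lines of \<open>U\<close> and of \<open>W\<close>; the product of two different lines is the indicator of \<open>U\<close>, and the square of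
  each generator is 0. A unit has every element among its multiples, which gives 2048 functions
  \<open>s\<close>. The balanced functions are non-units outside the square of the maximal ideal, so a non-unit
  \<open>s\<close> has a balanced multiple only if it is a unit times a balanced function, and in coordinates
  there are 320 of these (lemmas \<open>exists_balanced_multiple\<close> and \<open>card_vanishing_criterion\<close>).
\<close>

section \<open>The finite space V and its functions\<close>

instance bit :: finite
  by standard (simp add: UNIV_bit)

instance gf4 :: finite
proof
  show "finite (UNIV :: gf4 set)" using CARD_gf4 by (metis card.infinite zero_neq_numeral)
qed

instance gf8 :: finite
proof
  show "finite (UNIV :: gf8 set)" using CARD_gf8 by (metis card.infinite zero_neq_numeral)
qed

lemma card_UNIV_fun:
  "card (UNIV :: ('a :: finite \<Rightarrow> 'b :: finite) set) = card (UNIV :: 'b set) ^ card (UNIV :: 'a set)"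
proof -
  have "(UNIV :: ('a \<Rightarrow> 'b) set) = PiE UNIV (\<lambda>_. UNIV)" by (auto simp: PiE_def extensional_def)
  then have "card (UNIV :: ('a \<Rightarrow> 'b) set) = card (PiE (UNIV :: 'a set) (\<lambda>_. UNIV :: 'b set))"
    by (rule arg_cong)
  then show ?thesis by (simp only: card_PiE finite prod_constant)
qed

lemma card_bit: "card (UNIV :: bit set) = 2"
  by (simp add: UNIV_bit)

lemma card_V: "card (UNIV :: V set) = 2 ^ 7"
  by (simp add: UNIV_Times_UNIV[symmetric] card_cartesian_product CARD_gf4 CARD_gf8 del: UNIV_Times_UNIV)

lemma add_self_V [simp]: "(v :: V) + v = 0"
proof -
  have "(x :: gf4) + x = 0" for x by (cases x) (simp add: zero_gf4_def)
  moreover have "(y :: gf8) + y = 0" for y by (cases y) (simp add: zero_gf8_def)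
  ultimately show ?thesis by (cases v) (auto simp: zero_prod_def)
qed

lemma add_self_left_V [simp]: "(v :: V) + (v + w) = w"
  by (simp add: add.assoc[symmetric])

lemma add_self_right_V [simp]: "(v :: V) + (w + v) = w"
  by (metis add.commute add_self_left_V)

lemma add_eq_0_iff_V: "(v :: V) + w = 0 \<longleftrightarrow> v = w"
  by (metis add_self_V add_left_cancel)

lemma add_self_B [simp]: "(f :: B) + f = 0"
  by (simp add: fun_eq_iff)

lemma add_eq_0_iff_B: "(f :: B) + h = 0 \<longleftrightarrow> f = h"
  by (metis add_self_B add_left_cancel)

lemma translate_0 [simp]: "translate 0 f = f" "translate t 0 = 0"
  by (simp_all add: translate_def fun_eq_iff)

lemma translate_translate [simp]: "translate t (translate u f) = translate (t + u) f"
  by (simp add: translate_def fun_eq_iff add.assoc)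

lemma translate_add: "translate t (f + h) = translate t f + translate t h"
  by (simp add: translate_def fun_eq_iff)

lemma translate_eq_iff: "translate t s = s' \<longleftrightarrow> s = translate t s'"
  by auto

lemma sum_shift_V: "(\<Sum>x\<in>UNIV. F (x + t)) = (\<Sum>x\<in>(UNIV :: V set). F x)"
  by (rule sum.reindex_bij_witness[of _ "\<lambda>x. x + t" "\<lambda>x. x + t"]) (auto simp: add.assoc)

definition pairing :: "B \<Rightarrow> B \<Rightarrow> bit" where
  "pairing s f = (\<Sum>x\<in>UNIV. s x * f x)"

text \<open>The characters of the elementary abelian group \<open>B\<close>. Indexing them by functions instead of
  subsets of \<open>V\<close> puts \<open>B\<close> and its dual on the same footing.\<close>

definition lam :: "B \<Rightarrow> B \<Rightarrow> complex" where
  "lam s f = (if pairing s f = 0 then 1 else - 1)"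

lemma pairing_commute: "pairing s f = pairing f s"
  by (simp only: pairing_def mult.commute)

lemma pairing_translate: "pairing s (translate t f) = pairing (translate t s) f"
proof -
  have "pairing s (translate t f) = (\<Sum>x\<in>UNIV. (\<lambda>x. s (x + t) * f x) (x + t))"
    by (simp only: pairing_def translate_def add.assoc add_self_V add_0_right)
  also have "\<dots> = (\<Sum>x\<in>UNIV. (\<lambda>x. s (x + t) * f x) x)"
    by (rule sum_shift_V)
  also have "\<dots> = pairing (translate t s) f"
    by (simp only: pairing_def translate_def)
  finally show ?thesis .
qed

lemma lam_commute: "lam s f = lam f s"
  by (simp add: lam_def pairing_commute)

lemma lam_add: "lam s (f + h) = lam s f * lam s h"
proof -
  have "pairing s (f + h) = pairing s f + pairing s h"
    by (simp only: pairing_def plus_fun_apply distrib_left sum.distrib)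
  then show ?thesis by (auto simp: lam_def)
qed

lemma lam_add_left: "lam (s + s') f = lam s f * lam s' f"
  by (metis lam_add lam_commute)

lemma lam_translate: "lam s (translate t f) = lam (translate t s) f"
  by (simp add: lam_def pairing_translate)

lemma lam_0 [simp]: "lam s 0 = 1" "lam 0 f = 1"
  by (simp_all add: lam_def pairing_def)

lemma lam_mult_self [simp]: "lam s f * lam s f = 1"
  by (simp add: lam_def)

lemma lam_nonzero [simp]: "lam s f \<noteq> 0"
  by (simp add: lam_def)

lemma cnj_lam [simp]: "cnj (lam s f) = lam s f"
  by (simp add: lam_def)

text \<open>Translation by \<open>y \<in> S\<close> permutes the summands and multiplies the sum by \<open>c y\<close>, which leaves 0 as
  the only possible value when \<open>c y \<noteq> 1\<close>.\<close>

lemma sum_sign_subgroup: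
  fixes c :: "'a :: ab_group_add \<Rightarrow> complex"
  assumes fin: "finite S" and closed: "\<And>x y. x \<in> S \<Longrightarrow> y \<in> S \<Longrightarrow> x + y \<in> S"
    and mult: "\<And>x y. x \<in> S \<Longrightarrow> y \<in> S \<Longrightarrow> c (x + y) = c x * c y"
  shows "(\<Sum>x\<in>S. c x) = (if \<forall>x\<in>S. c x = 1 then of_nat (card S) else 0)"
proof (cases "\<forall>x\<in>S. c x = 1")
  case False
  then obtain y where y: "y \<in> S" "c y \<noteq> 1" by auto
  have inj: "inj_on ((+) y) S" by (auto simp: inj_on_def)
  have "(+) y ` S = S"
    by (rule card_subset_eq) (use fin closed y inj in \<open>auto simp: card_image\<close>)
  then have "(\<Sum>x\<in>S. c x) = (\<Sum>x\<in>S. c (y + x))"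
    using sum.reindex[OF inj, of c] by simp
  also have "\<dots> = c y * (\<Sum>x\<in>S. c x)"
    by (simp add: mult y sum_distrib_left)
  finally have "(\<Sum>x\<in>S. c x) = 0" using y(2) by simp
  with False show ?thesis by presburger
qed simp

section \<open>Fixed points of an automorphism of odd order\<close>

text \<open>The three groups of the Glauberman chain are the fixed points of the powers \<open>1\<close>, \<open>T\<^sup>7\<close>, \<open>T\<close> of \<open>T\<close>
  on \<open>G\<close>. They are treated together as \<open>E \<rtimes> Q\<close>, where \<open>E\<close> and \<open>Q\<close> are the fixed points of \<open>g\<close> on \<open>B\<close>
  and on \<open>V\<close>. Odd order makes the pairing nondegenerate on \<open>E\<close>, so that \<open>E\<close> is still its own dual.\<close>

locale odd_automorphism =
  fixes g :: "V \<Rightarrow> V" and m :: nat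
  assumes additive: "g (x + y) = g x + g y"
    and period: "g ^^ m = id"
    and odd_period: "odd m"
begin

definition E :: "B set" where "E = {f. f \<circ> g = f}"

definition Q :: "V set" where "Q = {t. g t = t}"

lemma g_0: "g 0 = 0"
  by (metis additive add_self_V)

lemma bij_g: "bij g"
proof -
  have "g ^^ (m - 1) \<circ> g = id" "g \<circ> g ^^ (m - 1) = id"
    using period odd_period funpow_Suc_right[of "m - 1" g] funpow.simps(2)[of "m - 1" g]
    by (cases m; simp)+
  then show ?thesis by (metis o_bij)
qed

lemma E_iff: "f \<in> E \<longleftrightarrow> (\<forall>x. f (g x) = f x)"
  unfolding E_def mem_Collect_eq fun_eq_iff comp_apply ..

lemma invariantD: "f \<in> E \<Longrightarrow> f (g x) = f x"
  by (simp only: E_iff)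

lemma invariant_pow: "f \<in> E \<Longrightarrow> f ((g ^^ k) x) = f x"
  by (induction k) (simp_all add: invariantD)

lemma E_add: "f \<in> E \<Longrightarrow> h \<in> E \<Longrightarrow> f + h \<in> E"
  by (simp only: E_iff plus_fun_apply simp_thms)

lemma E_0: "0 \<in> E"
  by (simp only: E_iff zero_fun_apply simp_thms)

lemma E_translate: "f \<in> E \<Longrightarrow> t \<in> Q \<Longrightarrow> translate t f \<in> E"
  by (metis (mono_tags, lifting) E_iff Q_def additive mem_Collect_eq translate_def)

lemma Q_add: "t \<in> Q \<Longrightarrow> u \<in> Q \<Longrightarrow> t + u \<in> Q"
  by (simp add: Q_def additive)

lemma Q_0: "0 \<in> Q"
  by (simp add: Q_def g_0)

lemma finite_E [simp]: "finite E" and finite_Q [simp]: "finite Q"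
  by simp_all

lemma card_E_nonzero: "card E \<noteq> 0" and card_Q_nonzero: "card Q \<noteq> 0"
  using E_0 Q_0 by (auto simp: card_eq_0_iff)

text \<open>If \<open>f a = 1\<close>, then the sum \<open>s\<close> of the point masses on \<open>g\<^sup>-\<^sup>k a\<close> over \<open>k < m\<close> is invariant and pairs
  with \<open>f\<close> to \<open>m \<cdot> f a\<close>, which is 1 because \<open>m\<close> is odd.\<close>

lemma nondegenerate:
  assumes f: "f \<in> E" and orth: "\<And>s. s \<in> E \<Longrightarrow> lam f s = 1"
  shows "f = 0"
proof (rule ccontr)
  assume "f \<noteq> 0"
  then obtain a where "f a \<noteq> 0" by (auto simp: fun_eq_iff)
  then have fa: "f a = 1" by simp
  define \<delta> :: B where "\<delta> = (\<lambda>x. if x = a then 1 else 0)"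
  define s :: B where "s = (\<lambda>x. \<Sum>k<m. \<delta> ((g ^^ k) x))"
  have "s (g x) = s x" for x
  proof -
    have "s (g x) + \<delta> x = (\<Sum>k<m. \<delta> ((g ^^ Suc k) x)) + \<delta> x"
      by (simp only: s_def funpow_Suc_right comp_apply)
    also have "\<dots> = (\<Sum>k<Suc m. \<delta> ((g ^^ k) x))"
      by (simp only: sum.lessThan_Suc_shift funpow_0 add.commute)
    also have "\<dots> = s x + \<delta> x"
      by (simp only: s_def period sum.lessThan_Suc id_apply)
    finally show ?thesis by (rule add_right_imp_eq)
  qed
  then have sE: "s \<in> E" by (simp only: E_iff simp_thms)
  have "pairing f s = (\<Sum>x\<in>UNIV. \<Sum>k<m. f x * \<delta> ((g ^^ k) x))"
    by (simp only: pairing_def s_def sum_distrib_left)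
  also have "\<dots> = (\<Sum>k<m. \<Sum>x\<in>UNIV. f x * \<delta> ((g ^^ k) x))"
    by (rule sum.swap)
  also have "\<dots> = (\<Sum>k<m. 1)"
  proof (rule sum.cong)
    fix k
    have "(\<Sum>x\<in>UNIV. f x * \<delta> ((g ^^ k) x)) = (\<Sum>x\<in>UNIV. (\<lambda>x. f x * \<delta> x) ((g ^^ k) x))"
      by (simp add: invariant_pow[OF f])
    also have "\<dots> = (\<Sum>x\<in>UNIV. f x * \<delta> x)"
      by (rule sum.reindex_bij_betw) (simp add: bij_fn bij_g)
    also have "\<dots> = (\<Sum>x\<in>UNIV. if x = a then 1 else 0)"
      by (rule sum.cong) (auto simp: \<delta>_def fa)
    finally show "(\<Sum>x\<in>UNIV. f x * \<delta> ((g ^^ k) x)) = 1" by simp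
  qed simp
  also have "\<dots> = 1"
  proof -
    have "(of_nat (2 * k + 1) :: bit) = 1" for k by (simp only: of_nat_add of_nat_mult) simp
    then show ?thesis using odd_period by (auto elim!: oddE)
  qed
  finally show False using orth[OF sE] by (simp add: lam_def)
qed

lemma lam_separates:
  assumes "s \<in> E" "s' \<in> E" and "\<And>f. f \<in> E \<Longrightarrow> lam s f = lam s' f"
  shows "s = s'"
  using nondegenerate[of "s + s'"] assms by (simp add: E_add lam_add_left add_eq_0_iff_B)

lemma orthogonality:
  assumes "s \<in> E" "s' \<in> E"
  shows "(\<Sum>f\<in>E. lam s f * lam s' f) = (if s = s' then of_nat (card E) else 0)"
proof -
  have "(\<Sum>f\<in>E. lam (s + s') f) = (if \<forall>f\<in>E. lam (s + s') f = 1 then of_nat (card E) else 0)"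
    by (rule sum_sign_subgroup) (auto simp: E_add lam_add)
  moreover have "(\<forall>f\<in>E. lam (s + s') f = 1) \<longleftrightarrow> s = s'"
    using nondegenerate[of "s + s'"] assms by (auto simp: E_add add_eq_0_iff_B)
  ultimately show ?thesis by (simp add: lam_add_left)
qed

end

section \<open>Matrix representations\<close>

lemma GL_simps: "carrier (GL n) = Units (ring_mat TYPE(complex) n ())"
  "mult (GL n) = (*)" "one (GL n) = 1\<^sub>m n"
  by (simp_all add: GL_def units_of_def ring_mat_def)

lemma group_GL: "group (GL n)"
proof -
  interpret ring "ring_mat TYPE(complex) n ()" by (rule ring_mat)
  show ?thesis unfolding GL_def by (rule units_group)
qed

lemma rep_carrier: "representation G n \<rho> \<Longrightarrow> x \<in> carrier G \<Longrightarrow> \<rho> x \<in> carrier_mat n n"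
  by (auto simp: representation_def hom_def GL_simps Units_def ring_mat_simps)

lemma rep_mult:
  "representation G n \<rho> \<Longrightarrow> x \<in> carrier G \<Longrightarrow> y \<in> carrier G \<Longrightarrow> \<rho> (x \<otimes>\<^bsub>G\<^esub> y) = \<rho> x * \<rho> y"
  by (auto simp: representation_def hom_def GL_simps)

lemma rep_one: "group G \<Longrightarrow> representation G n \<rho> \<Longrightarrow> \<rho> \<one>\<^bsub>G\<^esub> = 1\<^sub>m n"
  using hom_one[of \<rho> G "GL n"] group_GL by (simp add: representation_def GL_simps)

lemma representationI:
  assumes G: "group G"
    and carr: "\<And>x. x \<in> carrier G \<Longrightarrow> \<rho> x \<in> carrier_mat n n"
    and mult: "\<And>x y. x \<in> carrier G \<Longrightarrow> y \<in> carrier G \<Longrightarrow> \<rho> (x \<otimes>\<^bsub>G\<^esub> y) = \<rho> x * \<rho> y"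
    and one: "\<rho> \<one>\<^bsub>G\<^esub> = 1\<^sub>m n"
  shows "representation G n \<rho>"
proof -
  interpret group G by fact
  have "\<rho> x \<in> Units (ring_mat TYPE(complex) n ())" if x: "x \<in> carrier G" for x
  proof -
    have "\<rho> (inv\<^bsub>G\<^esub> x) * \<rho> x = 1\<^sub>m n" "\<rho> x * \<rho> (inv\<^bsub>G\<^esub> x) = 1\<^sub>m n"
      using x by (simp_all add: one flip: mult)
    then show ?thesis using x carr[of x] carr[of "inv\<^bsub>G\<^esub> x"]
      by (auto simp: Units_def ring_mat_simps)
  qed
  then show ?thesis by (auto simp: representation_def hom_def GL_simps mult)
qed

lemma subspace_vec_iff:
  "VectorSpace.subspace class_ring W (module_vec TYPE(complex) n) \<longleftrightarrow>
     W \<subseteq> carrier_vec n \<and> 0\<^sub>v n \<in> W \<and> (\<forall>v\<in>W. \<forall>w\<in>W. v + w \<in> W) \<and> (\<forall>c. \<forall>v\<in>W. c \<cdot>\<^sub>v v \<in> W)"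
proof -
  interpret vec_space "TYPE(complex)" n .
  show ?thesis
    using vec_vs[of n, where 'a = complex] vec_module[of n, where 'a = complex]
    by (auto simp: VectorSpace.subspace_def submodule_def module_vec_simps)
qed

lemma mult_mat_vec_nth:
  "A \<in> carrier_mat n n \<Longrightarrow> v \<in> carrier_vec n \<Longrightarrow> i < n \<Longrightarrow> (A *\<^sub>v v) $ i = (\<Sum>j<n. A $$ (i, j) * v $ j)"
  by (auto simp: scalar_prod_def lessThan_atLeast0 intro!: sum.cong)

text \<open>The vectors \<open>w\<close> such that \<open>P\<close> holds on the whole orbit of \<open>w\<close> form an invariant subspace. It
  contains \<open>v \<noteq> 0\<close>, hence is everything. In this form irreducibility can be used for any linear
  condition, without writing vectors as combinations of the orbit of \<open>v\<close>.\<close>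

lemma irreducible_rep_induct:
  assumes G: "group G" and irr: "irreducible_rep G n \<rho>"
    and v: "v \<in> carrier_vec n" "v \<noteq> 0\<^sub>v n" and w: "w \<in> carrier_vec n"
    and zero: "P (0\<^sub>v n)"
    and add: "\<And>x y. x \<in> carrier_vec n \<Longrightarrow> y \<in> carrier_vec n \<Longrightarrow> P x \<Longrightarrow> P y \<Longrightarrow> P (x + y)"
    and smult: "\<And>c x. x \<in> carrier_vec n \<Longrightarrow> P x \<Longrightarrow> P (c \<cdot>\<^sub>v x)"
    and orbit: "\<And>x. x \<in> carrier G \<Longrightarrow> P (\<rho> x *\<^sub>v v)"
  shows "P w"
proof -
  interpret group G by fact
  have rep: "representation G n \<rho>" using irr by (simp add: irreducible_rep_def)
  note carr = rep_carrier[OF rep]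
  define W where "W = {w \<in> carrier_vec n. \<forall>x \<in> carrier G. P (\<rho> x *\<^sub>v w)}"
  have "VectorSpace.subspace class_ring W (module_vec TYPE(complex) n)"
  proof -
    have "\<rho> x *\<^sub>v 0\<^sub>v n = 0\<^sub>v n" if "x \<in> carrier G" for x
      using carr[OF that] by (intro eq_vecI) auto
    moreover have "P (\<rho> x *\<^sub>v (a + b))" if "x \<in> carrier G" "a \<in> W" "b \<in> W" for x a b
      using that carr[OF that(1)]
      by (subst mult_add_distrib_mat_vec[of _ n n]) (auto simp: W_def intro!: add)
    moreover have "P (\<rho> x *\<^sub>v (c \<cdot>\<^sub>v a))" if "x \<in> carrier G" "a \<in> W" for x c a
      using that carr[OF that(1)]
      by (subst mult_mat_vec[of _ n n]) (auto simp: W_def intro!: smult)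
    ultimately show ?thesis
      unfolding subspace_vec_iff by (auto simp: W_def zero)
  qed
  moreover have "\<rho> x *\<^sub>v u \<in> W" if "x \<in> carrier G" "u \<in> W" for x u
  proof -
    have "\<rho> y *\<^sub>v (\<rho> x *\<^sub>v u) = \<rho> (y \<otimes>\<^bsub>G\<^esub> x) *\<^sub>v u" if "y \<in> carrier G" for y
      using that \<open>x \<in> carrier G\<close> \<open>u \<in> W\<close> carr[of x] carr[of y]
      by (subst rep_mult[OF rep]) (auto simp: W_def assoc_mult_mat_vec[of _ n n _ n])
    then show ?thesis using that carr[of x] by (auto simp: W_def)
  qed
  ultimately have "W = {0\<^sub>v n} \<or> W = carrier_vec n"
    using irr unfolding irreducible_rep_def by blast
  moreover have "v \<in> W" using v orbit by (simp add: W_def)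
  ultimately have "w \<in> W" using v w by auto
  then have "P (\<rho> \<one>\<^bsub>G\<^esub> *\<^sub>v w)" by (simp add: W_def)
  then show ?thesis using w by (simp add: rep_one[OF G rep])
qed

text \<open>One involution \<open>M\<close> is treated at a time: \<open>v + M v\<close> is fixed by \<open>M\<close>, unless it is 0 and then
  \<open>M v = - v\<close>. Because the involutions commute, eigenvalues obtained earlier persist. The predicate \<open>P\<close>
  carries along further conditions, such as lying in a weight space.\<close>

lemma common_sign_eigenvector:
  fixes X :: "complex mat set"
  assumes fin: "finite X" and X: "X \<subseteq> carrier_mat n n"
    and invol: "\<And>M. M \<in> X \<Longrightarrow> M * M = 1\<^sub>m n"
    and comm: "\<And>M N. M \<in> X \<Longrightarrow> N \<in> X \<Longrightarrow> M * N = N * M"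
    and carr: "\<And>v. P v \<Longrightarrow> v \<in> carrier_vec n"
    and closed: "\<And>M v. M \<in> X \<Longrightarrow> P v \<Longrightarrow> P (v + M *\<^sub>v v)"
    and v0: "P v0" "v0 \<noteq> 0\<^sub>v n"
  shows "\<exists>v. P v \<and> v \<noteq> 0\<^sub>v n \<and> (\<forall>M\<in>X. \<exists>c. (c = 1 \<or> c = -1) \<and> M *\<^sub>v v = c \<cdot>\<^sub>v v)"
proof -
  have "\<exists>v. P v \<and> v \<noteq> 0\<^sub>v n \<and> (\<forall>M\<in>Y. \<exists>c. (c = 1 \<or> c = -1) \<and> M *\<^sub>v v = c \<cdot>\<^sub>v v)" if "Y \<subseteq> X" for Y
    using finite_subset[OF that fin] that
  proof (induction Y rule: finite_induct)
    case empty
    then show ?case using v0 by auto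
  next
    case (insert M Y)
    then obtain v where v: "P v" "v \<noteq> 0\<^sub>v n"
      and eig: "\<And>N. N \<in> Y \<Longrightarrow> \<exists>c. (c = 1 \<or> c = -1) \<and> N *\<^sub>v v = c \<cdot>\<^sub>v v" by blast
    have M: "M \<in> carrier_mat n n" "M \<in> X" using insert.prems X by auto
    note vc = carr[OF v(1)]
    have Mv: "M *\<^sub>v v \<in> carrier_vec n" using M vc by simp
    define w where "w = v + M *\<^sub>v v"
    show ?case
    proof (cases "w = 0\<^sub>v n")
      case True
      have "M *\<^sub>v v = (-1) \<cdot>\<^sub>v v"
      proof (rule eq_vecI)
        fix i assume "i < dim_vec ((-1) \<cdot>\<^sub>v v)"
        then have i: "i < n" using vc by simp
        have "w $ i = 0" using True i by simp
        then show "(M *\<^sub>v v) $ i = ((-1) \<cdot>\<^sub>v v) $ i"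
          using i vc Mv M by (simp add: w_def add_eq_0_iff del: index_mult_mat_vec)
      qed (use M vc in auto)
      then show ?thesis using v eig by blast
    next
      case False
      have "M *\<^sub>v w = M *\<^sub>v v + M *\<^sub>v (M *\<^sub>v v)"
        unfolding w_def by (rule mult_add_distrib_mat_vec[OF M(1) vc Mv])
      also have "M *\<^sub>v (M *\<^sub>v v) = v"
        using assoc_mult_mat_vec[OF M(1) M(1) vc] invol[OF M(2)] vc by simp
      also have "M *\<^sub>v v + v = w"
        unfolding w_def by (rule comm_add_vec[OF Mv vc])
      finally have "M *\<^sub>v w = 1 \<cdot>\<^sub>v w" by simp
      moreover have "\<exists>c. (c = 1 \<or> c = -1) \<and> N *\<^sub>v w = c \<cdot>\<^sub>v w" if NY: "N \<in> Y" for N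
      proof -
        have N: "N \<in> carrier_mat n n" "N \<in> X" using insert.prems X NY by auto
        obtain c where c: "c = 1 \<or> c = -1" "N *\<^sub>v v = c \<cdot>\<^sub>v v" using eig[OF NY] by blast
        have "N *\<^sub>v w = N *\<^sub>v v + N *\<^sub>v (M *\<^sub>v v)"
          unfolding w_def by (rule mult_add_distrib_mat_vec[OF N(1) vc Mv])
        also have "N *\<^sub>v (M *\<^sub>v v) = M *\<^sub>v (N *\<^sub>v v)"
          using assoc_mult_mat_vec[OF M(1) N(1) vc] assoc_mult_mat_vec[OF N(1) M(1) vc]
            comm[OF M(2) N(2)] by simp
        also have "M *\<^sub>v (N *\<^sub>v v) = c \<cdot>\<^sub>v (M *\<^sub>v v)"
          unfolding c(2) using M vc by (simp add: mult_mat_vec[of _ n n])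
        also have "N *\<^sub>v v + c \<cdot>\<^sub>v (M *\<^sub>v v) = c \<cdot>\<^sub>v w"
          unfolding c(2) w_def by (rule smult_add_distrib_vec[OF vc Mv, symmetric])
        finally show ?thesis using c(1) by blast
      qed
      moreover have "P w" unfolding w_def by (rule closed[OF M(2) v(1)])
      ultimately show ?thesis using False by blast
    qed
  qed
  then show ?thesis by blast
qed

section \<open>Irreducible characters of the fixed-point groups\<close>

definition sign_character :: "V set \<Rightarrow> (V \<Rightarrow> complex) \<Rightarrow> bool" where
  "sign_character S \<mu> \<longleftrightarrow>
     (\<forall>t\<in>S. \<mu> t = 1 \<or> \<mu> t = -1) \<and> (\<forall>t\<in>S. \<forall>u\<in>S. \<mu> (t + u) = \<mu> t * \<mu> u)"

context odd_automorphism
begin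

definition H :: "(B \<times> V) monoid" where "H = BV\<lparr>carrier := E \<times> Q\<rparr>"

definition stab :: "B \<Rightarrow> V set" where "stab s = {t \<in> Q. translate t s = s}"

text \<open>The character induced from \<open>E \<rtimes> stab s\<close> of the extension of \<open>\<lambda>\<^sub>s\<close> by \<open>\<mu>\<close>. The sum over
  representatives of \<open>Q / stab s\<close> is replaced by a sum over \<open>Q\<close> divided by the order of the stabiliser.\<close>

definition chi :: "B \<Rightarrow> (V \<Rightarrow> complex) \<Rightarrow> B \<times> V \<Rightarrow> complex" where
  "chi s \<mu> = (\<lambda>(f, t) \<in> E \<times> Q. if t \<in> stab s
     then \<mu> t * (\<Sum>r\<in>Q. lam s (translate r f)) / of_nat (card (stab s)) else 0)"

lemma H_simps [simp]: "carrier H = E \<times> Q" "\<one>\<^bsub>H\<^esub> = (0, 0)"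
  "(f, t) \<otimes>\<^bsub>H\<^esub> (h, u) = (f + translate t h, t + u)"
  by (simp_all add: H_def BV_def)

lemma group_H: "group H"
proof (rule groupI)
  fix x assume "x \<in> carrier H"
  then obtain f t where x: "x = (f, t)" "f \<in> E" "t \<in> Q" by auto
  have "(translate t f, t) \<otimes>\<^bsub>H\<^esub> x = \<one>\<^bsub>H\<^esub>" by (simp only: x H_simps add_self_B add_self_V)
  then show "\<exists>y\<in>carrier H. y \<otimes>\<^bsub>H\<^esub> x = \<one>\<^bsub>H\<^esub>" using x E_translate[OF x(2,3)]
    by (intro bexI[of _ "(translate t f, t)"]) auto
next
  fix x y z assume "x \<in> carrier H" "y \<in> carrier H" "z \<in> carrier H"
  then show "x \<otimes>\<^bsub>H\<^esub> y \<otimes>\<^bsub>H\<^esub> z = x \<otimes>\<^bsub>H\<^esub> (y \<otimes>\<^bsub>H\<^esub> z)"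
    by (cases x; cases y; cases z) (simp only: H_simps translate_add translate_translate add.assoc)
next
  fix x y assume "x \<in> carrier H" "y \<in> carrier H"
  then obtain f t h u where "x = (f, t)" "y = (h, u)" "f \<in> E" "h \<in> E" "t \<in> Q" "u \<in> Q" by auto
  then show "x \<otimes>\<^bsub>H\<^esub> y \<in> carrier H"
    by (simp add: E_add E_translate Q_add)
qed (auto simp: E_0 Q_0)

lemma stab_subset: "stab s \<subseteq> Q" and stab_0: "0 \<in> stab s"
  and stab_add: "t \<in> stab s \<Longrightarrow> u \<in> stab s \<Longrightarrow> t + u \<in> stab s"
  and stab_translate: "t \<in> stab s \<Longrightarrow> translate t s = s"
  by (auto simp: stab_def Q_0 Q_add simp flip: translate_translate)

lemma finite_stab [simp]: "finite (stab s)"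
  by simp

lemma card_stab_nonzero: "card (stab s) \<noteq> 0"
  using stab_0 by (auto simp: card_eq_0_iff)

lemma stab_translate_eq: "stab (translate r s) = stab s"
proof -
  have "translate t (translate r s) = translate r s \<longleftrightarrow> translate t s = s" for t
    by (metis add.commute add_self_V translate_0(1) translate_translate)
  then show ?thesis by (simp add: stab_def)
qed

text \<open>Fourier inversion at 0: the coefficients of \<open>c\<close> have a nonzero sum. A nonzero coefficient
  at \<open>s\<close> means that \<open>c \<cdot> \<lambda>\<^sub>s\<close> is the trivial character.\<close>

lemma sign_hom_eq_lam:
  assumes c: "\<And>f. f \<in> E \<Longrightarrow> c f = 1 \<or> c f = -1"
    and mult: "\<And>f h. f \<in> E \<Longrightarrow> h \<in> E \<Longrightarrow> c (f + h) = c f * c h"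
  obtains s where "s \<in> E" "\<And>f. f \<in> E \<Longrightarrow> c f = lam s f"
proof -
  have c0: "c 0 = 1" using mult[OF E_0 E_0] c[OF E_0] by auto
  have "(\<Sum>s\<in>E. \<Sum>f\<in>E. c f * lam s f) = (\<Sum>f\<in>E. c f * (\<Sum>s\<in>E. lam f s * lam 0 s))"
    by (subst sum.swap) (simp add: sum_distrib_left lam_commute)
  also have "\<dots> = (\<Sum>f\<in>E. if f = 0 then of_nat (card E) else 0)"
    by (rule sum.cong) (simp_all add: orthogonality E_0 c0 del: lam_0)
  also have "\<dots> = of_nat (card E)" by (simp add: E_0)
  finally obtain s where s: "s \<in> E" "(\<Sum>f\<in>E. c f * lam s f) \<noteq> 0"
    using card_E_nonzero by (metis (mono_tags, lifting) of_nat_eq_0_iff sum.neutral)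
  have "(\<Sum>f\<in>E. c f * lam s f) = (if \<forall>f\<in>E. c f * lam s f = 1 then of_nat (card E) else 0)"
    by (rule sum_sign_subgroup) (auto simp: E_add lam_add mult)
  then have "\<forall>f\<in>E. c f * lam s f = 1" using s(2) by meson
  then have "c f = lam s f" if "f \<in> E" for f
    using that c[OF that] lam_mult_self[of s f] by (metis mult_cancel_right lam_nonzero)
  then show thesis using s(1) that by blast
qed

text \<open>Clifford theory by hand. Let \<open>v\<close> be a common eigenvector of \<open>E\<close>, of weight \<open>\<lambda>\<^sub>s\<close>, and of \<open>stab s\<close>,
  with eigenvalues \<open>\<mu>\<close>. The vectors \<open>v\<^sub>r = \<rho>(0, r) v\<close> have weights \<open>\<lambda>\<close> at the translates of \<open>s\<close>, and
  the space of weight \<open>\<lambda>\<^sub>s\<close> is the line of \<open>v\<close>. So the projection to that space is \<open>w \<mapsto> d(w) v\<close> for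
  a linear functional \<open>d\<close>, whose conjugates \<open>w \<mapsto> d(\<rho>(0, r) w) v\<^sub>r\<close> sum over \<open>r \<in> Q\<close> to the order of
  \<open>stab s\<close> times the identity. Traces are thus sums of values of \<open>d\<close>, and those are known on the \<open>v\<^sub>r\<close>.\<close>

lemma irreducible_character:
  assumes irr: "irreducible_rep H n \<rho>"
  obtains s \<mu> where "s \<in> E" "sign_character (stab s) \<mu>"
    "(\<lambda>x \<in> carrier H. mat_trace (\<rho> x)) = chi s \<mu>"
proof -
  have rep: "representation H n \<rho>" and n: "n > 0" using irr by (auto simp: irreducible_rep_def)
  have carr [simp, intro]: "\<rho> (f, t) \<in> carrier_mat n n" if "f \<in> E" "t \<in> Q" for f t
    using rep_carrier[OF rep] that by simp
  have mult: "\<rho> (f, t) * \<rho> (h, u) = \<rho> (f + translate t h, t + u)"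
    if "f \<in> E" "t \<in> Q" "h \<in> E" "u \<in> Q" for f t h u
    using rep_mult[OF rep, of "(f, t)" "(h, u)"] that by simp
  have one: "\<rho> (0, 0) = 1\<^sub>m n" using rep_one[OF group_H rep] by simp
  have multv: "\<rho> (f, t) *\<^sub>v (\<rho> (h, u) *\<^sub>v w) = \<rho> (f + translate t h, t + u) *\<^sub>v w"
    if "f \<in> E" "t \<in> Q" "h \<in> E" "u \<in> Q" "w \<in> carrier_vec n" for f t h u w
    using that by (metis assoc_mult_mat_vec carr mult)

  \<comment> \<open>an eigenvector \<open>v1\<close> of \<open>E\<close>; its eigenvalues form a character, which has the form \<open>\<lambda>\<^sub>s\<close>\<close>
  have "\<exists>v. v \<in> carrier_vec n \<and> v \<noteq> 0\<^sub>v n \<and>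
      (\<forall>M\<in>(\<lambda>f. \<rho> (f, 0)) ` E. \<exists>c. (c = 1 \<or> c = -1) \<and> M *\<^sub>v v = c \<cdot>\<^sub>v v)"
  proof (rule common_sign_eigenvector[of _ n "\<lambda>v. v \<in> carrier_vec n" "unit_vec n 0"])
    show "unit_vec n 0 \<noteq> (0\<^sub>v n :: complex vec)"
      using n by (metis index_unit_vec(1) index_zero_vec(1) zero_neq_one)
  qed (auto simp: mult Q_0 one add.commute intro!: add_carrier_vec mult_mat_vec_carrier[of _ n n])
  then obtain v1 where v1: "v1 \<in> carrier_vec n" "v1 \<noteq> 0\<^sub>v n"
    and "\<forall>f\<in>E. \<exists>c. (c = 1 \<or> c = -1) \<and> \<rho> (f, 0) *\<^sub>v v1 = c \<cdot>\<^sub>v v1" by auto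
  then obtain c where c: "\<And>f. f \<in> E \<Longrightarrow> c f = 1 \<or> c f = -1"
      "\<And>f. f \<in> E \<Longrightarrow> \<rho> (f, 0) *\<^sub>v v1 = c f \<cdot>\<^sub>v v1" by metis
  have zero_smult: "0 \<cdot>\<^sub>v w = 0\<^sub>v n" if "w \<in> carrier_vec n" for w :: "complex vec"
    using that by (intro eq_vecI) auto
  have smult_cancel: "a = b" if eq: "a \<cdot>\<^sub>v w = b \<cdot>\<^sub>v w" and w: "w \<in> carrier_vec n" "w \<noteq> 0\<^sub>v n"
    for a b :: complex and w
  proof -
    obtain i where "i < n" "w $ i \<noteq> 0"
      using w by (metis carrier_vecD eq_vecI index_zero_vec)
    moreover have "(a \<cdot>\<^sub>v w) $ i = (b \<cdot>\<^sub>v w) $ i" using eq by simp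
    ultimately show ?thesis using w(1) by simp
  qed
  have "c (f + h) = c f * c h" if "f \<in> E" "h \<in> E" for f h
  proof (rule smult_cancel[OF _ v1])
    have "c (f + h) \<cdot>\<^sub>v v1 = \<rho> (f, 0) *\<^sub>v (\<rho> (h, 0) *\<^sub>v v1)"
      using that v1 by (simp add: c(2)[symmetric] multv Q_0 E_add)
    also have "\<dots> = (c f * c h) \<cdot>\<^sub>v v1"
      using that v1 by (simp add: c(2) Q_0 mult_mat_vec[of _ n n] smult_smult_assoc mult.commute)
    finally show "c (f + h) \<cdot>\<^sub>v v1 = (c f * c h) \<cdot>\<^sub>v v1" .
  qed
  then obtain s where s: "s \<in> E" and cs: "\<And>f. f \<in> E \<Longrightarrow> c f = lam s f"
    using sign_hom_eq_lam[of c] c(1) by metis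

  \<comment> \<open>the stabiliser preserves the space of weight \<open>\<lambda>\<^sub>s\<close>, so an eigenvector of it can be found there\<close>
  define P where "P v \<longleftrightarrow> v \<in> carrier_vec n \<and> (\<forall>f\<in>E. \<rho> (f, 0) *\<^sub>v v = lam s f \<cdot>\<^sub>v v)" for v
  have weight: "\<rho> (f, t) *\<^sub>v (\<rho> (0, r) *\<^sub>v v) = lam (translate (r + t) s) f \<cdot>\<^sub>v (\<rho> (0, r + t) *\<^sub>v v)"
    if "f \<in> E" "t \<in> Q" "r \<in> Q" "P v" for f t r v
  proof -
    have v: "v \<in> carrier_vec n" using that(4) by (simp add: P_def)
    have "\<rho> (f, t) *\<^sub>v (\<rho> (0, r) *\<^sub>v v) = \<rho> (0, r + t) *\<^sub>v (\<rho> (translate (r + t) f, 0) *\<^sub>v v)"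
      using that v by (simp add: multv E_0 Q_0 Q_add E_translate add.commute)
    also have "\<dots> = \<rho> (0, r + t) *\<^sub>v (lam (translate (r + t) s) f \<cdot>\<^sub>v v)"
      using that by (simp add: P_def E_translate Q_add lam_translate)
    finally show ?thesis using that v by (simp add: mult_mat_vec[of _ n n] E_0 Q_add)
  qed
  have "\<exists>v. P v \<and> v \<noteq> 0\<^sub>v n \<and>
      (\<forall>M\<in>(\<lambda>t. \<rho> (0, t)) ` stab s. \<exists>c. (c = 1 \<or> c = -1) \<and> M *\<^sub>v v = c \<cdot>\<^sub>v v)"
  proof (rule common_sign_eigenvector[of _ n P v1])
    show "P v1" using v1 c cs by (simp add: P_def)
    fix M v assume "M \<in> (\<lambda>t. \<rho> (0, t)) ` stab s" and v: "P v"
    then obtain t where t: "t \<in> Q" "translate t s = s" "M = \<rho> (0, t)"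
      by (auto simp: stab_def)
    have vc: "v \<in> carrier_vec n" using v by (simp add: P_def)
    have "\<rho> (f, 0) *\<^sub>v (v + M *\<^sub>v v) = lam s f \<cdot>\<^sub>v (v + M *\<^sub>v v)" if "f \<in> E" for f
    proof -
      have Mv: "M *\<^sub>v v \<in> carrier_vec n"
        using t vc E_0 mult_mat_vec_carrier[OF carr[OF E_0 t(1)] vc] by simp
      have "\<rho> (f, 0) *\<^sub>v v = lam s f \<cdot>\<^sub>v v" using v that by (simp add: P_def)
      moreover have "\<rho> (f, 0) *\<^sub>v (M *\<^sub>v v) = lam s f \<cdot>\<^sub>v (M *\<^sub>v v)"
        using weight[OF that Q_0 t(1) v] t by simp
      ultimately show ?thesis
        using mult_add_distrib_mat_vec[OF carr[OF that Q_0] vc Mv] smult_add_distrib_vec[OF vc Mv]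
        by simp
    qed
    moreover have "v + M *\<^sub>v v \<in> carrier_vec n"
      using mult_mat_vec_carrier[OF carr[OF E_0 t(1)] vc] vc t(3) by simp
    ultimately show "P (v + M *\<^sub>v v)" by (simp add: P_def)
  qed (use v1 stab_subset in \<open>auto simp: mult E_0 Q_0 one add.commute P_def subset_eq\<close>)
  then obtain v where Pv: "P v" and v0: "v \<noteq> 0\<^sub>v n"
    and "\<forall>t\<in>stab s. \<exists>c. (c = 1 \<or> c = -1) \<and> \<rho> (0, t) *\<^sub>v v = c \<cdot>\<^sub>v v" by auto
  then obtain \<mu> where \<mu>: "\<And>t. t \<in> stab s \<Longrightarrow> \<mu> t = 1 \<or> \<mu> t = -1"
    "\<And>t. t \<in> stab s \<Longrightarrow> \<rho> (0, t) *\<^sub>v v = \<mu> t \<cdot>\<^sub>v v" by metis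
  have v: "v \<in> carrier_vec n" using Pv by (simp add: P_def)
  have \<mu>_add: "\<mu> (t + u) = \<mu> t * \<mu> u" if "t \<in> stab s" "u \<in> stab s" for t u
  proof (rule smult_cancel[OF _ v v0])
    have tu: "t \<in> Q" "u \<in> Q" using that stab_subset by auto
    have "\<mu> (t + u) \<cdot>\<^sub>v v = \<rho> (0, t) *\<^sub>v (\<rho> (0, u) *\<^sub>v v)"
      using that tu v by (simp add: \<mu>(2)[symmetric] multv E_0 stab_add)
    also have "\<dots> = (\<mu> t * \<mu> u) \<cdot>\<^sub>v v"
      using that tu v by (simp add: \<mu>(2) E_0 mult_mat_vec[of _ n n] smult_smult_assoc mult.commute)
    finally show "\<mu> (t + u) \<cdot>\<^sub>v v = (\<mu> t * \<mu> u) \<cdot>\<^sub>v v" .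
  qed
  define vr where "vr r = \<rho> (0, r) *\<^sub>v v" for r
  have vr [simp]: "vr r \<in> carrier_vec n" if "r \<in> Q" for r
    using that v by (auto simp: vr_def E_0 intro!: mult_mat_vec_carrier[of _ n n])
  have vr_smult_nth: "(a \<cdot>\<^sub>v vr r) $ i = a * vr r $ i" if "r \<in> Q" "i < n" for a r i
  proof -
    have "i < dim_vec (vr r)" using carrier_vecD[OF vr[OF that(1)]] that(2) by (simp only:)
    then show ?thesis by (rule index_smult_vec(1))
  qed
  have vr_weight: "\<rho> (f, t) *\<^sub>v vr r = lam (translate (r + t) s) f \<cdot>\<^sub>v vr (r + t)"
    if "f \<in> E" "t \<in> Q" "r \<in> Q" for f t r
    using weight[OF that Pv] by (simp add: vr_def)
  have vr0: "vr 0 = v" using v by (simp add: vr_def one)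
  have vr_stab: "vr (r + t) = \<mu> t \<cdot>\<^sub>v vr r" if "t \<in> stab s" "r \<in> Q" for r t
  proof -
    have t: "t \<in> Q" using that stab_subset by auto
    have "vr (r + t) = \<rho> (0, r) *\<^sub>v (\<rho> (0, t) *\<^sub>v v)"
      using that t v by (simp add: vr_def multv E_0)
    then show ?thesis using that v by (simp add: \<mu>(2) vr_def mult_mat_vec[of _ n n] E_0)
  qed

  \<comment> \<open>\<open>av\<close> is the projection to the space of weight \<open>\<lambda>\<^sub>s\<close>, scaled by the order of \<open>E\<close>\<close>
  define av where "av w = vec n (\<lambda>i. \<Sum>f\<in>E. lam s f * (\<rho> (f, 0) *\<^sub>v w) $ i)" for w
  have av_carr [simp]: "av w \<in> carrier_vec n" for w by (simp add: av_def)
  have av_add: "av (x + y) = av x + av y" if "x \<in> carrier_vec n" "y \<in> carrier_vec n" for x y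
    using that by (intro eq_vecI)
      (simp_all add: av_def mult_add_distrib_mat_vec[of _ n n] carr Q_0 distrib_left sum.distrib
        del: index_mult_mat_vec, simp add: sum.distrib distrib_left carrier_matD[OF carr] Q_0)
  have av_smult: "av (a \<cdot>\<^sub>v x) = a \<cdot>\<^sub>v av x" if "x \<in> carrier_vec n" for a x
    using that by (intro eq_vecI)
      (simp_all add: av_def mult_mat_vec[of _ n n] carr Q_0 sum_distrib_left mult.left_commute
        carrier_matD[OF carr])
  have av_vr: "av (vr r) = (if r \<in> stab s then of_nat (card E) * \<mu> r else 0) \<cdot>\<^sub>v v"
    if "r \<in> Q" for r
  proof (rule eq_vecI)
    fix i assume "i < dim_vec ((if r \<in> stab s then of_nat (card E) * \<mu> r else 0) \<cdot>\<^sub>v v)"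
    then have i: "i < n" using v by simp
    have "av (vr r) $ i = (\<Sum>f\<in>E. lam s f * lam (translate r s) f) * vr r $ i"
      using i that by (simp add: av_def vr_weight Q_0 sum_distrib_right mult.assoc carrier_vecD[OF vr]
        del: index_mult_mat_vec)
    also have "\<dots> = (if translate r s = s then of_nat (card E) else 0) * vr r $ i"
      using that s by (auto simp: orthogonality E_translate)
    also have "\<dots> = ((if r \<in> stab s then of_nat (card E) * \<mu> r else 0) \<cdot>\<^sub>v v) $ i"
      using i that v vr_stab[of r 0] by (auto simp: stab_def vr0 Q_0)
    finally show "av (vr r) $ i = ((if r \<in> stab s then of_nat (card E) * \<mu> r else 0) \<cdot>\<^sub>v v) $ i" .
  qed (use v in simp_all)
  have "\<exists>a. av w = a \<cdot>\<^sub>v v" if "w \<in> carrier_vec n" for w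
  proof (rule irreducible_rep_induct[OF group_H irr v v0 that])
    have "av (0\<^sub>v n) = 0 \<cdot>\<^sub>v v"
      using av_smult[OF v, of 0] by (simp only: zero_smult[OF v] zero_smult[OF av_carr])
    then show "\<exists>a. av (0\<^sub>v n) = a \<cdot>\<^sub>v v" by blast
  next
    fix x y assume "x \<in> carrier_vec n" "y \<in> carrier_vec n" "\<exists>a. av x = a \<cdot>\<^sub>v v" "\<exists>a. av y = a \<cdot>\<^sub>v v"
    then show "\<exists>a. av (x + y) = a \<cdot>\<^sub>v v" by (auto simp: av_add simp flip: add_smult_distrib_vec)
  next
    fix b x assume "x \<in> carrier_vec n" "\<exists>a. av x = a \<cdot>\<^sub>v v"
    then show "\<exists>a. av (b \<cdot>\<^sub>v x) = a \<cdot>\<^sub>v v" by (auto simp: av_smult smult_smult_assoc)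
  next
    fix x assume "x \<in> carrier H"
    then obtain f t where x: "x = (f, t)" "f \<in> E" "t \<in> Q" by auto
    have "\<rho> x *\<^sub>v v = lam (translate t s) f \<cdot>\<^sub>v vr t"
      using vr_weight[of f t 0] x Q_0 by (simp add: vr0)
    then show "\<exists>a. av (\<rho> x *\<^sub>v v) = a \<cdot>\<^sub>v v"
      using x by (auto simp: av_smult av_vr smult_smult_assoc)
  qed
  then obtain d0 where d0: "\<And>w. w \<in> carrier_vec n \<Longrightarrow> av w = d0 w \<cdot>\<^sub>v v" by metis
  define d where "d w = d0 w / of_nat (card E)" for w
  have d_add: "d (x + y) = d x + d y" if "x \<in> carrier_vec n" "y \<in> carrier_vec n" for x y
  proof -
    have "d0 (x + y) = d0 x + d0 y"
    proof (rule smult_cancel[OF _ v v0])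
      show "d0 (x + y) \<cdot>\<^sub>v v = (d0 x + d0 y) \<cdot>\<^sub>v v"
        using that by (simp add: d0[symmetric] av_add add_smult_distrib_vec)
    qed
    then show ?thesis by (simp add: d_def add_divide_distrib)
  qed
  have d_smult: "d (a \<cdot>\<^sub>v x) = a * d x" if "x \<in> carrier_vec n" for a x
  proof -
    have "d0 (a \<cdot>\<^sub>v x) = a * d0 x"
    proof (rule smult_cancel[OF _ v v0])
      show "d0 (a \<cdot>\<^sub>v x) \<cdot>\<^sub>v v = (a * d0 x) \<cdot>\<^sub>v v"
        using that by (simp add: d0[symmetric] av_smult smult_smult_assoc[symmetric])
    qed
    then show ?thesis by (simp add: d_def)
  qed
  have d_vr: "d (vr r) = (if r \<in> stab s then \<mu> r else 0)" if "r \<in> Q" for r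
  proof -
    have "d0 (vr r) = (if r \<in> stab s then of_nat (card E) * \<mu> r else 0)"
      by (rule smult_cancel[OF _ v v0]) (use that in \<open>simp add: d0[symmetric] av_vr\<close>)
    then show ?thesis using card_E_nonzero by (simp add: d_def)
  qed

  \<comment> \<open>in coordinates: the conjugates of the projection sum to a multiple of the identity\<close>
  have resolution: "(\<Sum>r\<in>Q. d (\<rho> (0, r) *\<^sub>v w) * vr r $ i) = of_nat (card (stab s)) * w $ i"
    if w: "w \<in> carrier_vec n" and i: "i < n" for w i
  proof (rule irreducible_rep_induct[OF group_H irr v v0 w])
    have "d (0\<^sub>v n) = 0" using d_smult[OF v, of 0] by (simp only: zero_smult[OF v] mult_zero_left)
    then have "d (\<rho> (0, r) *\<^sub>v 0\<^sub>v n) = 0" if "r \<in> Q" for r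
    proof -
      have "\<rho> (0, r) *\<^sub>v 0\<^sub>v n = 0\<^sub>v n" using carr[OF E_0 that] by (intro eq_vecI) auto
      then show ?thesis using \<open>d (0\<^sub>v n) = 0\<close> by simp
    qed
    then show "(\<Sum>r\<in>Q. d (\<rho> (0, r) *\<^sub>v 0\<^sub>v n) * vr r $ i) = of_nat (card (stab s)) * 0\<^sub>v n $ i"
      using i by simp
  next
    fix x y assume *: "x \<in> carrier_vec n" "y \<in> carrier_vec n"
      "(\<Sum>r\<in>Q. d (\<rho> (0, r) *\<^sub>v x) * vr r $ i) = of_nat (card (stab s)) * x $ i"
      "(\<Sum>r\<in>Q. d (\<rho> (0, r) *\<^sub>v y) * vr r $ i) = of_nat (card (stab s)) * y $ i"
    have "d (\<rho> (0, r) *\<^sub>v (x + y)) = d (\<rho> (0, r) *\<^sub>v x) + d (\<rho> (0, r) *\<^sub>v y)" if "r \<in> Q" for r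
      using * carr[OF E_0 that]
      by (simp add: mult_add_distrib_mat_vec[of _ n n] d_add)
    then show "(\<Sum>r\<in>Q. d (\<rho> (0, r) *\<^sub>v (x + y)) * vr r $ i) = of_nat (card (stab s)) * (x + y) $ i"
      using * i by (simp add: distrib_right sum.distrib distrib_left)
  next
    fix a x assume *: "x \<in> carrier_vec n"
      "(\<Sum>r\<in>Q. d (\<rho> (0, r) *\<^sub>v x) * vr r $ i) = of_nat (card (stab s)) * x $ i"
    have "d (\<rho> (0, r) *\<^sub>v (a \<cdot>\<^sub>v x)) = a * d (\<rho> (0, r) *\<^sub>v x)" if "r \<in> Q" for r
      using * carr[OF E_0 that] by (simp add: mult_mat_vec[of _ n n] d_smult)
    then have "(\<Sum>r\<in>Q. d (\<rho> (0, r) *\<^sub>v (a \<cdot>\<^sub>v x)) * vr r $ i) =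
        a * (\<Sum>r\<in>Q. d (\<rho> (0, r) *\<^sub>v x) * vr r $ i)"
      by (simp add: sum_distrib_left mult.assoc)
    then show "(\<Sum>r\<in>Q. d (\<rho> (0, r) *\<^sub>v (a \<cdot>\<^sub>v x)) * vr r $ i) = of_nat (card (stab s)) * (a \<cdot>\<^sub>v x) $ i"
      using * i by simp
  next
    fix x assume "x \<in> carrier H"
    then obtain f t where x: "x = (f, t)" and f: "f \<in> E" and t: "t \<in> Q" by auto
    have gv: "\<rho> x *\<^sub>v v = lam (translate t s) f \<cdot>\<^sub>v vr t"
      using vr_weight[of f t 0] x f t Q_0 by (simp add: vr0)
    have "(\<Sum>r\<in>Q. d (\<rho> (0, r) *\<^sub>v vr t) * vr r $ i) = (\<Sum>r\<in>Q. d (vr (t + r)) * vr r $ i)"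
      using t by (simp add: vr_weight E_0)
    also have "\<dots> = (\<Sum>r\<in>Q. if t + r \<in> stab s then vr t $ i else 0)"
    proof (rule sum.cong)
      fix r assume r: "r \<in> Q"
      have "\<mu> (t + r) * vr r $ i = vr t $ i" if "t + r \<in> stab s"
      proof -
        have "vr t = vr (r + (t + r))" by (metis add.commute add_self_left_V)
        also have "\<dots> = \<mu> (t + r) \<cdot>\<^sub>v vr r" using that r by (rule vr_stab)
        finally show ?thesis using i r by (simp add: vr_smult_nth)
      qed
      then show "d (vr (t + r)) * vr r $ i = (if t + r \<in> stab s then vr t $ i else 0)"
        using r t by (simp add: d_vr Q_add)
    qed simp
    also have "\<dots> = (\<Sum>r\<in>stab s. vr t $ i)"
      unfolding sum.inter_filter[OF finite_Q, symmetric]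
      by (rule sum.reindex_bij_witness[of _ "\<lambda>r. t + r" "\<lambda>r. t + r"])
        (use t stab_subset in \<open>auto intro!: Q_add\<close>)
    finally show "(\<Sum>r\<in>Q. d (\<rho> (0, r) *\<^sub>v (\<rho> x *\<^sub>v v)) * vr r $ i) =
        of_nat (card (stab s)) * (\<rho> x *\<^sub>v v) $ i"
      using i t
      by (simp add: gv vr_smult_nth mult_mat_vec[of _ n n] carr E_0 d_smult mult_mat_vec_carrier[of _ n n]
          mult.assoc sum_distrib_left[symmetric])
  qed

  \<comment> \<open>inserting this resolution of the identity into a trace leaves only values of \<open>d\<close>\<close>
  have d_sum: "d w = (\<Sum>j<n. d (unit_vec n j) * w $ j)" if "w \<in> carrier_vec n" for w
  proof -
    have "d (vec n (\<lambda>i. if i < k then w $ i else 0)) = (\<Sum>j<k. d (unit_vec n j) * w $ j)"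
      if "k \<le> n" for k
      using that
    proof (induction k)
      case 0
      have "vec n (\<lambda>i. if i < 0 then w $ i else 0) = 0 \<cdot>\<^sub>v v" using v by (intro eq_vecI) auto
      then have "d (vec n (\<lambda>i. if i < 0 then w $ i else 0)) = 0 * d v"
        by (simp only: d_smult[OF v])
      then show ?case by simp
    next
      case (Suc k)
      have "vec n (\<lambda>i. if i < Suc k then w $ i else 0) =
          vec n (\<lambda>i. if i < k then w $ i else 0) + w $ k \<cdot>\<^sub>v unit_vec n k"
        using Suc.prems by (intro eq_vecI) (auto simp: less_Suc_eq)
      then show ?case using Suc by (simp add: d_add d_smult mult.commute)
    qed
    from this[of n] have "d (vec n (\<lambda>i. if i < n then w $ i else 0)) = (\<Sum>j<n. d (unit_vec n j) * w $ j)"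
      by simp
    moreover have "vec n (\<lambda>i. if i < n then w $ i else 0) = w"
      using \<open>w \<in> carrier_vec n\<close> by (intro eq_vecI) auto
    ultimately show ?thesis by simp
  qed
  have trace: "of_nat (card (stab s)) * mat_trace (\<rho> (f, q)) =
      (\<Sum>r\<in>Q. d (\<rho> (0, r) *\<^sub>v (\<rho> (f, q) *\<^sub>v vr r)))" if f: "f \<in> E" and q: "q \<in> Q" for f q
  proof -
    let ?A = "\<rho> (f, q)"
    have A: "?A \<in> carrier_mat n n" using f q by simp
    have colA: "(?A *\<^sub>v unit_vec n j) $ i = ?A $$ (i, j)" if "i < n" "j < n" for i j
      using that A by (subst mult_mat_vec_nth[OF A]) (auto simp: if_distrib[of "\<lambda>x. _ * x"] cong: if_cong)
    have "of_nat (card (stab s)) * mat_trace ?A =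
        (\<Sum>i<n. of_nat (card (stab s)) * (?A *\<^sub>v unit_vec n i) $ i)"
      using A by (simp add: mat_trace_def colA sum_distrib_left del: index_mult_mat_vec)
    also have "\<dots> = (\<Sum>i<n. \<Sum>r\<in>Q. d (\<rho> (0, r) *\<^sub>v (?A *\<^sub>v unit_vec n i)) * vr r $ i)"
      using A by (intro sum.cong refl resolution[symmetric]) auto
    also have "\<dots> = (\<Sum>r\<in>Q. \<Sum>i<n. d (\<rho> (0, r) *\<^sub>v (?A *\<^sub>v unit_vec n i)) * vr r $ i)"
      by (rule sum.swap)
    also have "\<dots> = (\<Sum>r\<in>Q. d (\<rho> (0, r) *\<^sub>v (?A *\<^sub>v vr r)))"
    proof (rule sum.cong)
      fix r assume r: "r \<in> Q"
      let ?C = "\<rho> (0, r) * ?A"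
      have C: "?C \<in> carrier_mat n n" by (rule mult_carrier_mat[OF carr[OF E_0 r] A])
      have CA: "\<rho> (0, r) *\<^sub>v (?A *\<^sub>v w) = ?C *\<^sub>v w" if "w \<in> carrier_vec n" for w
        using assoc_mult_mat_vec[OF carr[OF E_0 r] A that] by simp
      have colC: "(?C *\<^sub>v unit_vec n i) $ j = ?C $$ (j, i)" if "i < n" "j < n" for i j
        using that by (subst mult_mat_vec_nth[OF C])
          (auto simp: if_distrib[of "\<lambda>x. _ * x"] simp del: index_mult_mat cong: if_cong)
      have "(\<Sum>i<n. d (?C *\<^sub>v unit_vec n i) * vr r $ i) =
          (\<Sum>i<n. \<Sum>j<n. d (unit_vec n j) * ?C $$ (j, i) * vr r $ i)"
      proof (rule sum.cong)
        fix i assume "i \<in> {..<n}"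
        moreover have "?C *\<^sub>v unit_vec n i \<in> carrier_vec n"
          by (rule mult_mat_vec_carrier[OF C]) simp
        ultimately show "d (?C *\<^sub>v unit_vec n i) * vr r $ i =
            (\<Sum>j<n. d (unit_vec n j) * ?C $$ (j, i) * vr r $ i)"
          by (subst d_sum) (simp_all add: sum_distrib_right colC del: index_mult_mat_vec index_mult_mat)
      qed simp
      also have "\<dots> = (\<Sum>j<n. \<Sum>i<n. d (unit_vec n j) * ?C $$ (j, i) * vr r $ i)"
        by (rule sum.swap)
      also have "\<dots> = (\<Sum>j<n. d (unit_vec n j) * (?C *\<^sub>v vr r) $ j)"
        by (intro sum.cong refl)
          (simp add: mult_mat_vec_nth[OF C vr[OF r]] sum_distrib_left mult.assoc
            del: index_mult_mat_vec index_mult_mat)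
      also have "\<dots> = d (?C *\<^sub>v vr r)"
        by (rule d_sum[symmetric], rule mult_mat_vec_carrier[OF C vr[OF r]])
      finally show "(\<Sum>i<n. d (\<rho> (0, r) *\<^sub>v (?A *\<^sub>v unit_vec n i)) * vr r $ i) =
          d (\<rho> (0, r) *\<^sub>v (?A *\<^sub>v vr r))"
        using r by (simp add: CA)
    qed simp
    finally show ?thesis .
  qed
  have "mat_trace (\<rho> (f, q)) = chi s \<mu> (f, q)" if f: "f \<in> E" and q: "q \<in> Q" for f q
  proof -
    have "d (\<rho> (0, r) *\<^sub>v (\<rho> (f, q) *\<^sub>v vr r)) =
        (if q \<in> stab s then \<mu> q * lam s (translate r f) else 0)" if r: "r \<in> Q" for r
    proof -
      have "\<rho> (0, r) *\<^sub>v (\<rho> (f, q) *\<^sub>v vr r) = \<rho> (translate r f, q) *\<^sub>v vr 0"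
        using f q r v by (simp add: vr0) (simp add: vr_def multv E_0 Q_add E_translate add.commute)
      also have "\<dots> = lam (translate q s) (translate r f) \<cdot>\<^sub>v vr q"
        using f q r by (simp add: vr_weight E_translate Q_0)
      finally show ?thesis using q by (auto simp: d_smult d_vr stab_translate)
    qed
    then have "of_nat (card (stab s)) * mat_trace (\<rho> (f, q)) =
        (\<Sum>r\<in>Q. if q \<in> stab s then \<mu> q * lam s (translate r f) else 0)"
      using trace[OF f q] by simp
    then have "of_nat (card (stab s)) * mat_trace (\<rho> (f, q)) =
        (if q \<in> stab s then \<mu> q * (\<Sum>r\<in>Q. lam s (translate r f)) else 0)"
      by (simp add: sum_distrib_left)
    then show ?thesis using f q card_stab_nonzero[of s]
      by (auto simp: chi_def field_simps)
  qed
  then have "(\<lambda>x \<in> carrier H. mat_trace (\<rho> x)) = chi s \<mu>"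
    by (auto simp: chi_def fun_eq_iff restrict_def)
  moreover have "sign_character (stab s) \<mu>"
    unfolding sign_character_def using \<mu>(1) \<mu>_add by blast
  ultimately show thesis using s that by blast
qed

end

lemma subspace_sum:
  assumes zero: "0\<^sub>v n \<in> W" and add: "\<forall>v\<in>W. \<forall>w\<in>W. v + w \<in> W"
    and sub: "W \<subseteq> carrier_vec n" and fin: "finite F" and u: "\<And>f. f \<in> F \<Longrightarrow> u f \<in> W"
  shows "vec n (\<lambda>i. \<Sum>f\<in>F. u f $ i) \<in> W"
  using fin u
proof (induction F rule: finite_induct)
  case empty
  have "vec n (\<lambda>i. \<Sum>f\<in>{}. u f $ i) = 0\<^sub>v n" by (intro eq_vecI) auto
  then show ?case using zero by (simp only:)
next
  case (insert x F)
  have "u x \<in> carrier_vec n" using insert.prems sub by blast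
  then have "vec n (\<lambda>i. \<Sum>f\<in>insert x F. u f $ i) = u x + vec n (\<lambda>i. \<Sum>f\<in>F. u f $ i)"
    using insert.hyps by (intro eq_vecI) auto
  then show ?case using insert add by auto
qed

context odd_automorphism
begin

text \<open>The representation is monomial, with one basis vector for each translate of \<open>s\<close>. The weights of
  the basis vectors are different, so an invariant subspace that contains a vector with a nonzero
  coordinate contains the corresponding basis vector, and then all of them by transitivity.\<close>

lemma chi_in_Irr:
  assumes s: "s \<in> E"
  shows "chi s (\<lambda>_. 1) \<in> Irr H"
proof -
  define Orb where "Orb = (\<lambda>r. translate r s) ` Q"
  define n where "n = card Orb"
  have finO: "finite Orb" by (simp add: Orb_def)
  have sO: "s \<in> Orb" using Q_0 by (force simp: Orb_def)
  have n: "n > 0" using sO finO by (auto simp: n_def card_gt_0_iff)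
  have O_E: "x \<in> E" if "x \<in> Orb" for x using that s by (auto simp: Orb_def E_translate)
  have O_translate: "translate t x \<in> Orb" if "x \<in> Orb" "t \<in> Q" for x t
  proof -
    obtain r where "r \<in> Q" "x = translate r s" using \<open>x \<in> Orb\<close> unfolding Orb_def by blast
    then show ?thesis using that Q_add[of t r] by (simp add: Orb_def)
  qed
  obtain enum where enum: "bij_betw enum {0..<n} Orb"
    using ex_bij_betw_nat_finite[OF finO] by (auto simp: n_def)
  then have inj: "inj_on enum {..<n}" and enum_O: "\<And>i. i < n \<Longrightarrow> enum i \<in> Orb"
    and surj: "\<And>x. x \<in> Orb \<Longrightarrow> \<exists>i<n. enum i = x"
    by (auto simp: bij_betw_def lessThan_atLeast0 image_iff)
  have enum_eq: "enum i = enum j \<longleftrightarrow> i = j" if "i < n" "j < n" for i j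
    using inj that by (auto simp: inj_on_def)
  define \<rho> where "\<rho> = (\<lambda>(f, t). mat n n (\<lambda>(i, j).
      if enum i = translate t (enum j) then lam (enum i) f else 0))"
  have \<rho>_carr [simp]: "\<rho> x \<in> carrier_mat n n" for x
    by (simp add: \<rho>_def split: prod.split)
  have \<rho>_nth: "\<rho> (f, t) $$ (i, j) = (if enum i = translate t (enum j) then lam (enum i) f else 0)"
    if "i < n" "j < n" for f t i j
    using that by (simp add: \<rho>_def)

  have rep: "representation H n \<rho>"
  proof (rule representationI[OF group_H])
    show "\<rho> \<one>\<^bsub>H\<^esub> = 1\<^sub>m n"
      by (rule eq_matI) (auto simp: \<rho>_def enum_eq)
    fix x y assume "x \<in> carrier H" "y \<in> carrier H"
    then obtain f t h u where x: "x = (f, t)" "t \<in> Q" and y: "y = (h, u)" "u \<in> Q" by auto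
    show "\<rho> (x \<otimes>\<^bsub>H\<^esub> y) = \<rho> x * \<rho> y"
    proof (rule eq_matI)
      fix i k assume "i < dim_row (\<rho> x * \<rho> y)" "k < dim_col (\<rho> x * \<rho> y)"
      then have i: "i < n" and k: "k < n"
        using carrier_matD[OF \<rho>_carr] by simp_all
      obtain j where j: "j < n" "enum j = translate u (enum k)"
        using surj[OF O_translate[OF enum_O[OF k] y(2)]] by blast
      have "(\<rho> x * \<rho> y) $$ (i, k) = (\<Sum>l<n. \<rho> x $$ (i, l) * \<rho> y $$ (l, k))"
        using i k carrier_matD[OF \<rho>_carr[of x]] carrier_matD[OF \<rho>_carr[of y]]
        by (auto simp: scalar_prod_def lessThan_atLeast0 intro!: sum.cong)
      also have "\<dots> = (\<Sum>l<n. if l = j then \<rho> x $$ (i, j) * \<rho> y $$ (j, k) else 0)"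
      proof (rule sum.cong)
        fix l assume "l \<in> {..<n}"
        then show "\<rho> x $$ (i, l) * \<rho> y $$ (l, k) = (if l = j then \<rho> x $$ (i, j) * \<rho> y $$ (j, k) else 0)"
          using i j k enum_eq[of l j] by (auto simp: x y \<rho>_nth)
      qed simp
      also have "\<dots> = \<rho> x $$ (i, j) * \<rho> y $$ (j, k)"
        using j by simp
      also have "\<dots> = (if enum i = translate (t + u) (enum k)
          then lam (enum i) f * lam (translate u (enum k)) h else 0)"
        using i j k by (simp add: x y \<rho>_nth)
      also have "\<dots> = \<rho> (x \<otimes>\<^bsub>H\<^esub> y) $$ (i, k)"
        using i k by (simp add: x y \<rho>_nth lam_add lam_translate)
      finally show "\<rho> (x \<otimes>\<^bsub>H\<^esub> y) $$ (i, k) = (\<rho> x * \<rho> y) $$ (i, k)" by simp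
    qed (use carrier_matD[OF \<rho>_carr] in simp_all)
  qed simp

  have irr: "irreducible_rep H n \<rho>"
    unfolding irreducible_rep_def
  proof (intro conjI allI impI)
    fix W
    assume "VectorSpace.subspace class_ring W (module_vec TYPE(complex) n) \<and>
      (\<forall>x\<in>carrier H. \<forall>w\<in>W. \<rho> x *\<^sub>v w \<in> W)"
    then have W: "W \<subseteq> carrier_vec n" "0\<^sub>v n \<in> W" "\<forall>v\<in>W. \<forall>w\<in>W. v + w \<in> W"
        and smult: "\<And>c v. v \<in> W \<Longrightarrow> c \<cdot>\<^sub>v v \<in> W"
        and inv: "\<And>f t w. f \<in> E \<Longrightarrow> t \<in> Q \<Longrightarrow> w \<in> W \<Longrightarrow> \<rho> (f, t) *\<^sub>v w \<in> W"
      by (auto simp: subspace_vec_iff)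
    note Wsum = subspace_sum[OF W(2,3,1)]
    show "W = {0\<^sub>v n} \<or> W = carrier_vec n"
    proof (cases "W = {0\<^sub>v n}")
      case False
      then obtain w where w: "w \<in> W" "w \<noteq> 0\<^sub>v n" using W(2) by blast
      then have wc: "w \<in> carrier_vec n" using W(1) by blast
      then obtain j where j: "j < n" "w $ j \<noteq> 0"
        using w(2) by (metis carrier_vecD eq_vecI index_zero_vec)
      \<comment> \<open>averaging against the weight of the \<open>j\<close>-th basis vector isolates the \<open>j\<close>-th coordinate\<close>
      have "vec n (\<lambda>i. \<Sum>f\<in>E. (lam (enum j) f \<cdot>\<^sub>v (\<rho> (f, 0) *\<^sub>v w)) $ i) \<in> W"
        by (rule Wsum) (auto intro!: smult inv simp: w Q_0)
      also have "vec n (\<lambda>i. \<Sum>f\<in>E. (lam (enum j) f \<cdot>\<^sub>v (\<rho> (f, 0) *\<^sub>v w)) $ i) =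
          (of_nat (card E) * w $ j) \<cdot>\<^sub>v unit_vec n j"
      proof (rule eq_vecI)
        fix i assume "i < dim_vec ((of_nat (card E) * w $ j) \<cdot>\<^sub>v unit_vec n j)"
        then have i: "i < n" by simp
        have "(lam (enum j) f \<cdot>\<^sub>v (\<rho> (f, 0) *\<^sub>v w)) $ i = lam (enum j) f * lam (enum i) f * w $ i" for f
        proof -
          have "(\<rho> (f, 0) *\<^sub>v w) $ i = (\<Sum>l<n. \<rho> (f, 0) $$ (i, l) * w $ l)"
            by (rule mult_mat_vec_nth[OF \<rho>_carr wc i])
          also have "\<dots> = (\<Sum>l<n. if l = i then lam (enum i) f * w $ i else 0)"
            using i enum_eq by (intro sum.cong) (auto simp: \<rho>_nth)
          finally have "(\<rho> (f, 0) *\<^sub>v w) $ i = lam (enum i) f * w $ i" using i by simp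
          then show ?thesis
            using i carrier_matD[OF \<rho>_carr[of "(f, 0)"]] by (simp del: index_mult_mat_vec)
        qed
        then have "(\<Sum>f\<in>E. (lam (enum j) f \<cdot>\<^sub>v (\<rho> (f, 0) *\<^sub>v w)) $ i) =
            (\<Sum>f\<in>E. lam (enum j) f * lam (enum i) f) * w $ i"
          by (simp add: sum_distrib_right)
        also have "\<dots> = (if i = j then of_nat (card E) * w $ j else 0)"
          using i j enum_eq[of j i] by (simp add: orthogonality O_E enum_O)
        finally show "vec n (\<lambda>i. \<Sum>f\<in>E. (lam (enum j) f \<cdot>\<^sub>v (\<rho> (f, 0) *\<^sub>v w)) $ i) $ i =
            ((of_nat (card E) * w $ j) \<cdot>\<^sub>v unit_vec n j) $ i"
          using i j by (auto simp: unit_vec_def)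
      qed simp
      finally have "(1 / (of_nat (card E) * w $ j)) \<cdot>\<^sub>v ((of_nat (card E) * w $ j) \<cdot>\<^sub>v unit_vec n j) \<in> W"
        by (rule smult)
      then have ej: "unit_vec n j \<in> W"
        using j(2) card_E_nonzero by (simp add: smult_smult_assoc)
      have ei: "unit_vec n i \<in> W" if i: "i < n" for i
      proof -
        obtain a b where ab: "a \<in> Q" "b \<in> Q" "enum i = translate a s" "enum j = translate b s"
          using enum_O[OF i] enum_O[OF j(1)] unfolding Orb_def by blast
        have ij: "enum i = translate (a + b) (enum j)"
          by (simp add: ab add.assoc)
        have "\<rho> (0, a + b) *\<^sub>v unit_vec n j = unit_vec n i"
        proof (rule eq_vecI)
          fix k assume "k < dim_vec (unit_vec n i :: complex vec)"
          then have k: "k < n" by simp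
          have "(\<rho> (0, a + b) *\<^sub>v unit_vec n j) $ k = (\<Sum>l<n. \<rho> (0, a + b) $$ (k, l) * unit_vec n j $ l)"
            by (rule mult_mat_vec_nth[OF \<rho>_carr _ k]) simp
          also have "\<dots> = (\<Sum>l<n. if l = j then \<rho> (0, a + b) $$ (k, j) else 0)"
            using j by (intro sum.cong) (auto simp: unit_vec_def)
          also have "\<dots> = (if k = i then 1 else 0)"
            using j k i enum_eq[of k i] by (simp add: \<rho>_nth ij[symmetric])
          finally show "(\<rho> (0, a + b) *\<^sub>v unit_vec n j) $ k = unit_vec n i $ k"
            using i k by (simp add: unit_vec_def)
        qed (use carrier_matD[OF \<rho>_carr] in simp)
        then show ?thesis using inv[OF E_0 Q_add[OF ab(1,2)] ej] by (simp only:)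
      qed
      have "x \<in> W" if x: "x \<in> carrier_vec n" for x
      proof -
        have "vec n (\<lambda>i. \<Sum>k<n. (x $ k \<cdot>\<^sub>v unit_vec n k) $ i) \<in> W"
          by (rule Wsum) (auto intro!: smult ei)
        also have "vec n (\<lambda>i. \<Sum>k<n. (x $ k \<cdot>\<^sub>v unit_vec n k) $ i) = x"
        proof (rule eq_vecI)
          fix i assume "i < dim_vec x"
          then have i: "i < n" using x by simp
          have "(\<Sum>k<n. (x $ k \<cdot>\<^sub>v unit_vec n k) $ i) = (\<Sum>k<n. if k = i then x $ i else 0)"
            using i by (intro sum.cong) (auto simp: unit_vec_def)
          then show "vec n (\<lambda>i. \<Sum>k<n. (x $ k \<cdot>\<^sub>v unit_vec n k) $ i) $ i = x $ i"
            using i by simp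
        qed (use x in simp)
        finally show ?thesis .
      qed
      then show ?thesis using W(1) by blast
    qed simp
  qed (use rep n in auto)

  have "mat_trace (\<rho> (f, t)) = chi s (\<lambda>_. 1) (f, t)" if f: "f \<in> E" and t: "t \<in> Q" for f t
  proof -
    have fixed: "x = translate t x \<longleftrightarrow> t \<in> stab s" if "x \<in> Orb" for x
    proof -
      obtain r where r: "r \<in> Q" "x = translate r s" using \<open>x \<in> Orb\<close> unfolding Orb_def by blast
      have "x = translate t x \<longleftrightarrow> t \<in> stab (translate r s)"
        using t by (auto simp: stab_def r)
      then show ?thesis by (simp only: stab_translate_eq)
    qed
    have "mat_trace (\<rho> (f, t)) = (\<Sum>i<n. if enum i = translate t (enum i) then lam (enum i) f else 0)"
      using carrier_matD[OF \<rho>_carr[of "(f, t)"]] by (simp add: mat_trace_def \<rho>_nth)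
    also have "\<dots> = (\<Sum>x\<in>Orb. if x = translate t x then lam x f else 0)"
      using sum.reindex_bij_betw[OF enum, of "\<lambda>x. if x = translate t x then lam x f else 0"]
      by (simp add: lessThan_atLeast0)
    also have "\<dots> = (\<Sum>x\<in>Orb. if t \<in> stab s then lam x f else 0)"
      using fixed by (intro sum.cong) auto
    finally have tr: "mat_trace (\<rho> (f, t)) = (if t \<in> stab s then \<Sum>x\<in>Orb. lam x f else 0)" by simp
    have "(\<Sum>r\<in>Q. lam s (translate r f)) = (\<Sum>r\<in>Q. lam (translate r s) f)"
      by (simp only: lam_translate)
    also have "\<dots> = (\<Sum>x\<in>Orb. \<Sum>r\<in>{r \<in> Q. translate r s = x}. lam (translate r s) f)"
      unfolding Orb_def by (rule sum.image_gen) simp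
    also have "\<dots> = (\<Sum>x\<in>Orb. of_nat (card (stab s)) * lam x f)"
    proof (rule sum.cong)
      fix x assume "x \<in> Orb"
      then obtain a where a: "a \<in> Q" "x = translate a s" unfolding Orb_def by blast
      have "translate r s = translate a s \<longleftrightarrow> translate (a + r) s = s" for r
        using translate_eq_iff[of a "translate r s" s] by auto
      then have "bij_betw ((+) a) {r \<in> Q. translate r s = x} (stab s)"
        unfolding stab_def a
        by (intro bij_betw_byWitness[where f' = "(+) a"]) (auto intro!: Q_add a simp del: add_Pair)
      then have "card {r \<in> Q. translate r s = x} = card (stab s)" by (rule bij_betw_same_card)
      then show "(\<Sum>r\<in>{r \<in> Q. translate r s = x}. lam (translate r s) f) = of_nat (card (stab s)) * lam x f"
        by simp
    qed simp
    finally show ?thesis using f t tr card_stab_nonzero[of s]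
      by (simp add: chi_def sum_distrib_left[symmetric])
  qed
  then have "chi s (\<lambda>_. 1) = (\<lambda>x\<in>carrier H. mat_trace (\<rho> x))"
    by (auto simp: chi_def fun_eq_iff restrict_def)
  then show ?thesis unfolding Irr_def using irr by blast
qed

lemma Irr_H_cases:
  assumes "\<chi> \<in> Irr H"
  obtains s \<mu> where "s \<in> E" "sign_character (stab s) \<mu>" "\<chi> = chi s \<mu>"
  using assms irreducible_character unfolding Irr_def by (smt (verit) mem_Collect_eq)

end

section \<open>Counting lemmas\<close>

text \<open>The set \<open>M\<close> is a disjoint union of cosets of \<open>S\<close>.\<close>

lemma card_subgroup_dvd_card_union_of_cosets:
  fixes M S :: "V set"
  assumes S0: "0 \<in> S" and S_add: "\<And>a b. a \<in> S \<Longrightarrow> b \<in> S \<Longrightarrow> a + b \<in> S"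
    and M: "\<And>r a. r \<in> M \<Longrightarrow> a \<in> S \<Longrightarrow> r + a \<in> M"
  shows "card S dvd card M"
proof -
  let ?C = "(\<lambda>r. (+) r ` S) ` M"
  have mem: "x \<in> (+) r ` S \<longleftrightarrow> r + x \<in> S" for r x
    by (metis (no_types, lifting) add_self_left_V image_iff)
  have "card S dvd card (\<Union>?C)"
  proof (rule dvd_partition)
    show "\<forall>c\<in>?C. card S dvd card c" by (simp add: card_image)
    show "\<forall>c1\<in>?C. \<forall>c2\<in>?C. c1 \<noteq> c2 \<longrightarrow> c1 \<inter> c2 = {}"
    proof (intro ballI impI)
      fix c1 c2 assume "c1 \<in> ?C" "c2 \<in> ?C" and ne: "c1 \<noteq> c2"
      then obtain a b where ab: "c1 = (+) a ` S" "c2 = (+) b ` S" by blast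
      show "c1 \<inter> c2 = {}"
      proof (rule ccontr)
        assume "c1 \<inter> c2 \<noteq> {}"
        then obtain x where "x \<in> c1" "x \<in> c2" by blast
        then have ax: "a + x \<in> S" and bx: "b + x \<in> S" by (simp_all only: ab mem)
        have "(a + x) + (b + x) = a + b" by (simp only: ac_simps add_self_left_V add_self_V add_0_right add_0_left)
        then have "a + b \<in> S" using S_add[OF ax bx] by (simp only:)
        have "a + y \<in> S \<longleftrightarrow> b + y \<in> S" for y
        proof -
          have "(a + b) + (a + y) = b + y" "(a + b) + (b + y) = a + y"
            by (simp_all only: ac_simps add_self_left_V add_self_V add_0_right add_0_left)
          then show ?thesis using S_add[OF \<open>a + b \<in> S\<close>] by metis
        qed
        then have "c1 = c2" unfolding ab set_eq_iff mem by blast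
        then show False using ne by blast
      qed
    qed
  qed simp
  also have "\<Union>?C = M"
  proof
    show "\<Union>?C \<subseteq> M" using M by blast
    show "M \<subseteq> \<Union>?C"
    proof
      fix x assume "x \<in> M"
      moreover have "x \<in> (+) x ` S" by (simp only: mem add_self_V S0)
      ultimately show "x \<in> \<Union>?C" by blast
    qed
  qed
  finally show ?thesis .
qed

lemma sumset_iff: "x \<in> (\<lambda>(a, b). a + b) ` (S1 \<times> S2) \<longleftrightarrow> (\<exists>a\<in>S1. \<exists>b\<in>S2. x = a + b)"
  by auto

text \<open>Every fibre of addition on \<open>S1 \<times> S2\<close> is a translate of the diagonal copy of \<open>S1 \<inter> S2\<close>.\<close>

lemma card_sumset:
  fixes S1 S2 :: "V set"
  assumes add1: "\<And>a b. a \<in> S1 \<Longrightarrow> b \<in> S1 \<Longrightarrow> a + b \<in> S1"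
    and add2: "\<And>a b. a \<in> S2 \<Longrightarrow> b \<in> S2 \<Longrightarrow> a + b \<in> S2"
  shows "card ((\<lambda>(a, b). a + b) ` (S1 \<times> S2)) * card (S1 \<inter> S2) = card S1 * card S2"
proof -
  let ?h = "\<lambda>(a, b). a + b :: V"
  have "card S1 * card S2 = (\<Sum>x\<in>S1 \<times> S2. 1)" by (simp add: card_cartesian_product)
  also have "\<dots> = (\<Sum>y\<in>?h ` (S1 \<times> S2). \<Sum>x\<in>{x \<in> S1 \<times> S2. ?h x = y}. 1)"
    by (rule sum.image_gen) simp
  also have "\<dots> = (\<Sum>y\<in>?h ` (S1 \<times> S2). card (S1 \<inter> S2))"
  proof (rule sum.cong)
    fix y assume "y \<in> ?h ` (S1 \<times> S2)"
    then obtain a b where ab: "a \<in> S1" "b \<in> S2" "y = a + b" unfolding sumset_iff by blast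
    have "bij_betw (\<lambda>d. (a + d, b + d)) (S1 \<inter> S2) {x \<in> S1 \<times> S2. ?h x = y}"
    proof (rule bij_betw_byWitness[where f' = "\<lambda>x. a + fst x"])
      show "\<forall>d\<in>S1 \<inter> S2. a + fst (a + d, b + d) = d"
        by simp
      have eq: "b + (a + c) = d" if "c + d = y" for c d
      proof -
        have "b + (a + c) = (a + b) + c" by (simp only: ac_simps)
        also have "\<dots> = d" using that ab(3) by (metis add.commute add_self_left_V)
        finally show ?thesis .
      qed
      show "\<forall>x\<in>{x \<in> S1 \<times> S2. ?h x = y}. (a + (a + fst x), b + (a + fst x)) = x"
      proof
        fix x assume "x \<in> {x \<in> S1 \<times> S2. ?h x = y}"
        then have "fst x + snd x = y" by (simp only: mem_Collect_eq case_prod_beta)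
        then show "(a + (a + fst x), b + (a + fst x)) = x"
          by (simp only: eq add_self_left_V prod.collapse)
      qed
      have "?h (a + d, b + d) = y" for d
        by (simp only: ab prod.case ac_simps add_self_left_V add_self_V add_0_right add_0_left)
      then show "(\<lambda>d. (a + d, b + d)) ` (S1 \<inter> S2) \<subseteq> {x \<in> S1 \<times> S2. ?h x = y}"
        using add1[OF ab(1)] add2[OF ab(2)] by blast
      show "(\<lambda>x. a + fst x) ` {x \<in> S1 \<times> S2. ?h x = y} \<subseteq> S1 \<inter> S2"
      proof (rule image_subsetI)
        fix x assume "x \<in> {x \<in> S1 \<times> S2. ?h x = y}"
        then have x: "fst x \<in> S1" "snd x \<in> S2" "fst x + snd x = y"
          by (simp_all only: mem_Collect_eq mem_Times_iff case_prod_beta)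
        have "b + snd x = a + fst x"
          using add_self_left_V[of b "a + fst x"] by (simp only: eq[OF x(3)])
        then show "a + fst x \<in> S1 \<inter> S2"
          using add1[OF ab(1) x(1)] add2[OF ab(2) x(2)] by (simp only: Int_iff simp_thms)
      qed
    qed
    then show "(\<Sum>x\<in>{x \<in> S1 \<times> S2. ?h x = y}. 1) = card (S1 \<inter> S2)"
      by (simp add: bij_betw_same_card)
  qed simp
  finally show ?thesis by simp
qed

text \<open>Powers of \<open>h\<close> move a point around an orbit of size 1 or \<open>p\<close>: two coincident powers below \<open>p\<close>
  differ by an exponent prime to \<open>p\<close>, and then \<open>h\<close> itself fixes the point.\<close>

lemma prime_dvd_card_moved_points:
  fixes h :: "'a \<Rightarrow> 'a"
  assumes fin: "finite M" and p: "prime p"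
    and closed: "\<And>x. x \<in> M \<Longrightarrow> h x \<in> M" and per: "\<And>x. x \<in> M \<Longrightarrow> (h ^^ p) x = x"
  shows "p dvd card {x \<in> M. h x \<noteq> x}"
proof -
  have pow_M: "(h ^^ k) x \<in> M" if "x \<in> M" for x k
    using that by (induction k) (simp_all add: closed)
  have pow_mult: "(h ^^ (d * k)) x = x" if "(h ^^ d) x = x" for d k x
    using that by (induction k) (simp_all add: funpow_add)
  have pow_mod: "(h ^^ k) x = (h ^^ (k mod p)) x" if "x \<in> M" for k x
  proof -
    have "(h ^^ k) x = (h ^^ (k mod p + p * (k div p))) x" by (simp only: mod_mult_div_eq)
    also have "\<dots> = (h ^^ (k mod p)) x"
      by (simp only: funpow_add comp_apply pow_mult[OF per[OF that]])
    finally show ?thesis .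
  qed
  have return: "(h ^^ (p - k)) ((h ^^ k) x) = x" if "x \<in> M" "k < p" for x k
  proof -
    have "(h ^^ (p - k)) ((h ^^ k) x) = (h ^^ (p - k + k)) x" by (simp only: funpow_add comp_apply)
    then show ?thesis using that per by simp
  qed
  have fixed_pow: "(h ^^ k) x = x" if "h x = x" for k x
    using that by (induction k) simp_all
  let ?F = "{x \<in> M. h x \<noteq> x}"
  define orb where "orb x = (\<lambda>k. (h ^^ k) x) ` {..<p}" for x
  have p0: "p > 0" using p prime_gt_0_nat by blast
  have orb_iff: "y \<in> orb x \<longleftrightarrow> (\<exists>k. y = (h ^^ k) x)" if "x \<in> M" for x y
    unfolding orb_def using pow_mod[OF that] p0
    by (metis (no_types, lifting) imageE imageI lessThan_iff mod_less_divisor)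
  have fixed_back: "h x = x" if "x \<in> M" "k < p" "h ((h ^^ k) x) = (h ^^ k) x" for x k
    using return[OF that(1,2)] fixed_pow[OF that(3)] that(3) by metis
  have "p dvd card (\<Union>(orb ` ?F))"
  proof (rule dvd_partition)
    show "finite (\<Union>(orb ` ?F))" using fin by (simp add: orb_def)
    show "\<forall>c\<in>orb ` ?F. p dvd card c"
    proof
      fix c assume "c \<in> orb ` ?F"
      then obtain x where x: "x \<in> M" "h x \<noteq> x" "c = orb x" by blast
      have "(h ^^ i) x \<noteq> (h ^^ j) x" if "i < j" "j < p" for i j
      proof
        assume eq: "(h ^^ i) x = (h ^^ j) x"
        define y where "y = (h ^^ i) x"
        have yM: "y \<in> M" using pow_M x by (simp add: y_def)
        have "(h ^^ (j - i)) y = (h ^^ (j - i + i)) x"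
          by (simp only: y_def funpow_add comp_apply)
        then have yd: "(h ^^ (j - i)) y = y" using that eq by (simp add: y_def)
        have "coprime (j - i) p"
          using that p by (metis coprime_commute diff_is_0_eq leD less_imp_diff_less nat_dvd_not_less
              neq0_conv prime_imp_coprime)
        then obtain a b where "(j - i) * a = p * b + 1"
          using coprime_bezout_strong[of "j - i" p] p prime_gt_1_nat by (metis nat_neq_iff)
        then have "(h ^^ (p * b + 1)) y = y" using pow_mult[OF yd] by metis
        then have "h y = y"
          by (simp add: funpow_add funpow_swap1 pow_mult[OF per] closed[OF yM])
        then show False using fixed_back[OF x(1), of i] that x(2) by (simp add: y_def)
      qed
      then have "inj_on (\<lambda>k. (h ^^ k) x) {..<p}"
        by (metis (mono_tags, lifting) inj_onI lessThan_iff linorder_neqE_nat)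
      then show "p dvd card c" by (simp add: x orb_def card_image)
    qed
    show "\<forall>c1\<in>orb ` ?F. \<forall>c2\<in>orb ` ?F. c1 \<noteq> c2 \<longrightarrow> c1 \<inter> c2 = {}"
    proof (intro ballI impI)
      fix c1 c2 assume "c1 \<in> orb ` ?F" "c2 \<in> orb ` ?F" and ne: "c1 \<noteq> c2"
      then obtain x y where xy: "x \<in> M" "y \<in> M" "c1 = orb x" "c2 = orb y" by blast
      have same: "orb z = orb w" if z: "z \<in> orb w" and w: "w \<in> M" for z w
      proof -
        obtain k where k: "k < p" "z = (h ^^ k) w" using z by (auto simp: orb_def)
        have zM: "z \<in> M" using pow_M w k by simp
        have "w = (h ^^ (p - k)) z" using return[OF w k(1)] k(2) by simp
        then show ?thesis
          unfolding set_eq_iff orb_iff[OF zM] orb_iff[OF w] using k(2)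
          by (metis comp_apply funpow_add)
      qed
      show "c1 \<inter> c2 = {}" using same xy ne by blast
    qed
  qed
  also have "\<Union>(orb ` ?F) = ?F"
  proof
    show "\<Union>(orb ` ?F) \<subseteq> ?F" using pow_M fixed_back by (auto simp: orb_def)
    show "?F \<subseteq> \<Union>(orb ` ?F)" using p0 by (force simp: orb_def)
  qed
  finally show ?thesis .
qed

context odd_automorphism
begin

lemma chi_translate:
  assumes r: "r \<in> Q"
  shows "chi (translate r s) \<mu> = chi s \<mu>"
proof -
  have "(\<Sum>q\<in>Q. lam (translate r s) (translate q f)) = (\<Sum>q\<in>Q. lam s (translate q f))" for f
    by (rule sum.reindex_bij_witness[of _ "\<lambda>q. r + q" "\<lambda>q. r + q"])
      (use r Q_add in \<open>simp_all only: add_self_left_V lam_translate[symmetric] translate_translate\<close>)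
  then show ?thesis unfolding chi_def stab_translate_eq by (simp only:)
qed

lemma chi_cong: "(\<And>t. t \<in> stab s \<Longrightarrow> \<mu> t = \<nu> t) \<Longrightarrow> chi s \<mu> = chi s \<nu>"
  unfolding chi_def by (intro restrict_ext) auto

lemma odd_prime_not_dvd_card_stab:
  assumes "prime p" "odd p"
  shows "\<not> p dvd card (stab s)"
proof
  assume "p dvd card (stab s)"
  also have "card (stab s) dvd card (UNIV :: V set)"
    by (rule card_subgroup_dvd_card_union_of_cosets) (simp_all only: stab_0 stab_add UNIV_I)
  finally have "p dvd 2" using card_V prime_dvd_power[OF assms(1)] by metis
  then have "p = 2" by (rule primes_dvd_imp_eq[OF assms(1) two_is_prime_nat])
  then show False using assms(2) by simp
qed

end

section \<open>One step of the Glauberman correspondence\<close>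

text \<open>The automorphism \<open>g2\<close> acts on the fixed points of its power \<open>g1\<close> as a group of order dividing
  \<open>p\<close>, and its fixed points there are all its fixed points. Below, the prefixes \<open>A\<close> and \<open>B\<close> refer to the
  larger and to the smaller group of fixed points.\<close>

locale glauberman_step =
  A: odd_automorphism g1 m1 + B: odd_automorphism g2 m2
  for g1 m1 g2 m2 +
  fixes p :: nat
  assumes power: "g1 = g2 ^^ p" and p: "prime p" "odd p"
begin

lemma g1_apply: "g1 x = (g2 ^^ p) x"
  by (simp only: power)

lemma E_subset: "B.E \<subseteq> A.E"
  unfolding subset_iff A.E_iff g1_apply using B.invariant_pow by blast

lemma Q_subset: "B.Q \<subseteq> A.Q"
proof
  fix t assume "t \<in> B.Q"
  then have "(g2 ^^ k) t = t" for k by (induction k) (simp_all add: B.Q_def)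
  then show "t \<in> A.Q" by (simp add: A.Q_def g1_apply)
qed

text \<open>These \<open>r\<close> parametrise the conjugates of \<open>\<lambda>\<^sub>s\<close> that restrict to \<open>\<lambda>\<close> at \<open>s'\<close> on \<open>B.E\<close>.\<close>

definition matching :: "B \<Rightarrow> B \<Rightarrow> V set" where
  "matching s s' = {r \<in> A.Q. \<forall>f\<in>B.E. lam (translate r s) f = lam s' f}"

text \<open>Expand both characters as sums over \<open>r \<in> A.Q\<close> and \<open>q \<in> B.Q\<close>. Summing over \<open>f\<close> first, orthogonality
  leaves the pairs for which the conjugates of \<open>\<lambda>\<^sub>s\<close> by \<open>r\<close> and of \<open>\<lambda>\<close> at \<open>s'\<close> by \<open>q\<close> agree on \<open>B.E\<close>,
  that is, \<open>r + q\<close> is matching.\<close>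

lemma inner_chi:
  assumes s': "s' \<in> B.E" and \<mu>: "sign_character (B.stab s') \<mu>"
  shows "char_inner B.H (A.chi s (\<lambda>_. 1)) (B.chi s' \<mu>) =
    (\<Sum>t\<in>A.stab s \<inter> B.stab s'. \<mu> t) * of_nat (card (matching s s')) /
    (of_nat (card (A.stab s)) * of_nat (card (B.stab s')))"
proof -
  let ?F = "\<lambda>r q. \<Sum>f\<in>B.E. lam s (translate r f) * lam s' (translate q f)"
  have F: "?F r q = (if r + q \<in> matching s s' then of_nat (card B.E) else 0)"
    if r: "r \<in> A.Q" and q: "q \<in> B.Q" for r q
  proof -
    have "?F r q = (\<Sum>f\<in>B.E. lam (translate (r + q) s) f * lam s' f)"
      by (rule sum.reindex_bij_witness[of _ "translate q" "translate q"])
        (use q B.E_translate in \<open>simp_all add: lam_translate[symmetric] add.commute\<close>)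
    also have "\<dots> = (if \<forall>f\<in>B.E. lam (translate (r + q) s) f * lam s' f = 1 then of_nat (card B.E) else 0)"
      by (rule sum_sign_subgroup) (auto simp: B.E_add lam_add)
    also have "(\<forall>f\<in>B.E. lam (translate (r + q) s) f * lam s' f = 1) \<longleftrightarrow> r + q \<in> matching s s'"
    proof -
      have "r + q \<in> A.Q" using A.Q_add r q Q_subset by blast
      moreover have "lam a f * lam b f = 1 \<longleftrightarrow> lam a f = lam b f" for a b f by (simp add: lam_def)
      ultimately show ?thesis by (simp only: matching_def mem_Collect_eq simp_thms)
    qed
    finally show ?thesis .
  qed
  have total: "(\<Sum>f\<in>B.E. (\<Sum>r\<in>A.Q. lam s (translate r f)) * (\<Sum>q\<in>B.Q. lam s' (translate q f))) =
      of_nat (card B.Q) * of_nat (card (matching s s')) * of_nat (card B.E)"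
  proof -
    have "(\<Sum>f\<in>B.E. (\<Sum>r\<in>A.Q. lam s (translate r f)) * (\<Sum>q\<in>B.Q. lam s' (translate q f))) =
        (\<Sum>f\<in>B.E. \<Sum>q\<in>B.Q. \<Sum>r\<in>A.Q. lam s (translate r f) * lam s' (translate q f))"
      by (subst sum.swap[of _ A.Q]) (simp add: sum_product)
    also have "\<dots> = (\<Sum>q\<in>B.Q. \<Sum>f\<in>B.E. \<Sum>r\<in>A.Q. lam s (translate r f) * lam s' (translate q f))"
      by (rule sum.swap)
    also have "\<dots> = (\<Sum>q\<in>B.Q. \<Sum>r\<in>A.Q. ?F r q)"
      by (intro sum.cong refl sum.swap)
    also have "\<dots> = (\<Sum>q\<in>B.Q. of_nat (card (matching s s')) * of_nat (card B.E))"
    proof (rule sum.cong)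
      fix q assume q: "q \<in> B.Q"
      then have qA: "q \<in> A.Q" using Q_subset by blast
      have "(\<Sum>r\<in>A.Q. ?F r q) = (\<Sum>r\<in>A.Q. if r + q \<in> matching s s' then of_nat (card B.E) else 0)"
        using F q by simp
      also have "\<dots> = (\<Sum>r\<in>A.Q. if r \<in> matching s s' then of_nat (card B.E) else 0)"
        by (rule sum.reindex_bij_witness[of _ "\<lambda>r. r + q" "\<lambda>r. r + q"])
          (use qA A.Q_add in \<open>simp_all only: add.assoc add_self_V add_0_right\<close>)
      also have "\<dots> = (\<Sum>r\<in>matching s s'. of_nat (card B.E))"
        unfolding sum.inter_filter[OF A.finite_Q, symmetric]
        by (rule sum.cong) (auto simp: matching_def)
      finally show "(\<Sum>r\<in>A.Q. ?F r q) = of_nat (card (matching s s')) * of_nat (card B.E)" by simp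
    qed simp
    finally show ?thesis by simp
  qed
  let ?S = "A.stab s" and ?S' = "B.stab s'"
  have cnj_\<mu>: "cnj (\<mu> t) = \<mu> t" if "t \<in> ?S'" for t
    using \<mu> that by (auto simp: sign_character_def)
  have summand: "A.chi s (\<lambda>_. 1) (f, t) * cnj (B.chi s' \<mu> (f, t)) =
      (if t \<in> ?S \<inter> ?S' then \<mu> t else 0) / (of_nat (card ?S) * of_nat (card ?S')) *
      ((\<Sum>r\<in>A.Q. lam s (translate r f)) * (\<Sum>q\<in>B.Q. lam s' (translate q f)))"
    if "f \<in> B.E" "t \<in> B.Q" for f t
  proof -
    have "f \<in> A.E" "t \<in> A.Q" using that E_subset Q_subset by blast+
    then show ?thesis using that by (simp add: A.chi_def B.chi_def cnj_\<mu> mult_ac)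
  qed
  have "(\<Sum>x\<in>carrier B.H. A.chi s (\<lambda>_. 1) x * cnj (B.chi s' \<mu> x)) =
      (\<Sum>f\<in>B.E. \<Sum>t\<in>B.Q. A.chi s (\<lambda>_. 1) (f, t) * cnj (B.chi s' \<mu> (f, t)))"
    by (simp add: sum.cartesian_product split_beta)
  also have "\<dots> = (\<Sum>t\<in>B.Q. if t \<in> ?S \<inter> ?S' then \<mu> t else 0) / (of_nat (card ?S) * of_nat (card ?S')) *
      (\<Sum>f\<in>B.E. (\<Sum>r\<in>A.Q. lam s (translate r f)) * (\<Sum>q\<in>B.Q. lam s' (translate q f)))"
  proof -
    define P where "P f = (\<Sum>r\<in>A.Q. lam s (translate r f)) * (\<Sum>q\<in>B.Q. lam s' (translate q f))" for f
    define c where "c t = (if t \<in> ?S \<inter> ?S' then \<mu> t else 0)" for t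
    have "(\<Sum>f\<in>B.E. \<Sum>t\<in>B.Q. A.chi s (\<lambda>_. 1) (f, t) * cnj (B.chi s' \<mu> (f, t))) =
        (\<Sum>f\<in>B.E. \<Sum>t\<in>B.Q. c t / (of_nat (card ?S) * of_nat (card ?S')) * P f)"
      unfolding P_def c_def by (intro sum.cong refl summand)
    also have "\<dots> = (\<Sum>t\<in>B.Q. c t) / (of_nat (card ?S) * of_nat (card ?S')) * (\<Sum>f\<in>B.E. P f)"
      by (simp only: sum_distrib_left sum_distrib_right sum_divide_distrib)
    finally show ?thesis unfolding P_def c_def .
  qed
  also have "(\<Sum>t\<in>B.Q. if t \<in> ?S \<inter> ?S' then \<mu> t else 0) = (\<Sum>t\<in>?S \<inter> ?S'. \<mu> t)"
    unfolding sum.inter_filter[OF B.finite_Q, symmetric]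
    by (rule sum.cong) (auto simp: B.stab_def)
  finally show ?thesis
    unfolding char_inner_def total using B.card_E_nonzero B.card_Q_nonzero
    by (simp add: card_cartesian_product)
qed

lemma matching_closed:
  assumes r: "r \<in> matching s s'" and a: "a \<in> A.stab s" and b: "b \<in> B.stab s'"
  shows "r + (a + b) \<in> matching s s'"
proof -
  have Q: "r \<in> A.Q" "a \<in> A.Q" "b \<in> B.Q"
    using r a b A.stab_subset B.stab_subset by (auto simp only: matching_def)
  have "translate (r + (a + b)) s = translate b (translate r (translate a s))"
    by (simp only: translate_translate ac_simps)
  then have eq: "translate (r + (a + b)) s = translate b (translate r s)"
    by (simp only: A.stab_translate[OF a])
  have "lam (translate (r + (a + b)) s) f = lam s' f" if f: "f \<in> B.E" for f
  proof -
    have "lam (translate (r + (a + b)) s) f = lam (translate r s) (translate b f)"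
      by (simp only: eq lam_translate)
    also have "\<dots> = lam s' (translate b f)"
      using r B.E_translate[OF f Q(3)] by (simp add: matching_def)
    also have "\<dots> = lam s' f" by (simp only: lam_translate B.stab_translate[OF b])
    finally show ?thesis .
  qed
  moreover have "r + (a + b) \<in> A.Q" using Q Q_subset A.Q_add by blast
  ultimately show ?thesis by (simp add: matching_def)
qed

text \<open>The inner product is a natural number. It is 0 unless \<open>\<mu>\<close> is trivial on the common stabiliser;
  in that case the denominator divides the numerator, since the set of matching elements is a union of cosets of
  \<open>stab s + stab s'\<close>, whose order is the product of the orders of both stabilisers divided by the order
  of their intersection.\<close>

lemma multiplicity_chi:
  assumes s': "s' \<in> B.E" and \<mu>: "sign_character (B.stab s') \<mu>"
  shows "multiplicity_in B.H (A.chi s (\<lambda>_. 1)) (B.chi s' \<mu>) * (card (A.stab s) * card (B.stab s')) =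
    (if \<forall>t\<in>A.stab s \<inter> B.stab s'. \<mu> t = 1 then card (A.stab s \<inter> B.stab s') else 0) *
    card (matching s s')"
proof -
  let ?S = "A.stab s" and ?S' = "B.stab s'"
  let ?D = "if \<forall>t\<in>?S \<inter> ?S'. \<mu> t = 1 then card (?S \<inter> ?S') else 0"
  let ?T = "(\<lambda>(a, b). a + b) ` (?S \<times> ?S')"
  have sum\<mu>: "(\<Sum>t\<in>?S \<inter> ?S'. \<mu> t) = of_nat ?D"
    using \<mu> by (subst sum_sign_subgroup) (auto simp: A.stab_add B.stab_add sign_character_def simp del: split_paired_All)
  have card_T: "card ?T * card (?S \<inter> ?S') = card ?S * card ?S'"
    by (rule card_sumset) (simp_all only: A.stab_add B.stab_add)
  have "card ?T dvd card (matching s s')"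
  proof (rule card_subgroup_dvd_card_union_of_cosets)
    show "0 \<in> ?T"
      unfolding sumset_iff using A.stab_0[of s] B.stab_0[of s'] by (metis add_0_right)
    show "x + y \<in> ?T" if x: "x \<in> ?T" and y: "y \<in> ?T" for x y
    proof -
      obtain a b where ab: "a \<in> ?S" "b \<in> ?S'" "x = a + b" using x unfolding sumset_iff by blast
      obtain c d where cd: "c \<in> ?S" "d \<in> ?S'" "y = c + d" using y unfolding sumset_iff by blast
      have "x + y = (a + c) + (b + d)" by (simp only: ab cd ac_simps)
      then show ?thesis using A.stab_add[OF ab(1) cd(1)] B.stab_add[OF ab(2) cd(2)]
        unfolding sumset_iff by blast
    qed
    show "r + x \<in> matching s s'" if "r \<in> matching s s'" "x \<in> ?T" for r x
      using that matching_closed unfolding sumset_iff by blast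
  qed
  then obtain k where k: "card (matching s s') = card ?T * k" by (rule dvdE)
  have "\<exists>N. N * (card ?S * card ?S') = ?D * card (matching s s')"
  proof (cases "\<forall>t\<in>?S \<inter> ?S'. \<mu> t = 1")
    case True
    then have "k * (card ?S * card ?S') = ?D * card (matching s s')"
      by (simp add: k card_T[symmetric])
    then show ?thesis by blast
  next
    case False
    then have "0 * (card ?S * card ?S') = ?D * card (matching s s')" by (simp only: if_False mult_zero_left)
    then show ?thesis by blast
  qed
  then obtain N where N: "N * (card ?S * card ?S') = ?D * card (matching s s')" by blast
  have "(of_nat N :: complex) * (of_nat (card ?S) * of_nat (card ?S')) = of_nat ?D * of_nat (card (matching s s'))"
    using arg_cong[OF N, of of_nat] by (simp only: of_nat_mult)
  then have "char_inner B.H (A.chi s (\<lambda>_. 1)) (B.chi s' \<mu>) = of_nat N"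
    unfolding inner_chi[OF s' \<mu>] sum\<mu> using A.card_stab_nonzero B.card_stab_nonzero
    by (simp add: divide_eq_eq)
  then have "multiplicity_in B.H (A.chi s (\<lambda>_. 1)) (B.chi s' \<mu>) = N"
    unfolding multiplicity_in_def by (simp add: the_equality)
  then show ?thesis using N by simp
qed

text \<open>As \<open>s\<close> and the functions in \<open>B.E\<close> are invariant under \<open>g2\<close>, this automorphism permutes the matching
  elements, with period \<open>p\<close>. A matching element that it fixes lies in \<open>B.Q\<close>, and there the characters
  of \<open>B.E\<close> separate the translates of \<open>s\<close>.\<close>

lemma card_matching:
  assumes s: "s \<in> B.E" and s': "s' \<in> B.E"
  shows "p dvd card (matching s s') \<longleftrightarrow> p dvd card {r \<in> B.Q. translate r s = s'}"
proof -
  have step: "g2 r \<in> matching s s'" if r: "r \<in> matching s s'" for r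
  proof -
    have "g2 r \<in> A.Q"
      using r by (simp add: matching_def A.Q_def g1_apply funpow_swap1[symmetric])
    moreover have "lam (translate (g2 r) s) f = lam (translate r s) f" if f: "f \<in> B.E" for f
    proof -
      have "pairing (translate (g2 r) s) f = (\<Sum>x\<in>UNIV. (\<lambda>x. s (x + g2 r) * f x) (g2 x))"
        unfolding pairing_def translate_def by (rule sum.reindex_bij_betw[OF B.bij_g, symmetric])
      also have "\<dots> = pairing (translate r s) f"
        by (simp only: pairing_def translate_def B.additive[symmetric] B.invariantD[OF s] B.invariantD[OF f])
      finally show ?thesis by (simp add: lam_def)
    qed
    ultimately show ?thesis using r by (simp add: matching_def)
  qed
  have "p dvd card {r \<in> matching s s'. g2 r \<noteq> r}"
  proof (rule prime_dvd_card_moved_points[OF _ p(1) step])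
    show "(g2 ^^ p) r = r" if "r \<in> matching s s'" for r
      using that by (simp add: matching_def A.Q_def g1_apply)
  qed simp_all
  moreover have "card (matching s s') = card {r \<in> matching s s'. g2 r = r} + card {r \<in> matching s s'. g2 r \<noteq> r}"
    by (subst card_Un_disjoint[symmetric]) (auto intro!: arg_cong[of _ _ card])
  moreover have "{r \<in> matching s s'. g2 r = r} = {r \<in> B.Q. translate r s = s'}"
  proof -
    have "r \<in> matching s s' \<longleftrightarrow> translate r s = s'" if r: "r \<in> B.Q" for r
      using r Q_subset B.lam_separates[OF B.E_translate[OF s r] s'] by (auto simp only: matching_def)
    then show ?thesis by (auto simp only: B.Q_def)
  qed
  ultimately show ?thesis by (simp add: dvd_add_left_iff)
qed

text \<open>The orders of all stabilisers are powers of 2 and \<open>p\<close> is odd. Modulo \<open>p\<close> the multiplicity in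
  \<open>\<chi>\<^sub>s\<close> is therefore nonzero only if \<open>s'\<close> is a translate of \<open>s\<close> under \<open>B.Q\<close> and \<open>\<mu>\<close> is trivial on the
  common stabiliser, which for such \<open>s'\<close> is all of \<open>B.stab s\<close>.\<close>

theorem p'_constituent_chi:
  assumes s: "s \<in> B.E"
  shows "the_p'_constituent p B.H (Irr B.H) (A.chi s (\<lambda>_. 1)) (B.chi s (\<lambda>_. 1))"
  unfolding the_p'_constituent_def
proof (intro conjI ballI impI)
  show "B.chi s (\<lambda>_. 1) \<in> Irr B.H" by (rule B.chi_in_Irr[OF s])
  have ndvd: "\<not> p dvd card (A.stab t)" "\<not> p dvd card (B.stab t)" for t
    using A.odd_prime_not_dvd_card_stab B.odd_prime_not_dvd_card_stab p by blast+
  have stab_sub: "B.stab s \<subseteq> A.stab s"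
    using Q_subset by (auto simp only: A.stab_def B.stab_def)
  have one: "sign_character (B.stab s) (\<lambda>_. 1)" by (simp add: sign_character_def)
  show "\<not> p dvd multiplicity_in B.H (A.chi s (\<lambda>_. 1)) (B.chi s (\<lambda>_. 1))"
  proof
    assume "p dvd multiplicity_in B.H (A.chi s (\<lambda>_. 1)) (B.chi s (\<lambda>_. 1))"
    then have "p dvd multiplicity_in B.H (A.chi s (\<lambda>_. 1)) (B.chi s (\<lambda>_. 1)) *
        (card (A.stab s) * card (B.stab s))"
      by (rule dvd_mult2)
    then have "p dvd card (A.stab s \<inter> B.stab s) * card (matching s s)"
      unfolding multiplicity_chi[OF s one] by simp
    then have "p dvd card (B.stab s) * card (matching s s)"
      using stab_sub by (simp add: Int_absorb1)
    then have "p dvd card {r \<in> B.Q. translate r s = s}"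
      using ndvd p(1) card_matching[OF s s] by (simp add: prime_dvd_mult_iff)
    then show False using ndvd(2)[of s] by (simp add: B.stab_def)
  qed
  fix \<theta> assume "\<theta> \<in> Irr B.H" and nd: "\<not> p dvd multiplicity_in B.H (A.chi s (\<lambda>_. 1)) \<theta>"
  then obtain s' \<mu> where s': "s' \<in> B.E" and \<mu>: "sign_character (B.stab s') \<mu>" and \<theta>: "\<theta> = B.chi s' \<mu>"
    by (metis B.Irr_H_cases)
  note mult = multiplicity_chi[OF s' \<mu>, of s, folded \<theta>]
  have "\<not> p dvd multiplicity_in B.H (A.chi s (\<lambda>_. 1)) \<theta> * (card (A.stab s) * card (B.stab s'))"
    using nd ndvd p(1) by (simp add: prime_dvd_mult_iff)
  note nd' = this[unfolded mult]
  then have "\<not> p dvd card (matching s s')" using dvd_mult by blast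
  moreover have \<mu>1: "\<forall>t\<in>A.stab s \<inter> B.stab s'. \<mu> t = 1"
  proof (rule ccontr)
    assume neg: "\<not> ?thesis"
    from nd' show False unfolding if_not_P[OF neg] by simp
  qed
  ultimately have "{r \<in> B.Q. translate r s = s'} \<noteq> {}"
    using card_matching[OF s s'] by (metis card.empty dvd_0_right)
  then obtain r where r: "r \<in> B.Q" "translate r s = s'" by blast
  then have stab_eq: "B.stab s' = B.stab s" using B.stab_translate_eq by metis
  have "\<theta> = B.chi s' (\<lambda>_. 1)"
    unfolding \<theta> using \<mu>1 stab_sub stab_eq by (intro B.chi_cong) blast
  then show "\<theta> = B.chi s (\<lambda>_. 1)" using B.chi_translate[OF r(1)] r(2) by metis
qed

end

section \<open>The invariant functions on V as an algebra under convolution\<close>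

lemma bit_add_self: "(x :: bit) + x = 0"
  by simp

lemma bit_add_self_left: "(x :: bit) + (x + y) = y"
  by (simp only: add.assoc[symmetric] bit_add_self add_0_left)

lemma bit_mult_self: "(x :: bit) * x = x"
  by (cases x rule: bit.exhaust) simp_all

lemma bit_table: "(0 :: bit) + 0 = 0" "(0 :: bit) + 1 = 1" "(1 :: bit) + 0 = 1" "(1 :: bit) + 1 = 0"
  by simp_all

definition convolution :: "('a :: {ab_group_add, finite} \<Rightarrow> bit) \<Rightarrow> ('a \<Rightarrow> bit) \<Rightarrow> 'a \<Rightarrow> bit" where
  "convolution s f r = (\<Sum>x\<in>UNIV. s x * f (x + r))"

text \<open>The points of the projective line over the field with four elements: \<open>None\<close> stands for the line
  through \<open>(0, 1)\<close>, and \<open>Some c\<close> for the line through \<open>(1, c)\<close>.\<close>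

type_synonym line = "gf4 option"

text \<open>The bilinear form for which different lines have value 1 and equal lines have value 0. It gives the
  product of two combinations of lines, as a multiple of the indicator of \<open>U\<close>.\<close>

definition line_form :: "(line \<Rightarrow> bit) \<Rightarrow> (line \<Rightarrow> bit) \<Rightarrow> bit" where
  "line_form a b = (\<Sum>k\<in>UNIV. a k) * (\<Sum>k\<in>UNIV. b k) + (\<Sum>k\<in>UNIV. a k * b k)"

lemma UNIV_gf4_eq: "(UNIV :: gf4 set) = {GF4 0 0, GF4 1 0, GF4 0 1, GF4 1 1}"
  by (auto simp: UNIV_gf4 UNIV_bit)

lemma sum_gf4: "(\<Sum>x\<in>UNIV. F x) = F (GF4 0 0) + (F (GF4 1 0) + (F (GF4 0 1) + F (GF4 1 1)))"
  for F :: "gf4 \<Rightarrow> 'a :: comm_monoid_add"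
  by (simp add: UNIV_gf4_eq)

lemma sum_line: "(\<Sum>k\<in>UNIV. F k) = F None + (\<Sum>c\<in>UNIV. F (Some c))"
  for F :: "line \<Rightarrow> 'a :: comm_monoid_add"
  by (simp add: UNIV_option_conv sum.reindex)

lemma sum_U: "(\<Sum>u\<in>UNIV. F u) = (\<Sum>x\<in>UNIV. \<Sum>y\<in>UNIV. F (x, y))"
  for F :: "gf4 \<times> gf4 \<Rightarrow> 'a :: comm_monoid_add"
  by (simp add: sum.cartesian_product)

lemma card_line: "card (UNIV :: line set) = 5"
  by (simp add: UNIV_option_conv card_image CARD_gf4)

lemma sum_line_const: "(\<Sum>k\<in>(UNIV :: line set). c) = (c :: bit)"
proof -
  have "(of_nat 5 :: bit) = 1" by simp
  then show ?thesis by (simp add: card_line)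
qed

lemma line_form_commute: "line_form a b = line_form b a"
  by (simp only: line_form_def mult.commute)

lemma line_form_add: "line_form a (\<lambda>k. b k + c k) = line_form a b + line_form a c"
  by (simp only: line_form_def distrib_left sum.distrib ac_simps)

lemma line_form_scale: "line_form a (\<lambda>k. c * b k) = c * line_form a b"
  by (simp only: line_form_def distrib_left sum_distrib_left ac_simps)

lemma line_form_const: "line_form a (\<lambda>k. c) = 0"
  by (simp only: line_form_def sum_line_const sum_distrib_right bit_add_self)

lemma line_form_self: "line_form a a = 0"
  by (simp only: line_form_def bit_mult_self bit_add_self)

text \<open>The function \<open>a0 \<delta>\<^sub>0 + \<Sum>\<^sub>k a k 1\<^sub>k\<close> on \<open>U\<close>, where \<open>1\<^sub>k\<close> is the indicator of the line \<open>k\<close> with the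
  origin included. The origin is what makes \<open>1\<^sub>k\<close> a subgroup indicator, with convolution square 0.\<close>

definition line_fun :: "bit \<Rightarrow> (line \<Rightarrow> bit) \<Rightarrow> gf4 \<times> gf4 \<Rightarrow> bit" where
  "line_fun a0 a x = (if fst x = 0 then if snd x = 0 then a0 + (\<Sum>k\<in>UNIV. a k) else a None
     else a (Some (snd x / fst x)))"

lemma line_fun_table:
  "line_fun a0 a (GF4 1 0, y) = a (Some y)"
  "line_fun a0 a (GF4 0 0, GF4 0 0) = a0 + (\<Sum>k\<in>UNIV. a k)"
  "line_fun a0 a (GF4 0 0, GF4 1 0) = a None"
  "line_fun a0 a (GF4 0 0, GF4 0 1) = a None"
  "line_fun a0 a (GF4 0 0, GF4 1 1) = a None"
  "line_fun a0 a (GF4 0 1, GF4 0 0) = a (Some (GF4 0 0))"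
  "line_fun a0 a (GF4 0 1, GF4 1 0) = a (Some (GF4 1 1))"
  "line_fun a0 a (GF4 0 1, GF4 0 1) = a (Some (GF4 1 0))"
  "line_fun a0 a (GF4 0 1, GF4 1 1) = a (Some (GF4 0 1))"
  "line_fun a0 a (GF4 1 1, GF4 0 0) = a (Some (GF4 0 0))"
  "line_fun a0 a (GF4 1 1, GF4 1 0) = a (Some (GF4 0 1))"
  "line_fun a0 a (GF4 1 1, GF4 0 1) = a (Some (GF4 1 1))"
  "line_fun a0 a (GF4 1 1, GF4 1 1) = a (Some (GF4 1 0))"
  by (cases y; simp add: line_fun_def zero_gf4_def divide_gf4_def inverse_gf4_def power2_eq_square one_gf4_def)
    (simp_all add: line_fun_def zero_gf4_def divide_gf4_def inverse_gf4_def power2_eq_square one_gf4_def)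

lemma line_fun_product_origin: "line_fun (a0 * b0) (\<lambda>k. a0 * b k + b0 * a k + line_form a b) (GF4 0 0, GF4 0 0) =
  (a0 + (\<Sum>k\<in>UNIV. a k)) * (b0 + (\<Sum>k\<in>UNIV. b k)) + (\<Sum>k\<in>UNIV. a k * b k)"
  by (simp only: line_fun_table sum.distrib sum_line_const sum_distrib_left[symmetric] line_form_def distrib_left distrib_right ac_simps)

text \<open>The coefficient of each \<open>1\<^sub>k\<close> contains \<open>line_form a b\<close> because the indicator of \<open>U\<close> is the sum of
  all \<open>1\<^sub>k\<close>: the origin is counted five times. The identity is checked at the 16 points of \<open>U\<close>.\<close>

lemma convolution_line_fun:
  "convolution (line_fun a0 a) (line_fun b0 b) = line_fun (a0 * b0) (\<lambda>k. a0 * b k + b0 * a k + line_form a b)" (is "?l = ?r")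
proof (rule ext)
  fix x :: "gf4 \<times> gf4"
  let ?U = "{GF4 0 0, GF4 1 0, GF4 0 1, GF4 1 1}"
  obtain y z where x: "x = (y, z)" by (cases x)
  have "y \<in> ?U" "z \<in> ?U" using UNIV_gf4_eq by blast+
  then consider "y = GF4 0 0 \<and> z = GF4 0 0" | "y = GF4 0 0" "z \<in> {GF4 1 0, GF4 0 1, GF4 1 1}"
    | "y \<in> {GF4 1 0, GF4 0 1, GF4 1 1}" "z \<in> ?U"
    by blast
  then show "?l x = ?r x"
  proof cases
    case 1
    then have x0: "x = (GF4 0 0, GF4 0 0)" using x by simp
    show ?thesis
      unfolding x0
      by (simp only: line_fun_product_origin; simp only: convolution_def sum_U sum_gf4 add_Pair plus_gf4.simps bit_table line_fun_table
        sum_line add.assoc bit_add_self bit_add_self_left;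
        simp only: ac_simps bit_add_self bit_add_self_left add_0_left add_0_right)
  next
    case 2
    from 2(2) show ?thesis
      unfolding x 2(1)
      by (elim insertE emptyE; hypsubst;
          simp only: convolution_def sum_U sum_gf4 add_Pair plus_gf4.simps bit_table line_fun_table line_form_def sum_line;
          simp only: distrib_left distrib_right add.assoc bit_add_self bit_add_self_left add_0_right;
          simp only: mult.commute mult.left_commute mult.assoc add.commute add.left_commute add.assoc
            bit_add_self bit_add_self_left add_0_right add_0_left)
  next
    case 3
    then show ?thesis
      unfolding x
      by (elim insertE emptyE; hypsubst;
          simp only: convolution_def sum_U sum_gf4 add_Pair plus_gf4.simps bit_table line_fun_table line_form_def sum_line;
          simp only: distrib_left distrib_right add.assoc bit_add_self bit_add_self_left add_0_right;
          simp only: mult.commute mult.left_commute mult.assoc add.commute add.left_commute add.assoc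
            bit_add_self bit_add_self_left add_0_right add_0_left)
  qed
qed

lemma line_fun_add: "line_fun (a0 + b0) (\<lambda>k. a k + b k) u = line_fun a0 a u + line_fun b0 b u"
  by (cases "fst u = 0"; cases "snd u = 0")
    (simp_all only: line_fun_def simp_thms if_True if_False sum.distrib ac_simps)

type_synonym coords = "(bit \<times> (line \<Rightarrow> bit)) \<times> (bit \<times> (line \<Rightarrow> bit))"

text \<open>The element \<open>((a0, a), (b0, b))\<close> is \<open>p + q w\<close> in the algebra, where \<open>w\<close> is the indicator of \<open>W\<close> and
  \<open>p\<close>, \<open>q\<close> are the functions on \<open>U\<close> with coordinates \<open>(a0, a)\<close> and \<open>(b0, b)\<close>. Functions on \<open>U\<close> are
  extended to \<open>V\<close> by 0, so \<open>p\<close> is supported on \<open>y = 0\<close>, while \<open>q w\<close> is constant in \<open>y\<close>.\<close>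

definition invariant_fun :: "coords \<Rightarrow> V \<Rightarrow> bit" where
  "invariant_fun = (\<lambda>((a0, a), (b0, b)). \<lambda>(u, y). line_fun b0 b u + (if y = 0 then line_fun a0 a u else 0))"

text \<open>The product \<open>(p + q w) (p' + q' w) = p p' + (p q' + q p') w\<close>, as \<open>w\<^sup>2 = 8 w = 0\<close>.\<close>

definition mult_coords :: "coords \<Rightarrow> coords \<Rightarrow> coords" where
  "mult_coords = (\<lambda>((a0, a), (b0, b)) ((a0', a'), (b0', b')).
    ((a0 * a0', \<lambda>k. a0 * a' k + a0' * a k + line_form a a'),
     (a0 * b0' + b0 * a0', \<lambda>k. (a0 * b' k + b0' * a k + line_form a b') + (b0 * a' k + a0' * b k + line_form b a'))))"

lemma sum_gf8_const: "(\<Sum>y\<in>(UNIV :: gf8 set). c) = (0 :: bit)"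
proof -
  have "(of_nat 8 :: bit) = 0" by simp
  then show ?thesis by (simp add: CARD_gf8)
qed

lemma add_eq_0_gf8: "(y :: gf8) + z = 0 \<longleftrightarrow> y = z"
proof -
  have "z + z = 0" for z :: gf8 by (cases z) (simp add: zero_gf8_def)
  then show ?thesis by (metis add_right_cancel)
qed

lemma convolution_invariant_fun: "convolution (invariant_fun c) (invariant_fun d) = invariant_fun (mult_coords c d)"
proof -
  obtain a0 a b0 b where c: "c = ((a0, a), (b0, b))" by (metis surj_pair)
  obtain a0' a' b0' b' where d: "d = ((a0', a'), (b0', b'))" by (metis surj_pair)
  have "convolution (invariant_fun c) (invariant_fun d) (r, z) = invariant_fun (mult_coords c d) (r, z)" for r z
  proof -
    let ?p = "line_fun a0 a" and ?q = "line_fun b0 b" and ?p' = "line_fun a0' a'" and ?q' = "line_fun b0' b'"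
    have inner: "(\<Sum>y\<in>UNIV. invariant_fun c (u, y) * invariant_fun d (u + r, y + z)) =
        ?p u * ?q' (u + r) + ?q u * ?p' (u + r) + (if z = 0 then ?p u * ?p' (u + r) else 0)" for u
    proof -
      have "(\<Sum>y\<in>UNIV. invariant_fun c (u, y) * invariant_fun d (u + r, y + z)) =
          (\<Sum>y\<in>UNIV. ?q u * ?q' (u + r) + ((if y = 0 then ?p u * ?q' (u + r) else 0) +
            ((if y = z then ?q u * ?p' (u + r) else 0) +
             (if y = 0 then if z = 0 then ?p u * ?p' (u + r) else 0 else 0))))"
        by (rule sum.cong) (auto simp only: c d invariant_fun_def prod.case add_eq_0_gf8 distrib_left distrib_right
          ac_simps mult_zero_left mult_zero_right add_0_left add_0_right add_0 if_True if_False split: if_split)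
      also have "\<dots> = ?p u * ?q' (u + r) + ?q u * ?p' (u + r) + (if z = 0 then ?p u * ?p' (u + r) else 0)"
        by (simp only: sum.distrib sum_gf8_const sum.delta finite UNIV_I if_True ac_simps add_0_left)
      finally show ?thesis .
    qed
    have "convolution (invariant_fun c) (invariant_fun d) (r, z) = (\<Sum>u\<in>UNIV. \<Sum>y\<in>UNIV. invariant_fun c (u, y) * invariant_fun d (u + r, y + z))"
      by (simp only: convolution_def sum.cartesian_product UNIV_Times_UNIV)
        (simp only: case_prod_unfold add_Pair[symmetric] prod.collapse)
    also have "\<dots> = convolution ?p ?q' r + convolution ?q ?p' r + (if z = 0 then convolution ?p ?p' r else 0)"
      by (simp only: inner convolution_def sum.distrib) (simp only: sum.neutral_const split: if_split; simp)
    also have "\<dots> = invariant_fun (mult_coords c d) (r, z)"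
      by (simp only: convolution_line_fun invariant_fun_def mult_coords_def c d prod.case line_fun_add)
    finally show ?thesis .
  qed
  then show ?thesis by (simp only: fun_eq_iff split_paired_All simp_thms)
qed

lemma bit_cases: "x = 0 \<or> x = 1" for x :: bit
  by (metis bit_not_one_iff)

definition line_point :: "line \<Rightarrow> gf4 \<times> gf4" where
  "line_point k = (case k of None \<Rightarrow> (0, 1) | Some y \<Rightarrow> (1, y))"

lemma line_fun_point: "line_fun a0 a (line_point k) = a k"
  by (simp add: line_fun_def line_point_def split: option.split)

lemma line_fun_origin: "line_fun a0 a (0, 0) = a0 + (\<Sum>k\<in>UNIV. a k)"
  by (simp only: line_fun_def fst_conv snd_conv simp_thms if_True)

lemma line_fun_inject: "line_fun a0 a = line_fun b0 b \<longleftrightarrow> a0 = b0 \<and> a = b"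
proof
  assume eq: "line_fun a0 a = line_fun b0 b"
  then have "a = b" by (metis line_fun_point ext)
  moreover have "a0 + (\<Sum>k\<in>UNIV. a k) = b0 + (\<Sum>k\<in>UNIV. b k)" using eq by (metis line_fun_origin)
  ultimately show "a0 = b0 \<and> a = b" by (metis add_right_cancel)
qed simp

lemma invariant_fun_apply: "invariant_fun ((a0, a), (b0, b)) (u, y) = line_fun b0 b u + (if y = 0 then line_fun a0 a u else 0)"
  by (simp only: invariant_fun_def prod.case)

lemma inj_invariant_fun: "inj invariant_fun"
proof (rule injI)
  fix c d assume eq: "invariant_fun c = invariant_fun d"
  obtain a0 a b0 b where c: "c = ((a0, a), (b0, b))" by (metis surj_pair)
  obtain a0' a' b0' b' where d: "d = ((a0', a'), (b0', b'))" by (metis surj_pair)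
  have "line_fun b0 b u = line_fun b0' b' u" for u
    using fun_cong[OF eq, of "(u, 1)"] by (simp only: c d invariant_fun_apply one_neq_zero if_False add_0_right)
  then have b: "line_fun b0 b = line_fun b0' b'" by blast
  have "line_fun a0 a u = line_fun a0' a' u" for u
    using fun_cong[OF eq, of "(u, 0)"] by (simp only: c d invariant_fun_apply b if_True add_left_cancel simp_thms)
  then have "line_fun a0 a = line_fun a0' a'" by blast
  with b show "c = d" by (simp only: c d line_fun_inject simp_thms)
qed

text \<open>The \<open>n\<close> first powers are different and nonzero, so they fill the multiplicative group.\<close>

lemma powers_exhaust:
  fixes x :: "'a :: field"
  assumes x: "has_order x n" and card: "card (UNIV :: 'a set) = n + 1" and c: "c \<noteq> 0"
  shows "\<exists>i. c = x ^ i"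
proof -
  have x0: "x \<noteq> 0" using x by (auto simp: has_order_def power_0_left)
  have fin: "finite (UNIV :: 'a set)" using card by (metis card.infinite add_is_0 one_neq_zero)
  have "x ^ i \<noteq> x ^ j" if "i < j" "j < n" for i j
  proof
    assume "x ^ i = x ^ j"
    moreover have "x ^ i * x ^ (j - i) = x ^ j" using that by (simp flip: power_add)
    ultimately have "x ^ i * x ^ (j - i) = x ^ i * 1" by simp
    then have "x ^ (j - i) = 1" using x0 by (simp only: mult_cancel_left power_eq_0_iff) simp
    then show False using x that by (auto simp: has_order_def)
  qed
  then have "inj_on (power x) {..<n}"
    by (metis (mono_tags, lifting) inj_onI lessThan_iff linorder_neqE_nat)
  then have "card (power x ` {..<n}) = card (UNIV - {0 :: 'a})"
    using fin card by (simp add: card_image card_Diff_subset)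
  moreover have "power x ` {..<n} \<subseteq> UNIV - {0}" using x0 by auto
  ultimately have "power x ` {..<n} = UNIV - {0}"
    using fin by (metis card_subset_eq finite_Diff)
  then show ?thesis using c by (metis DiffI UNIV_I imageE singletonD)
qed

lemma T_pow: "(T \<omega> \<zeta> ^^ k) ((x1, x2), y) = ((\<omega> ^ k * x1, \<omega> ^ k * x2), \<zeta> ^ k * y)"
  by (induction k) (simp_all add: mult.assoc)

text \<open>Chinese remaindering: for \<open>c = \<omega>\<^sup>i\<close> and \<open>d = \<zeta>\<^sup>j\<close> the power of \<open>T\<close> with exponent \<open>7 i + 15 j\<close> scales \<open>U\<close> by
  \<open>c\<close> and \<open>W\<close> by \<open>d\<close>, because 7 and 15 are the orthogonal idempotents modulo 21.\<close>

lemma scale_invariant: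
  assumes \<omega>: "has_order \<omega> 3" and \<zeta>: "has_order \<zeta> 7" and s: "s \<circ> T \<omega> \<zeta> = s"
    and c: "c \<noteq> 0" and d: "d \<noteq> 0"
  shows "s ((c * x1, c * x2), d * y) = s ((x1, x2), y)"
proof -
  obtain i where i: "c = \<omega> ^ i" using powers_exhaust[OF \<omega> _ c] CARD_gf4 by auto
  obtain j where j: "d = \<zeta> ^ j" using powers_exhaust[OF \<zeta> _ d] CARD_gf8 by auto
  have "s ((T \<omega> \<zeta> ^^ k) x) = s x" for k x
    using s by (induction k) (simp_all add: fun_eq_iff del: split_paired_All)
  from this[of "7 * i + 15 * j" "((x1, x2), y)"]
  have "s ((\<omega> ^ (7 * i + 15 * j) * x1, \<omega> ^ (7 * i + 15 * j) * x2), \<zeta> ^ (7 * i + 15 * j) * y) =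
      s ((x1, x2), y)"
    by (simp only: T_pow)
  moreover have "\<omega> ^ (7 * i + 15 * j) = c"
  proof -
    have "\<omega> ^ (7 * i + 15 * j) = \<omega> ^ (i + 3 * (2 * i + 5 * j))" by (rule arg_cong[of _ _ "power \<omega>"]) simp
    also have "\<dots> = c" using \<omega> by (simp only: power_add power_mult has_order_def i power_one mult_1_right)
    finally show ?thesis .
  qed
  moreover have "\<zeta> ^ (7 * i + 15 * j) = d"
  proof -
    have "\<zeta> ^ (7 * i + 15 * j) = \<zeta> ^ (j + 7 * (i + 2 * j))" by (rule arg_cong[of _ _ "power \<zeta>"]) simp
    also have "\<dots> = d" using \<zeta> by (simp only: power_add power_mult has_order_def j power_one mult_1_right)
    finally show ?thesis .
  qed
  ultimately show ?thesis by simp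
qed

lemma line_fun_scale: "c \<noteq> 0 \<Longrightarrow> line_fun a0 a (c * x, c * y) = line_fun a0 a (x, y)"
  by (simp add: line_fun_def)

lemma invariant_functions:
  assumes \<omega>: "has_order \<omega> 3" and \<zeta>: "has_order \<zeta> 7"
  shows "{s. s \<circ> T \<omega> \<zeta> = s} = range invariant_fun"
proof (intro equalityI subsetI)
  fix s :: "V \<Rightarrow> bit" assume "s \<in> range invariant_fun"
  then obtain a0 a b0 b where s: "s = invariant_fun ((a0, a), (b0, b))" by (metis imageE surj_pair)
  have "\<omega> \<noteq> 0" "\<zeta> \<noteq> 0" using assms by (auto simp: has_order_def)
  then have "s (T \<omega> \<zeta> ((x1, x2), y)) = s ((x1, x2), y)" for x1 x2 y
    by (simp only: s T.simps invariant_fun_apply line_fun_scale mult_eq_0_iff simp_thms)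
  then show "s \<in> {s. s \<circ> T \<omega> \<zeta> = s}"
    by (simp only: mem_Collect_eq fun_eq_iff comp_apply split_paired_All simp_thms)
next
  fix s :: "V \<Rightarrow> bit" assume "s \<in> {s. s \<circ> T \<omega> \<zeta> = s}"
  then have scale: "s ((c * x1, c * x2), d * y) = s ((x1, x2), y)" if "c \<noteq> 0" "d \<noteq> 0" for c d x1 x2 y
    using scale_invariant[OF \<omega> \<zeta>] that by blast
  have line_fun_ex: "\<exists>a0 a. h = line_fun a0 a" if h: "\<And>c x1 x2. c \<noteq> 0 \<Longrightarrow> h (c * x1, c * x2) = h (x1, x2)" for h
  proof -
    have "h (x1, x2) = line_fun (h (0, 0) + (\<Sum>k\<in>UNIV. h (line_point k))) (\<lambda>k. h (line_point k)) (x1, x2)" for x1 x2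
    proof (cases "x1 = 0")
      case True
      show ?thesis
      proof (cases "x2 = 0")
        case True
        have "x + y + y = x" for x y :: bit by (simp only: add.assoc bit_add_self add_0_right)
        then show ?thesis using \<open>x1 = 0\<close> True by (simp only: line_fun_origin)
      next
        case False
        then show ?thesis using \<open>x1 = 0\<close> h[of x2 0 1] by (simp add: line_fun_def line_point_def)
      qed
    next
      case False
      then show ?thesis using h[of x1 1 "x2 / x1"] by (simp add: line_fun_def line_point_def)
    qed
    then show ?thesis by (metis ext surj_pair)
  qed
  obtain b0 b where b: "(\<lambda>u. s (u, 1)) = line_fun b0 b"
    using line_fun_ex[of "\<lambda>u. s (u, 1)"] scale[of _ 1 _ _ 1] by auto
  obtain a0 a where a: "(\<lambda>u. s (u, 1) + s (u, 0)) = line_fun a0 a"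
    using line_fun_ex[of "\<lambda>u. s (u, 1) + s (u, 0)"] scale[of _ 1 _ _ 1] scale[of _ 1 _ _ 0] by auto
  have "s (u, y) = invariant_fun ((a0, a), (b0, b)) (u, y)" for u y
  proof (cases "y = 0")
    case True
    then show ?thesis
      by (simp only: invariant_fun_apply fun_cong[OF a, symmetric] fun_cong[OF b, symmetric] simp_thms if_True bit_add_self_left)
  next
    case False
    then have "s (u, y) = s (u, 1)" using scale[of 1 y "fst u" "snd u" 1] by simp
    then show ?thesis
      using False by (simp only: invariant_fun_apply fun_cong[OF b, symmetric] if_False add_0_right)
  qed
  then have "s = invariant_fun ((a0, a), (b0, b))" by (simp only: fun_eq_iff split_paired_All simp_thms)
  then show "s \<in> range invariant_fun" by blast
qed

section \<open>Vanishing character sums\<close>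

definition sign_of :: "bit \<Rightarrow> int" where "sign_of b = (if b = 0 then 1 else - 1)"

definition hamming_weight :: "(line \<Rightarrow> bit) \<Rightarrow> nat" where "hamming_weight a = card {k. a k = 1}"

lemma hamming_weight_le: "hamming_weight a \<le> 5"
  using card_mono[of UNIV "{k. a k = 1}"] by (simp add: hamming_weight_def card_line)

lemma sum_line_bit: "(\<Sum>k\<in>UNIV. a k) = of_nat (hamming_weight a)"
proof -
  have "(\<Sum>k\<in>UNIV. a k) = (\<Sum>k\<in>UNIV. if a k = 1 then 1 else 0)" by (rule sum.cong) auto
  also have "\<dots> = (\<Sum>k\<in>{k. a k = 1}. 1)" by (subst sum.inter_filter[symmetric]) simp_all
  finally show ?thesis by (simp only: hamming_weight_def sum_constant mult_1_right)
qed

lemma sum_line_sign_of: "(\<Sum>k\<in>UNIV. sign_of (a k)) = 5 - 2 * int (hamming_weight a)"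
proof -
  have "(\<Sum>k\<in>UNIV. sign_of (a k)) = (\<Sum>k\<in>UNIV. 1 - 2 * (if a k = 1 then 1 else 0))"
    by (rule sum.cong) (auto simp: sign_of_def)
  also have "\<dots> = 5 - 2 * (\<Sum>k\<in>UNIV. if a k = 1 then 1 else 0)"
    by (simp add: sum_subtractf card_line sum_distrib_left)
  also have "(\<Sum>k\<in>UNIV. if a k = 1 then 1 else 0 :: int) = int (hamming_weight a)"
    unfolding hamming_weight_def by (subst sum.inter_filter[symmetric, of UNIV, simplified]) simp_all
  finally show ?thesis .
qed

lemma sum_line_fun_sign_of: "(\<Sum>u\<in>UNIV. sign_of (line_fun a0 a u)) = sign_of (a0 + (\<Sum>k\<in>UNIV. a k)) + 3 * (5 - 2 * int (hamming_weight a))"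
proof -
  have "(\<Sum>u\<in>UNIV. sign_of (line_fun a0 a u)) = sign_of (a0 + (\<Sum>k\<in>UNIV. a k)) + 3 * (\<Sum>k\<in>UNIV. sign_of (a k))"
    unfolding sum_U sum_gf4 line_fun_table sum_line[of "\<lambda>k. sign_of (a k)"] by simp
  then show ?thesis by (simp only: sum_line_sign_of)
qed

lemma sum_invariant_fun_sign_of:
  "(\<Sum>r\<in>UNIV. sign_of (invariant_fun ((a0, a), (b0, b)) r)) =
    (\<Sum>u\<in>UNIV. sign_of (line_fun (a0 + b0) (\<lambda>k. a k + b k) u)) + 7 * (\<Sum>u\<in>UNIV. sign_of (line_fun b0 b u))"
proof -
  have card7: "card (UNIV - {0 :: gf8}) = 7" by (simp add: card_Diff_subset CARD_gf8)
  have "(\<Sum>y\<in>UNIV. sign_of (invariant_fun ((a0, a), (b0, b)) (u, y))) =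
      sign_of (line_fun (a0 + b0) (\<lambda>k. a k + b k) u) + 7 * sign_of (line_fun b0 b u)" for u
  proof -
    have "(\<Sum>y\<in>UNIV. sign_of (invariant_fun ((a0, a), (b0, b)) (u, y))) =
        sign_of (invariant_fun ((a0, a), (b0, b)) (u, 0)) + (\<Sum>y\<in>UNIV - {0}. sign_of (invariant_fun ((a0, a), (b0, b)) (u, y)))"
      by (rule sum.remove) simp_all
    also have "(\<Sum>y\<in>UNIV - {0}. sign_of (invariant_fun ((a0, a), (b0, b)) (u, y))) = (\<Sum>y\<in>UNIV - {0 :: gf8}. sign_of (line_fun b0 b u))"
      by (rule sum.cong) (simp_all only: invariant_fun_apply Diff_iff singleton_iff simp_thms if_False add_0_right)
    also have "invariant_fun ((a0, a), (b0, b)) (u, 0) = line_fun (a0 + b0) (\<lambda>k. a k + b k) u"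
      by (simp only: invariant_fun_apply line_fun_add simp_thms if_True add.commute)
    finally show ?thesis by (simp add: card7)
  qed
  moreover have "(\<Sum>r\<in>UNIV. sign_of (invariant_fun ((a0, a), (b0, b)) r)) = (\<Sum>u\<in>UNIV. \<Sum>y\<in>UNIV. sign_of (invariant_fun ((a0, a), (b0, b)) (u, y)))"
    by (simp only: sum.cartesian_product UNIV_Times_UNIV) (simp only: case_prod_unfold prod.collapse)
  ultimately show ?thesis by (simp add: sum.distrib sum_distrib_left)
qed

text \<open>The orbits of \<open>T\<close> on \<open>V\<close> have sizes 1, 3 (five times), 7 and 21 (five times). Up to a global
  sign, the only way in which the signed sizes cancel is \<open>1 - 5 \<cdot> 3 - 7 + (3 - 2) \<cdot> 21 = 0\<close>.\<close>

definition balanced :: "coords \<Rightarrow> bool" where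
  "balanced = (\<lambda>((a0, a), (b0, b)). a0 = 0 \<and> b0 = 1 \<and>
     (hamming_weight b = 2 \<and> a = (\<lambda>k. b k + 1) \<or> hamming_weight b = 3 \<and> a = b))"

lemma hamming_weight_eq_5: "hamming_weight a = 5 \<longleftrightarrow> (\<forall>k. a k = 1)"
proof
  assume "hamming_weight a = 5"
  then have "{k. a k = 1} = UNIV"
    unfolding hamming_weight_def using card_subset_eq[of UNIV "{k. a k = 1}"] by (simp add: card_line)
  then show "\<forall>k. a k = 1" by blast
qed (simp add: hamming_weight_def card_line)

lemma hamming_weight_eq_0: "hamming_weight a = 0 \<longleftrightarrow> (\<forall>k. a k = 0)"
  by (auto simp: hamming_weight_def)

text \<open>With \<open>x0\<close> and \<open>w\<close> describing the values at 0 and on the orbits of size 3, and \<open>y0\<close> and the weight of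
  \<open>b\<close> those on the orbits of size 7 and 21, the sum is an explicit integer in four small unknowns and
  can be checked in all cases.\<close>

lemma sum_invariant_fun_eq_0_iff:
  "(\<Sum>r\<in>UNIV. sign_of (invariant_fun c r)) = 0 \<longleftrightarrow> balanced c"
proof -
  obtain a0 a b0 b where c: "c = ((a0, a), (b0, b))" by (metis surj_pair)
  define x0 where "x0 = a0 + b0 + (\<Sum>k\<in>UNIV. a k + b k)"
  define y0 where "y0 = b0 + (\<Sum>k\<in>UNIV. b k)"
  define w where "w = hamming_weight (\<lambda>k. a k + b k)"
  have sum: "(\<Sum>r\<in>UNIV. sign_of (invariant_fun c r)) = sign_of x0 + 3 * (5 - 2 * int w) + 7 * (sign_of y0 + 3 * (5 - 2 * int (hamming_weight b)))"
    by (simp only: c sum_invariant_fun_sign_of sum_line_fun_sign_of x0_def y0_def w_def)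
  have "(\<Sum>r\<in>UNIV. sign_of (invariant_fun c r)) = 0 \<longleftrightarrow>
      x0 = 0 \<and> w = 5 \<and> y0 = 1 \<and> hamming_weight b = 2 \<or> x0 = 1 \<and> w = 0 \<and> y0 = 0 \<and> hamming_weight b = 3"
  proof -
    have "w \<in> {0, 1, 2, 3, 4, 5}" "hamming_weight b \<in> {0, 1, 2, 3, 4, 5}"
      using hamming_weight_le[of b] hamming_weight_le[of "\<lambda>k. a k + b k"] unfolding w_def by auto
    then show ?thesis
      unfolding sum using bit_cases[of x0] bit_cases[of y0]
      by (elim insertE disjE emptyE) (simp_all add: sign_of_def)
  qed
  also have "\<dots> \<longleftrightarrow> balanced c"
  proof -
    have even: "(\<Sum>k\<in>UNIV. b k) = 0" if "hamming_weight b = 2" by (simp add: sum_line_bit that)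
    have odd: "(\<Sum>k\<in>UNIV. b k) = 1" if "hamming_weight b = 3" by (simp add: sum_line_bit that)
    have w5: "w = 5 \<longleftrightarrow> a = (\<lambda>k. b k + 1)"
    proof -
      have "x + y = 1 \<longleftrightarrow> x = y + 1" for x y :: bit using bit_cases[of x] bit_cases[of y] by auto
      then show ?thesis unfolding w_def hamming_weight_eq_5 fun_eq_iff by presburger
    qed
    have w0: "w = 0 \<longleftrightarrow> a = b"
    proof -
      have "x + y = 0 \<longleftrightarrow> x = y" for x y :: bit using bit_cases[of x] bit_cases[of y] by auto
      then show ?thesis unfolding w_def hamming_weight_eq_0 fun_eq_iff by presburger
    qed
    have "x0 = a0 + b0 + 1" if "a = (\<lambda>k. b k + 1)"
    proof -
      have "x + 1 + x = 1" for x :: bit using bit_cases[of x] by auto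
      then show ?thesis unfolding x0_def that by (simp only: sum_line_const)
    qed
    moreover have "x0 = a0 + b0" if "a = b"
      unfolding x0_def that by (simp only: bit_add_self sum.neutral_const add_0_right)
    ultimately show ?thesis
      unfolding w5 w0 c balanced_def prod.case y0_def using even odd by (cases a0; cases b0) auto
  qed
  finally show ?thesis .
qed

section \<open>Invariant functions with a balanced multiple\<close>

text \<open>The first alternative describes the units of the algebra. In the second, \<open>s\<close> is congruent to a
  balanced element modulo the square of the maximal ideal, and the value of \<open>line_form a b\<close> says that
  it can be carried to one by a unit.\<close>

definition vanishing_criterion :: "coords \<Rightarrow> bool" where
  "vanishing_criterion = (\<lambda>((a0, a), (b0, b)). a0 = 1 \<or>
     a0 = 0 \<and> b0 = 1 \<and> (hamming_weight a = 3 \<and> line_form a b = 0 \<or> hamming_weight a = 2 \<and> line_form a b = 1))"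

text \<open>The square of a unit is 1, so a unit has every element as a multiple. For a non-unit \<open>s\<close> the coefficient of \<open>w\<close> in a balanced multiple \<open>s * f\<close>
  forces \<open>f\<close> to be a unit, and comparing coefficients expresses \<open>f\<close> through \<open>s\<close> up to terms that
  \<open>line_form a\<close> annihilates.\<close>

lemma exists_balanced_multiple: "(\<exists>d. balanced (mult_coords c d)) \<longleftrightarrow> vanishing_criterion c"
proof -
  obtain a0 a b0 b where c: "c = ((a0, a), (b0, b))" by (metis surj_pair)
  have hamming_weight_compl: "hamming_weight (\<lambda>k. x k + 1) = 5 - hamming_weight x" for x
  proof -
    have "{k. x k + 1 = 1} = UNIV - {k. x k = 1}" by auto
    then show ?thesis by (simp only: hamming_weight_def) (simp add: card_Diff_subset card_line)
  qed
  show ?thesis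
  proof (cases "a0 = 1")
    case True
    have "hamming_weight (\<lambda>k. if k = None \<or> k = Some 0 then 1 else 0) = card {None, Some (0 :: gf4)}"
      unfolding hamming_weight_def by (rule arg_cong[of _ _ card]) auto
    also have "\<dots> = 2" by simp
    finally obtain z where z: "hamming_weight z = 2" by blast
    define z' where "z' = (\<lambda>k. z k + 1)"
    \<comment> \<open>multiply the balanced element by the inverse of \<open>c\<close>, which is \<open>c\<close> itself\<close>
    have "mult_coords c (mult_coords c ((0, z'), (1, z))) = ((0, z'), (1, z))"
      by (simp only: c True mult_coords_def prod.case mult_1_left mult_zero_left mult_zero_right add_0_left add_0_right
          mult_1_right line_form_add line_form_scale line_form_const line_form_self prod.inject simp_thms fun_eq_iff
          bit_add_self bit_add_self_left distrib_left line_form_commute[of b a])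
        (simp only: ac_simps bit_add_self bit_add_self_left simp_thms add_0_left add_0_right)
    moreover have "balanced ((0, z'), (1, z))" by (simp add: balanced_def z'_def z)
    ultimately have "\<exists>d. balanced (mult_coords c d)" by metis
    then show ?thesis by (simp add: c True vanishing_criterion_def)
  next
    case False
    then have a0: "a0 = 0" using bit_cases by blast
    show ?thesis
    proof
      assume "vanishing_criterion c"
      then have b0: "b0 = 1" and or: "hamming_weight a = 3 \<and> line_form a b = 0 \<or> hamming_weight a = 2 \<and> line_form a b = 1"
        using False by (auto simp: c vanishing_criterion_def)
      \<comment> \<open>the solution of the equations in the other direction with \<open>h0 = 1\<close> and \<open>h = 0\<close>\<close>
      have "mult_coords c ((1, b), (1, \<lambda>k. 0)) = ((0, \<lambda>k. a k + line_form a b), (1, a))"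
        by (simp only: c a0 b0 mult_coords_def prod.case mult_1_left mult_zero_left mult_zero_right add_0_left add_0_right
            mult_1_right line_form_const line_form_self prod.inject simp_thms bit_add_self fun_eq_iff)
      then have "balanced (mult_coords c ((1, b), (1, \<lambda>k. 0)))"
        using or by (auto simp: balanced_def)
      then show "\<exists>d. balanced (mult_coords c d)" by blast
    next
      assume "\<exists>d. balanced (mult_coords c d)"
      then obtain f0 f h0 h where bal: "balanced (mult_coords c ((f0, f), (h0, h)))" by (metis surj_pair)
      define A where "A = (\<lambda>k. f0 * a k + line_form a f)"
      define B' where "B' = (\<lambda>k. (h0 * a k + line_form a h) + (b0 * f k + f0 * b k + line_form b f))"
      have cm: "mult_coords c ((f0, f), (h0, h)) = ((0, A), (b0 * f0, B'))"
        by (simp only: c a0 mult_coords_def prod.case mult_zero_left add_0_left A_def B'_def)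
      have "b0 * f0 = 1" and AB: "hamming_weight B' = 2 \<and> A = (\<lambda>k. B' k + 1) \<or> hamming_weight B' = 3 \<and> A = B'"
        using bal unfolding cm balanced_def by auto
      then have b0: "b0 = 1" and f0: "f0 = 1" using bit_cases by (metis mult_zero_left mult_zero_right zero_neq_one)+
      have A: "A = (\<lambda>k. a k + line_form a f)" by (simp only: A_def f0 mult_1_left)
      obtain e where e: "A = (\<lambda>k. B' k + e)"
        using AB by (metis (no_types, lifting) ext add_0_right)
      have f: "f = (\<lambda>k. b k + (h0 * a k + (a k + (e + (line_form a h + (line_form b f + line_form a f))))))"
      proof
        fix k
        have "a k + line_form a f = B' k + e" using A e by metis
        also have "\<dots> = f k + (b k + (h0 * a k + (e + (line_form a h + line_form b f))))"
          by (simp only: B'_def b0 f0 mult_1_left ac_simps)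
        finally have "f k + (a k + line_form a f) = b k + (h0 * a k + (e + (line_form a h + line_form b f)))"
          by (simp only: bit_add_self_left)
        then have "f k + (a k + line_form a f) + (a k + line_form a f) = b k + (h0 * a k + (e + (line_form a h + line_form b f))) + (a k + line_form a f)"
          by (rule arg_cong)
        then show "f k = b k + (h0 * a k + (a k + (e + (line_form a h + (line_form b f + line_form a f)))))"
          by (simp only: add.assoc bit_add_self add_0_right) (simp only: ac_simps)
      qed
      have "line_form a f = line_form a b"
      proof -
        have "line_form a f = line_form a (\<lambda>k. b k + (h0 * a k + (a k + (e + (line_form a h + (line_form b f + line_form a f))))))"
          by (rule arg_cong[OF f])
        then show ?thesis by (simp only: line_form_add line_form_scale line_form_self line_form_const mult_zero_right add_0_left add_0_right)
      qed
      moreover have "hamming_weight A = 3" using AB hamming_weight_compl[of B'] by auto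
      moreover have "hamming_weight (\<lambda>k. a k + x) = (if x = 0 then hamming_weight a else 5 - hamming_weight a)" for x
      proof (cases "x = 0")
        case False
        then have "x = 1" using bit_cases by blast
        then show ?thesis using hamming_weight_compl[of a] by simp
      qed (simp only: add_0_right simp_thms if_True)
      ultimately have "(if line_form a b = 0 then hamming_weight a else 5 - hamming_weight a) = 3" unfolding A by metis
      then show "vanishing_criterion c" using hamming_weight_le[of a] by (auto simp: c a0 b0 vanishing_criterion_def split: if_splits)
    qed
  qed
qed

lemma card_line_fun: "card (UNIV :: (line \<Rightarrow> bit) set) = 32"
  by (simp only: card_UNIV_fun card_bit card_line) simp

lemma card_hamming_weight: "card {a. hamming_weight a = j} = 5 choose j"
proof -
  have "bij_betw (\<lambda>a. {k. a k = (1 :: bit)}) {a. hamming_weight a = j} {S. S \<subseteq> (UNIV :: line set) \<and> card S = j}"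
  proof (rule bij_betw_byWitness[where f' = "\<lambda>S k. if k \<in> S then 1 else 0"])
    show "\<forall>a\<in>{a. hamming_weight a = j}. (\<lambda>k. if k \<in> {k. a k = (1 :: bit)} then 1 else 0) = a" by auto
  qed (auto simp: hamming_weight_def)
  then show ?thesis using n_subsets[of "UNIV :: line set" j] by (simp add: bij_betw_same_card card_line)
qed

text \<open>The hypothesis says that the linear form \<open>line_form a\<close> does not vanish at the basis vector of \<open>k\<close>, so
  adding this basis vector exchanges its two fibres.\<close>

lemma card_line_form:
  assumes k: "(\<Sum>k\<in>UNIV. a k) + a k = 1"
  shows "card {b. line_form a b = x} = 16"
proof -
  define e :: "line \<Rightarrow> bit" where "e = (\<lambda>l. if l = k then 1 else 0)"
  have "line_form a e = 1"
  proof -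
    have "(\<Sum>l\<in>UNIV. e l) = 1" by (simp add: e_def)
    moreover have "(\<Sum>l\<in>UNIV. a l * e l) = (\<Sum>l\<in>UNIV. if l = k then a k else 0)"
      by (rule sum.cong) (auto simp: e_def)
    ultimately show ?thesis using k by (simp only: line_form_def mult_1_right sum.delta finite UNIV_I if_True)
  qed
  then have flip: "line_form a (\<lambda>l. b l + e l) = line_form a b + 1" for b by (simp only: line_form_add)
  have invol: "(\<lambda>l. (b l + e l) + e l) = b" for b by (simp only: add.assoc bit_add_self add_0_right)
  have "bij_betw (\<lambda>b l. b l + e l) {b. line_form a b = 0} {b. line_form a b = 1}"
    by (rule bij_betw_byWitness[where f' = "\<lambda>b l. b l + e l"])
      (auto simp only: invol flip mem_Collect_eq bit_table)
  then have "card {b. line_form a b = 0} = card {b. line_form a b = 1}" by (rule bij_betw_same_card)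
  moreover have "card {b. line_form a b = 0} + card {b. line_form a b = 1} = 32"
  proof -
    have "card {b. line_form a b = 0} + card {b. line_form a b = 1} = card ({b. line_form a b = 0} \<union> {b. line_form a b = 1})"
      by (rule card_Un_disjoint[symmetric]) auto
    also have "{b. line_form a b = 0} \<union> {b. line_form a b = 1} = UNIV" by auto
    finally show ?thesis by (simp only: card_line_fun)
  qed
  moreover have "x = 0 \<or> x = 1" by (rule bit_cases)
  ultimately show ?thesis by auto
qed

lemma card_vanishing_criterion: "card {c. vanishing_criterion c} = 2368"
proof -
  let ?S1 = "{a. hamming_weight a = 3}" and ?S2 = "{a. hamming_weight a = 2}"
  let ?X = "({1} \<times> UNIV) \<times> (UNIV \<times> UNIV) :: coords set"
  let ?g = "\<lambda>(a, b). ((0, a), (1, b)) :: coords"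
  let ?Y = "?g ` (SIGMA a:?S1. {b. line_form a b = 0})" and ?Z = "?g ` (SIGMA a:?S2. {b. line_form a b = 1})"
  have inj: "inj_on ?g M" for M by (auto simp: inj_on_def)
  have "c \<in> {c. vanishing_criterion c} \<longleftrightarrow> c \<in> ?X \<union> (?Y \<union> ?Z)" for c
  proof -
    obtain a0 a b0 b where c: "c = ((a0, a), (b0, b))" by (metis surj_pair)
    show ?thesis by (auto simp: c vanishing_criterion_def image_iff)
  qed
  then have eq: "{c. vanishing_criterion c} = ?X \<union> (?Y \<union> ?Z)" by blast
  have total: "card {c. vanishing_criterion c} = card ?X + (card ?Y + card ?Z)"
  proof -
    have "?X \<inter> (?Y \<union> ?Z) = {}" "?Y \<inter> ?Z = {}" by auto
    then show ?thesis
      by (simp only: eq card_Un_disjoint[OF finite finite])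
  qed
  have X: "card ?X = 2048"
    by (simp only: card_cartesian_product card_bit card_line_fun) simp
  have Y: "card ?Y = 160"
  proof -
    have "card {b. line_form a b = 0} = 16" if wa: "hamming_weight a = 3" for a
    proof -
      have "(\<Sum>k\<in>UNIV. a k) = 1" by (simp add: sum_line_bit wa)
      moreover obtain k where "a k \<noteq> 1" using hamming_weight_eq_5[of a] wa by auto
      ultimately have "(\<Sum>k\<in>UNIV. a k) + a k = 1" by simp
      then show ?thesis by (rule card_line_form)
    qed
    then show ?thesis by (simp add: card_image[OF inj] card_hamming_weight numeral_eq_Suc)
  qed
  have Z: "card ?Z = 160"
  proof -
    have "card {b. line_form a b = 1} = 16" if wa: "hamming_weight a = 2" for a
    proof -
      have "(\<Sum>k\<in>UNIV. a k) = 0" by (simp add: sum_line_bit wa)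
      moreover obtain k where "a k \<noteq> 0" using hamming_weight_eq_0[of a] wa by auto
      ultimately have "(\<Sum>k\<in>UNIV. a k) + a k = 1" by simp
      then show ?thesis by (rule card_line_form)
    qed
    then show ?thesis by (simp add: card_image[OF inj] card_hamming_weight numeral_eq_Suc)
  qed
  show ?thesis unfolding total X Y Z by simp
qed

section \<open>The action of the cyclic group of order 21\<close>

text \<open>The whole group \<open>G\<close> is the fixed-point group of the identity.\<close>

interpretation G: odd_automorphism id 1
  by unfold_locales simp_all

lemma G_E: "G.E = UNIV" and G_Q: "G.Q = UNIV"
  by (simp_all add: G.E_def G.Q_def)

lemma G_H: "G.H = BV"
  by (simp add: G.H_def G_E G_Q BV_def)

lemma G_stab: "t \<in> G.stab s \<longleftrightarrow> translate t s = s"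
  by (simp only: G.stab_def G_Q mem_Collect_eq UNIV_I simp_thms)

lemma G_chi: "G.chi s \<mu> (f, t) = (if translate t s = s
     then \<mu> t * (\<Sum>r\<in>UNIV. lam (translate r s) f) / of_nat (card (G.stab s)) else 0)"
  by (simp only: G.chi_def G_E G_Q UNIV_Times_UNIV restrict_UNIV prod.case G_stab lam_translate)

lemma card_BV: "card (carrier BV) = 2 ^ 135"
proof -
  have "carrier BV = UNIV \<times> UNIV" by (simp add: BV_def)
  then have "card (carrier BV) = card (UNIV :: B set) * card (UNIV :: V set)"
    by (simp only: card_cartesian_product)
  also have "card (UNIV :: B set) = 2 ^ 128"
    by (simp only: card_UNIV_fun card_bit card_V) simp
  finally show ?thesis by (simp only: card_V power_add[symmetric]) simp
qed

text \<open>The multiplicity of \<open>\<lambda>\<^sub>s\<close> in the left-hand side is the order of the stabiliser of \<open>s\<close>, hence nonzero,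
  and in the right-hand side it is the number of \<open>r\<close> with \<open>u r = s\<close>.\<close>

lemma equal_orbit_sums_imp_in_orbit:
  fixes u :: "V \<Rightarrow> B"
  assumes "\<And>f. (\<Sum>r\<in>UNIV. lam (translate r s) f) = (\<Sum>r\<in>UNIV. lam (u r) f)"
  shows "\<exists>r. u r = s"
proof (rule ccontr)
  assume none: "\<nexists>r. u r = s"
  have E: "x \<in> G.E" for x by (simp only: G_E UNIV_I)
  have "(\<Sum>f\<in>G.E. lam s f * (\<Sum>r\<in>UNIV. lam (v r) f)) = (\<Sum>r\<in>UNIV. \<Sum>f\<in>G.E. lam s f * lam (v r) f)"
    for v :: "V \<Rightarrow> B"
    by (subst sum.swap) (simp only: sum_distrib_left)
  then have *: "(\<Sum>f\<in>G.E. lam s f * (\<Sum>r\<in>UNIV. lam (v r) f)) =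
      (\<Sum>r\<in>UNIV. if s = v r then of_nat (card G.E) else 0)" for v :: "V \<Rightarrow> B"
    by (simp only: G.orthogonality[OF E E])
  have "(\<Sum>r\<in>UNIV. if s = u r then of_nat (card G.E) else (0 :: complex)) = 0"
    using none by (intro sum.neutral ballI) metis
  then have "(\<Sum>r\<in>UNIV. if s = translate r s then of_nat (card G.E) else (0 :: complex)) = 0"
    using *[of u] *[of "\<lambda>r. translate r s"] assms by (simp only:)
  then have "of_nat (card {r. s = translate r s}) * of_nat (card G.E) = (0 :: complex)"
    by (subst (asm) sum.inter_filter[symmetric, of UNIV, simplified]) simp_all
  then have "card {r. s = translate r s} = 0" using G.card_E_nonzero by (simp only: mult_eq_0_iff of_nat_eq_0_iff simp_thms)
  moreover have "0 \<in> {r. s = translate r s}" by simp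
  ultimately show False by (metis card_eq_0_iff empty_iff finite)
qed

context odd_automorphism
begin

lemma pairing_comp: "pairing s (f \<circ> inv_into UNIV g) = pairing (s \<circ> g) f"
proof -
  have "pairing s (f \<circ> inv_into UNIV g) = (\<Sum>x\<in>UNIV. (\<lambda>x. s x * f (inv_into UNIV g x)) (g x))"
    unfolding pairing_def comp_apply by (rule sum.reindex_bij_betw[OF bij_g, symmetric])
  then show ?thesis
    by (simp only: pairing_def comp_apply inv_f_f[OF bij_is_inj[OF bij_g]])
qed

lemma lam_comp: "lam s (f \<circ> inv_into UNIV g) = lam (s \<circ> g) f"
  by (simp only: lam_def pairing_comp)

lemma translate_comp: "translate (g r) s \<circ> g = translate r (s \<circ> g)"
  by (simp only: translate_def fun_eq_iff comp_apply additive[symmetric] simp_thms)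

lemma E_translate_g: "s \<in> E \<Longrightarrow> translate (g t) s = s \<longleftrightarrow> translate t s = s"
proof -
  assume s: "s \<in> E"
  then have sign_of: "s \<circ> g = s" by (simp add: E_def)
  have "translate (g t) s = s \<longleftrightarrow> translate (g t) s \<circ> g = s \<circ> g"
    using bij_is_surj[OF bij_g] by (metis comp_id o_assoc surj_iff)
  then show ?thesis by (simp only: translate_comp sign_of)
qed

lemma sum_lam_comp:
  assumes s: "s \<in> E"
  shows "(\<Sum>r\<in>UNIV. lam (translate r s) (f \<circ> inv_into UNIV g)) = (\<Sum>r\<in>UNIV. lam (translate r s) f)"
proof -
  have sign_of: "s \<circ> g = s" using s by (simp add: E_def)
  have "(\<Sum>r\<in>UNIV. lam (translate r s) (f \<circ> inv_into UNIV g)) =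
      (\<Sum>r\<in>UNIV. lam (translate (g r) s) (f \<circ> inv_into UNIV g))"
    by (rule sum.reindex_bij_betw[OF bij_g, symmetric])
  then show ?thesis by (simp only: lam_comp translate_comp sign_of)
qed

lemma G_chi_invariant:
  assumes s: "s \<in> E"
  shows "G.chi s (\<lambda>_. 1) (f \<circ> inv_into UNIV g, g t) = G.chi s (\<lambda>_. 1) (f, t)"
  by (simp only: G_chi E_translate_g[OF s] sum_lam_comp[OF s])

lemma iterate: "odd_automorphism (g ^^ k) m"
proof
  show "(g ^^ k) (x + y) = (g ^^ k) x + (g ^^ k) y" for x y
    by (induction k) (simp_all add: additive)
  show "(g ^^ k) ^^ m = id" using period by (metis funpow_mult id_funpow mult.commute)
  show "odd m" by (rule odd_period)
qed

end

locale c21_action =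
  fixes \<omega> :: gf4 and \<zeta> :: gf8
  assumes \<omega>: "has_order \<omega> 3" and \<zeta>: "has_order \<zeta> 7"
begin

abbreviation "act \<equiv> act_BV \<omega> \<zeta>"

lemma nontrivial: "\<omega> \<noteq> 1" "\<zeta> \<noteq> 1"
  using \<omega> \<zeta> by (auto simp: has_order_def)

lemma T_add: "T \<omega> \<zeta> (x + y) = T \<omega> \<zeta> x + T \<omega> \<zeta> y"
proof -
  obtain x1 x2 x3 y1 y2 y3 where "x = ((x1, x2), x3)" "y = ((y1, y2), y3)" by (metis surj_pair)
  then show ?thesis by (simp add: distrib_left)
qed

lemma T_21: "T \<omega> \<zeta> ^^ 21 = id"
proof -
  have "\<omega> ^ 21 = (\<omega> ^ 3) ^ 7" "\<zeta> ^ 21 = (\<zeta> ^ 7) ^ 3" by (simp_all only: power_mult[symmetric]) simp_all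
  then have "\<omega> ^ 21 = 1" "\<zeta> ^ 21 = 1" using \<omega> \<zeta> by (simp_all only: has_order_def power_one)
  then have "(T \<omega> \<zeta> ^^ 21) ((x1, x2), y) = ((x1, x2), y)" for x1 x2 y
    by (simp only: T_pow mult_1_left)
  then show ?thesis by (simp only: fun_eq_iff split_paired_All id_apply simp_thms)
qed

sublocale C: odd_automorphism "T \<omega> \<zeta>" 21
  by unfold_locales (simp_all only: T_add T_21, simp)

sublocale M: odd_automorphism "T \<omega> \<zeta> ^^ 7" 3
proof
  show "(T \<omega> \<zeta> ^^ 7) (x + y) = (T \<omega> \<zeta> ^^ 7) x + (T \<omega> \<zeta> ^^ 7) y" for x y
    using C.iterate[of 7] by (rule odd_automorphism.additive)
  show "(T \<omega> \<zeta> ^^ 7) ^^ 3 = id" using T_21 by (simp add: funpow_mult)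
qed simp

lemma step_3: "glauberman_step id 1 (T \<omega> \<zeta> ^^ 7) 3 3"
  by unfold_locales (use T_21 in \<open>simp_all add: funpow_mult\<close>)

lemma step_7: "glauberman_step (T \<omega> \<zeta> ^^ 7) 3 (T \<omega> \<zeta>) 21 7"
  by unfold_locales simp_all

lemma T_fixed: "T \<omega> \<zeta> v = v \<longleftrightarrow> v = 0"
proof -
  obtain x1 x2 y where v: "v = ((x1, x2), y)" by (metis surj_pair)
  have "\<omega> * x = x \<longleftrightarrow> x = 0" for x using nontrivial(1) by (metis mult_cancel_right1)
  moreover have "\<zeta> * x = x \<longleftrightarrow> x = 0" for x using nontrivial(2) by (metis mult_cancel_right1)
  ultimately show ?thesis by (simp add: v zero_prod_def)
qed

lemma C_Q: "C.Q = {0}"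
  by (auto simp only: C.Q_def T_fixed)

lemma commutator_inj: "T \<omega> \<zeta> v + v = T \<omega> \<zeta> w + w \<longleftrightarrow> v = w"
proof
  assume "T \<omega> \<zeta> v + v = T \<omega> \<zeta> w + w"
  then have "T \<omega> \<zeta> (v + w) = v + w"
    unfolding T_add by (metis add.assoc add.commute add_self_left_V)
  then show "v = w" by (simp only: T_fixed add_eq_0_iff_V)
qed simp

text \<open>In characteristic 2 the map \<open>v \<mapsto> T v + v\<close> is \<open>T - 1\<close>. It is injective since \<open>T\<close> fixes only 0, and an
  injective map of a finite set into itself is onto.\<close>

lemma commutator_surj:
  assumes S: "\<And>v. v \<in> S \<Longrightarrow> T \<omega> \<zeta> v + v \<in> S" and u: "u \<in> S"
  shows "\<exists>v\<in>S. T \<omega> \<zeta> v + v = u"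
proof -
  have "(\<lambda>v. T \<omega> \<zeta> v + v) ` S = S"
  proof (rule card_subset_eq[OF finite])
    show "(\<lambda>v. T \<omega> \<zeta> v + v) ` S \<subseteq> S" using S by blast
    show "card ((\<lambda>v. T \<omega> \<zeta> v + v) ` S) = card S"
      by (rule card_image, rule inj_onI) (simp only: commutator_inj)
  qed
  then show ?thesis using u by (metis (no_types, lifting) imageE)
qed

subsection \<open>Coprimeness\<close>

lemma act_apply: "act k (f, t) = (f \<circ> inv_into UNIV (T \<omega> \<zeta> ^^ nat k), (T \<omega> \<zeta> ^^ nat k) t)"
  by (simp only: act_BV_def act_V_def prod.case)

lemma bij_T_pow: "bij (T \<omega> \<zeta> ^^ k)"
  by (rule bij_fn[OF C.bij_g])

lemma act_hom: "act k (x \<otimes>\<^bsub>BV\<^esub> y) = act k x \<otimes>\<^bsub>BV\<^esub> act k y"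
proof -
  let ?P = "T \<omega> \<zeta> ^^ nat k"
  interpret P: odd_automorphism ?P 21 by (rule C.iterate)
  obtain f t h u where x: "x = (f, t)" and y: "y = (h, u)" by (metis surj_pair)
  have "(f + translate t h) \<circ> inv_into UNIV ?P = (f \<circ> inv_into UNIV ?P) + translate (?P t) (h \<circ> inv_into UNIV ?P)"
  proof
    fix z
    have "inv_into UNIV ?P (z + ?P t) = inv_into UNIV ?P (?P (inv_into UNIV ?P z + t))"
      by (simp only: P.additive surj_f_inv_f[OF bij_is_surj[OF P.bij_g]])
    also have "\<dots> = inv_into UNIV ?P z + t" by (rule inv_f_f[OF bij_is_inj[OF P.bij_g]])
    finally show "((f + translate t h) \<circ> inv_into UNIV ?P) z =
        ((f \<circ> inv_into UNIV ?P) + translate (?P t) (h \<circ> inv_into UNIV ?P)) z"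
      by (simp only: comp_apply plus_fun_apply translate_def)
  qed
  moreover have mult: "(f, t) \<otimes>\<^bsub>BV\<^esub> (h, u) = (f + translate t h, t + u)" for f h :: B and t u
    by (simp add: BV_def)
  ultimately show ?thesis by (simp only: x y act_apply mult P.additive)
qed

lemma bij_act: "bij (act k)"
proof -
  let ?P = "T \<omega> \<zeta> ^^ nat k"
  have b: "bij ?P" by (rule bij_T_pow)
  have f: "f \<circ> inv_into UNIV ?P \<circ> ?P = f" "f \<circ> ?P \<circ> inv_into UNIV ?P = f" for f :: B
    using b by (simp_all only: comp_assoc inv_o_cancel[OF bij_is_inj[OF b]] surj_iff[THEN iffD1, OF bij_is_surj[OF b]] comp_id)
  define unact where "unact = (\<lambda>(f :: B, t). (f \<circ> ?P, inv_into UNIV ?P t))"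
  have "unact (act k (f, t)) = (f, t)" "act k (unact (f, t)) = (f, t)" for f t
    by (simp_all only: unact_def act_apply prod.case f inv_f_f[OF bij_is_inj[OF b]]
        surj_f_inv_f[OF bij_is_surj[OF b]])
  then have "unact (act k x) = x" "act k (unact x) = x" for x by (metis surj_pair)+
  then show ?thesis
    by (intro o_bij[where g = unact]) (simp_all only: fun_eq_iff comp_apply id_apply simp_thms)
qed

lemma act_add:
  assumes "x \<in> carrier C21" "y \<in> carrier C21"
  shows "act ((x + y) mod 21) = act x \<circ> act y"
proof -
  let ?T = "T \<omega> \<zeta>"
  have xy: "0 \<le> x" "0 \<le> y" using assms by (simp_all add: carrier_integer_mod_group)
  have mod: "?T ^^ (k mod 21) = ?T ^^ k" for k
  proof -
    have "?T ^^ k = ?T ^^ (k mod 21 + 21 * (k div 21))" by (simp only: mod_mult_div_eq)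
    also have "\<dots> = ?T ^^ (k mod 21)"
      unfolding funpow_add funpow_mult[symmetric] T_21 by simp
    finally show ?thesis ..
  qed
  have "nat ((x + y) mod 21) = (nat x + nat y) mod 21"
    using xy by (simp add: nat_mod_distrib nat_add_distrib)
  then have "?T ^^ nat ((x + y) mod 21) = ?T ^^ nat x \<circ> ?T ^^ nat y"
    by (simp only: mod funpow_add)
  moreover have "inv_into UNIV (?T ^^ nat x \<circ> ?T ^^ nat y) = inv_into UNIV (?T ^^ nat y) \<circ> inv_into UNIV (?T ^^ nat x)"
    by (rule o_inv_distrib[OF bij_T_pow bij_T_pow])
  ultimately have "act ((x + y) mod 21) (f, t) = (act x \<circ> act y) (f, t)" for f t
    by (simp only: comp_apply act_apply comp_assoc)
  then show ?thesis by (metis ext surj_pair)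
qed

lemma coprime_action_C21: "coprime_action C21 BV act"
  unfolding coprime_action_def
proof (intro conjI)
  show "group C21" by simp
  show "finite (carrier C21)" by (simp add: carrier_integer_mod_group)
  show grp: "group BV" using G.group_H by (simp only: G_H)
  show "finite (carrier BV)" by (rule finite)
  have auto: "act k \<in> auto BV" for k
    using act_hom bij_act[of k] by (auto simp: auto_def hom_def Bij_def BV_def)
  have Bij: "act k \<in> Bij (carrier BV)" for k using auto by (simp add: auto_def)
  show "act \<in> hom C21 (AutoGroup BV)"
  proof (rule homI)
    show "act x \<in> carrier (AutoGroup BV)" for x using auto by (simp add: AutoGroup_def)
    fix x y assume xy: "x \<in> carrier C21" "y \<in> carrier C21"
    have "compose (carrier BV) (act x) (act y) = act x \<circ> act y"
      by (simp add: compose_def BV_def comp_def restrict_UNIV)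
    then show "act (x \<otimes>\<^bsub>C21\<^esub> y) = act x \<otimes>\<^bsub>AutoGroup BV\<^esub> act y"
      using Bij act_add[OF xy] by (simp add: AutoGroup_def BijGroup_def)
  qed
  have "coprime (21 :: nat) 2" by simp
  then have "coprime (21 :: nat) (2 ^ 135)" by (simp only: coprime_power_right_iff simp_thms)
  then show "coprime (card (carrier C21)) (card (carrier BV))"
    unfolding card_BV by (simp only: carrier_integer_mod_group) simp
qed

subsection \<open>Invariant characters\<close>

text \<open>Invariance of the character gives \<open>r\<close> such that \<open>T\<close> carries the translate of \<open>s\<close> by \<open>r\<close> back to
  \<open>s\<close>. Writing \<open>r = T x + x\<close>, the translate by \<open>x\<close> is invariant. Its stabiliser is \<open>T\<close>-invariant, so each
  of its elements is \<open>T t + t\<close> with \<open>t\<close> in the stabiliser, and \<open>\<mu>(T t) = \<mu>(t)\<close> makes \<open>\<mu>\<close> equal to 1 there.\<close>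

lemma invariant_Irr_subset:
  assumes "\<chi> \<in> Irr_inv C21 BV act"
  shows "\<exists>s\<in>C.E. \<chi> = G.chi s (\<lambda>_. 1)"
proof -
  have "x \<in> carrier BV" for x by (simp add: BV_def)
  moreover have "1 \<in> carrier C21" by simp
  ultimately have inv: "\<chi> (act 1 x) = \<chi> x" for x
    using assms unfolding Irr_inv_def by blast
  have "\<chi> \<in> Irr G.H" using assms by (simp add: Irr_inv_def G_H)
  then obtain s \<mu> where \<mu>: "sign_character (G.stab s) \<mu>" and \<chi>: "\<chi> = G.chi s \<mu>"
    by (metis G.Irr_H_cases)
  have \<mu>0: "\<mu> 0 = 1"
  proof -
    have "\<mu> (0 + 0) = \<mu> 0 * \<mu> 0" "\<mu> 0 = 1 \<or> \<mu> 0 = -1"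
      using \<mu> G.stab_0 unfolding sign_character_def by blast+
    then show ?thesis by auto
  qed
  have act1: "act 1 (f, t) = (f \<circ> inv_into UNIV (T \<omega> \<zeta>), T \<omega> \<zeta> t)" for f t
    by (simp add: act_apply)
  \<comment> \<open>the values on \<open>B\<close> show that the orbit of \<open>s\<close> is invariant\<close>
  have "(\<Sum>r\<in>UNIV. lam (translate r s) f) = (\<Sum>r\<in>UNIV. lam (translate r s \<circ> T \<omega> \<zeta>) f)" for f
  proof -
    have "G.chi s \<mu> (f \<circ> inv_into UNIV (T \<omega> \<zeta>), 0) = G.chi s \<mu> (f, 0)"
      using inv[of "(f, 0)"] by (simp only: \<chi> act1 C.g_0)
    then show ?thesis
      using G.card_stab_nonzero[of s] by (simp add: G_chi \<mu>0 C.lam_comp)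
  qed
  from equal_orbit_sums_imp_in_orbit[OF this] obtain r where r: "translate r s \<circ> T \<omega> \<zeta> = s" by blast
  obtain x where x: "T \<omega> \<zeta> x + x = r" using commutator_surj[of UNIV r] by blast
  define s1 where "s1 = translate x s"
  have "s1 \<circ> T \<omega> \<zeta> = s1"
  proof -
    have "x = T \<omega> \<zeta> x + r" by (simp only: x[symmetric] add_self_left_V)
    then have "s1 = translate (T \<omega> \<zeta> x) (translate r s)"
      by (metis s1_def translate_translate)
    then have "s1 \<circ> T \<omega> \<zeta> = translate x (translate r s \<circ> T \<omega> \<zeta>)"
      by (simp only: C.translate_comp)
    then show ?thesis by (simp only: r s1_def)
  qed
  then have s1: "s1 \<in> C.E" by (simp add: C.E_def)
  have \<chi>1: "\<chi> = G.chi s1 \<mu>"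
    unfolding \<chi> s1_def by (rule G.chi_translate[symmetric]) (simp only: G_Q UNIV_I)
  have \<mu>1: "sign_character (G.stab s1) \<mu>"
    using \<mu> unfolding s1_def G.stab_translate_eq .
  \<comment> \<open>the values on \<open>V\<close> show that \<open>\<mu>\<close> is constant on orbits of \<open>T\<close>\<close>
  have T_stab: "T \<omega> \<zeta> t \<in> G.stab s1" if "t \<in> G.stab s1" for t
    using that C.E_translate_g[OF s1] by (simp only: G_stab)
  have "\<mu> u = 1" if u: "u \<in> G.stab s1" for u
  proof -
    obtain t where t: "t \<in> G.stab s1" "T \<omega> \<zeta> t + t = u"
      using commutator_surj[of "G.stab s1" u] G.stab_add T_stab u by blast
    have "G.chi s1 \<mu> (0 \<circ> inv_into UNIV (T \<omega> \<zeta>), T \<omega> \<zeta> t) = G.chi s1 \<mu> (0, t)"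
      using inv[of "(0, t)"] by (simp only: \<chi>1 act1)
    moreover have "(0 :: B) \<circ> inv_into UNIV (T \<omega> \<zeta>) = 0" by (simp add: fun_eq_iff)
    ultimately have "\<mu> (T \<omega> \<zeta> t) = \<mu> t"
      using t(1) T_stab[OF t(1)] G.card_stab_nonzero[of s1] card_V by (simp add: G_chi G_stab)
    moreover have "\<mu> (T \<omega> \<zeta> t + t) = \<mu> (T \<omega> \<zeta> t) * \<mu> t" "\<mu> t = 1 \<or> \<mu> t = -1"
      using \<mu>1 t(1) T_stab[OF t(1)] unfolding sign_character_def by blast+
    ultimately show "\<mu> u = 1" using t(2) by auto
  qed
  then have "\<chi> = G.chi s1 (\<lambda>_. 1)" unfolding \<chi>1 by (rule G.chi_cong)
  then show ?thesis using s1 by blast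
qed

lemma Irr_inv_eq: "Irr_inv C21 BV act = (\<lambda>s. G.chi s (\<lambda>_. 1)) ` C.E"
proof
  show "Irr_inv C21 BV act \<subseteq> (\<lambda>s. G.chi s (\<lambda>_. 1)) ` C.E"
    using invariant_Irr_subset by blast
  show "(\<lambda>s. G.chi s (\<lambda>_. 1)) ` C.E \<subseteq> Irr_inv C21 BV act"
  proof (rule image_subsetI)
    fix s assume s: "s \<in> C.E"
    have "G.chi s (\<lambda>_. 1) \<in> Irr BV"
      using G.chi_in_Irr[of s] by (simp only: G_E UNIV_I G_H simp_thms)
    moreover have "G.chi s (\<lambda>_. 1) (act b x) = G.chi s (\<lambda>_. 1) x" for b x
    proof -
      interpret P: odd_automorphism "T \<omega> \<zeta> ^^ nat b" 21 by (rule C.iterate)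
      obtain f t where x: "x = (f, t)" by (metis surj_pair)
      have "s \<in> P.E" using C.invariant_pow[OF s] by (simp only: P.E_iff simp_thms)
      then show ?thesis unfolding x act_apply by (rule P.G_chi_invariant)
    qed
    ultimately show "G.chi s (\<lambda>_. 1) \<in> Irr_inv C21 BV act" by (simp add: Irr_inv_def)
  qed
qed

text \<open>Equal characters give \<open>s = translate r s'\<close>. Since \<open>T\<close> fixes both functions, \<open>T r + r\<close> stabilises
  \<open>s'\<close>; as \<open>T - 1\<close> is bijective on the stabiliser and injective on \<open>V\<close>, already \<open>r\<close> stabilises \<open>s'\<close>.\<close>

lemma inj_on_chi: "inj_on (\<lambda>s. G.chi s (\<lambda>_. 1)) C.E"
proof (rule inj_onI)
  fix s s' assume s: "s \<in> C.E" and s': "s' \<in> C.E" and eq: "G.chi s (\<lambda>_. 1) = G.chi s' (\<lambda>_. 1)"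
  have at0: "(\<Sum>r\<in>UNIV. lam (translate r s) f) / of_nat (card (G.stab s)) =
      (\<Sum>r\<in>UNIV. lam (translate r s') f) / of_nat (card (G.stab s'))" for f
    using fun_cong[OF eq, of "(f, 0)"] by (simp add: G_chi)
  have "of_nat (card (G.stab s)) = (of_nat (card (G.stab s')) :: complex)"
    using at0[of 0] card_V G.card_stab_nonzero by (simp add: frac_eq_eq)
  then have "(\<Sum>r\<in>UNIV. lam (translate r s) f) = (\<Sum>r\<in>UNIV. lam (translate r s') f)" for f
    using at0[of f] G.card_stab_nonzero[of s'] by simp
  from equal_orbit_sums_imp_in_orbit[OF this] obtain r where r: "translate r s' = s" by blast
  have sT: "s \<circ> T \<omega> \<zeta> = s" "s' \<circ> T \<omega> \<zeta> = s'" using s s' by (simp_all add: C.E_def)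
  have "translate (T \<omega> \<zeta> r) s' = s"
  proof -
    have "translate (T \<omega> \<zeta> r) s' \<circ> T \<omega> \<zeta> = s \<circ> T \<omega> \<zeta>"
      by (simp only: C.translate_comp sT r)
    then show ?thesis using bij_is_surj[OF C.bij_g] by (metis comp_id o_assoc surj_iff)
  qed
  then have rr: "T \<omega> \<zeta> r + r \<in> G.stab s'"
    unfolding G_stab by (metis r add.commute translate_eq_iff translate_translate)
  obtain t where t: "t \<in> G.stab s'" "T \<omega> \<zeta> t + t = T \<omega> \<zeta> r + r"
    using commutator_surj[of "G.stab s'", OF _ rr] G.stab_add C.E_translate_g[OF s'] by (metis G_stab)
  then have "r \<in> G.stab s'" using commutator_inj by metis
  then show "s = s'" using r by (simp only: G_stab)
qed

subsection \<open>The correspondents\<close>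

lemma fixed_points_C: "fixed_points (carrier C21) BV act = C.E \<times> C.Q"
proof (rule Set.set_eqI)
  fix x :: "B \<times> V"
  obtain f t where x: "x = (f, t)" by (metis surj_pair)
  have inv_iff: "f \<circ> inv_into UNIV P = f \<longleftrightarrow> f \<circ> P = f" if "bij P" for P :: "V \<Rightarrow> V"
    using that by (metis comp_assoc comp_id bij_is_inj bij_is_surj inv_o_cancel surj_iff)
  show "x \<in> fixed_points (carrier C21) BV act \<longleftrightarrow> x \<in> C.E \<times> C.Q"
  proof
    assume "x \<in> fixed_points (carrier C21) BV act"
    moreover have "1 \<in> carrier C21" by simp
    ultimately have "act 1 (f, t) = (f, t)" unfolding fixed_points_def x by blast
    then show "x \<in> C.E \<times> C.Q"
      using inv_iff[OF C.bij_g] by (simp add: x act_apply C.E_def C.Q_def)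
  next
    assume "x \<in> C.E \<times> C.Q"
    then have f: "f \<in> C.E" and t: "t \<in> C.Q" by (simp_all add: x)
    have "act b (f, t) = (f, t)" for b
    proof -
      have "f \<circ> T \<omega> \<zeta> ^^ nat b = f" using C.invariant_pow[OF f] by (simp only: fun_eq_iff comp_apply simp_thms)
      moreover have "(T \<omega> \<zeta> ^^ k) t = t" for k using t by (induction k) (simp_all add: C.Q_def)
      ultimately show ?thesis by (simp only: act_apply prod.inject inv_iff[OF bij_T_pow] simp_thms)
    qed
    then show "x \<in> fixed_points (carrier C21) BV act" by (simp add: fixed_points_def x BV_def)
  qed
qed

lemma fixed_points_M: "fixed_points {0, 7, 14} BV act = M.E \<times> M.Q"
proof (rule Set.set_eqI)
  fix x :: "B \<times> V"
  obtain f t where x: "x = (f, t)" by (metis surj_pair)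
  have inv_iff: "f \<circ> inv_into UNIV P = f \<longleftrightarrow> f \<circ> P = f" if "bij P" for P :: "V \<Rightarrow> V"
    using that by (metis comp_assoc comp_id bij_is_inj bij_is_surj inv_o_cancel surj_iff)
  let ?P = "T \<omega> \<zeta> ^^ 7"
  have 14: "T \<omega> \<zeta> ^^ 14 = ?P \<circ> ?P" by (simp flip: funpow_add)
  have act: "act b (f, t) = (f, t) \<longleftrightarrow> f \<circ> T \<omega> \<zeta> ^^ nat b = f \<and> (T \<omega> \<zeta> ^^ nat b) t = t" for b
    by (simp only: act_apply prod.inject inv_iff[OF bij_T_pow])
  have n: "nat 0 = 0" "nat 7 = 7" "nat 14 = 14" by simp_all
  have "x \<in> fixed_points {0, 7, 14} BV act \<longleftrightarrow> f \<circ> ?P = f \<and> ?P t = t"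
    unfolding fixed_points_def x mem_Collect_eq ball_simps act n 14
    by (auto simp: BV_def fun_eq_iff simp del: split_paired_All)
  then show "x \<in> fixed_points {0, 7, 14} BV act \<longleftrightarrow> x \<in> M.E \<times> M.Q"
    by (simp only: x M.E_def M.Q_def mem_Times_iff fst_conv snd_conv mem_Collect_eq)
qed

lemma subgroup_7: "subgroup {0, 7, 14} C21"
  by (rule group.subgroupI) (auto simp: carrier_integer_mod_group)

lemma glauberman_chain_chi:
  assumes s: "s \<in> C.E"
  shows "glauberman_chain C21 BV act (G.chi s (\<lambda>_. 1)) (carrier C21) (C.chi s (\<lambda>_. 1))"
proof -
  interpret S1: glauberman_step id 1 "T \<omega> \<zeta> ^^ 7" 3 3 by (rule step_3)
  interpret S2: glauberman_step "T \<omega> \<zeta> ^^ 7" 3 "T \<omega> \<zeta>" 21 7 by (rule step_7)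
  have sM: "s \<in> M.E" using S2.E_subset s by blast
  have HM: "BV\<lparr>carrier := fixed_points {0, 7, 14} BV act\<rparr> = M.H"
    by (simp only: fixed_points_M M.H_def)
  have HC: "BV\<lparr>carrier := fixed_points (carrier C21) BV act\<rparr> = C.H"
    by (simp only: fixed_points_C C.H_def)
  have one: "{\<one>\<^bsub>C21\<^esub>} \<lhd> C21\<lparr>carrier := {0, 7, 14}\<rparr>"
    using group.one_is_normal[OF subgroup.subgroup_is_group[OF subgroup_7 group_integer_mod_group]] by simp
  have chain_M: "glauberman_chain C21 BV act (G.chi s (\<lambda>_. 1)) {0, 7, 14} (M.chi s (\<lambda>_. 1))"
  proof (rule glauberman_chain.step[OF glauberman_chain.start subgroup_7 one])
    show "prime (3 :: nat)" by simp
    show "card {0 :: int, 7, 14} = 3 ^ 1 * card {\<one>\<^bsub>C21\<^esub>}" by simp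
    show "the_p'_constituent 3 (BV\<lparr>carrier := fixed_points {0, 7, 14} BV act\<rparr>)
        (Irr (BV\<lparr>carrier := fixed_points {0, 7, 14} BV act\<rparr>)) (G.chi s (\<lambda>_. 1)) (M.chi s (\<lambda>_. 1))"
      unfolding HM by (rule S1.p'_constituent_chi[OF sM])
  qed
  have normal: "{0, 7, 14} \<lhd> C21\<lparr>carrier := carrier C21\<rparr>"
    using comm_group.subgroup_imp_normal[OF abelian_integer_mod_group subgroup_7] by simp
  have sub: "subgroup (carrier C21) C21"
    by (rule group.subgroup_self) simp
  show ?thesis
  proof (rule glauberman_chain.step[OF chain_M sub normal])
    show "prime (7 :: nat)" by simp
    show "card (carrier C21) = 7 ^ 1 * card {0 :: int, 7, 14}"
      by (simp add: carrier_integer_mod_group)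
    show "the_p'_constituent 7 (BV\<lparr>carrier := fixed_points (carrier C21) BV act\<rparr>)
        (Irr (BV\<lparr>carrier := fixed_points (carrier C21) BV act\<rparr>)) (M.chi s (\<lambda>_. 1)) (C.chi s (\<lambda>_. 1))"
      unfolding HC by (rule S2.p'_constituent_chi[OF s])
  qed
qed

text \<open>Since \<open>C.Q\<close> is trivial, the group \<open>C\<close> is a subgroup of \<open>B\<close> and all its characters are linear.\<close>

lemma C_Irr_one:
  assumes "\<theta> \<in> Irr C.H"
  shows "\<theta> \<one>\<^bsub>BV\<^esub> = 1"
proof -
  obtain s \<mu> where s: "s \<in> C.E" and \<mu>: "sign_character (C.stab s) \<mu>" and \<theta>: "\<theta> = C.chi s \<mu>"
    using assms by (metis C.Irr_H_cases)
  have stab: "C.stab s = {0}" using C.stab_0[of s] C.stab_subset[of s] C_Q by blast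
  have "\<mu> (0 + 0) = \<mu> 0 * \<mu> 0" "\<mu> 0 = 1 \<or> \<mu> 0 = -1"
    using \<mu> unfolding sign_character_def stab by blast+
  then have "\<mu> 0 = 1" by auto
  moreover have "\<one>\<^bsub>BV\<^esub> = (0, 0)" by (simp add: BV_def)
  ultimately show ?thesis by (simp add: \<theta> C.chi_def stab C_Q C.E_0)
qed

lemma solvable_C21: "solvable C21"
proof -
  interpret comm_group C21 by simp
  have "derived C21 (carrier C21) = {\<one>\<^bsub>C21\<^esub>}"
    by (rule derived_eq_singleton) simp
  then have "(derived C21 ^^ 1) (carrier C21) = {\<one>\<^bsub>C21\<^esub>}" by simp
  then show ?thesis unfolding solvable_iff_trivial_derived_seq by blast
qed

text \<open>The chain through \<open>{0, 7, 14}\<close> shows that some character is reached. Whichever chain produced the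
  chosen one, its last step lands in the irreducible characters of \<open>C\<close>.\<close>

lemma correspondent_linear:
  assumes s: "s \<in> C.E"
  shows "GI_correspondent C21 BV act (G.chi s (\<lambda>_. 1)) \<one>\<^bsub>BV\<^esub> = 1"
proof -
  let ?\<theta> = "GI_correspondent C21 BV act (G.chi s (\<lambda>_. 1))"
  have "glauberman_chain C21 BV act (G.chi s (\<lambda>_. 1)) (carrier C21) ?\<theta>"
    unfolding GI_correspondent_def using solvable_C21 glauberman_chain_chi[OF s] by (simp add: someI[of _ "C.chi s (\<lambda>_. 1)"])
  then have "?\<theta> \<in> Irr (BV\<lparr>carrier := fixed_points (carrier C21) BV act\<rparr>)"
  proof cases
    case start
    then have "(7 :: int) \<in> {0}" by (metis carrier_integer_mod_group atLeastLessThan_iff one_integer_mod_group subgroup_7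
          insertI1 insertI2 subgroup.mem_carrier)
    then show ?thesis by simp
  next
    case (step H \<psi> p n)
    then show ?thesis by (simp add: the_p'_constituent_def)
  qed
  then have "?\<theta> \<in> Irr C.H" by (simp only: fixed_points_C C.H_def)
  then show ?thesis by (rule C_Irr_one)
qed

text \<open>Both \<open>s\<close> and the points of \<open>C\<close> are invariant functions, and the value of the character is a
  nonzero multiple of the signed sum over their convolution.\<close>

lemma chi_zero_iff:
  assumes s: "s = invariant_fun c"
  shows "(\<exists>x \<in> fixed_points (carrier C21) BV act. G.chi s (\<lambda>_. 1) x = 0) \<longleftrightarrow> vanishing_criterion c"
proof -
  have E: "C.E = range invariant_fun" unfolding C.E_def by (rule invariant_functions[OF \<omega> \<zeta>])
  have lam_convolution: "lam (translate r s) f = of_int (sign_of (convolution s f r))" for f r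
  proof -
    have "pairing (translate r s) f = pairing s (translate r f)"
      by (rule pairing_translate[symmetric])
    then have "pairing (translate r s) f = convolution s f r"
      by (simp only: pairing_def translate_def convolution_def)
    then show ?thesis by (simp add: lam_def sign_of_def)
  qed
  have "G.chi s (\<lambda>_. 1) (invariant_fun d, 0) = 0 \<longleftrightarrow> balanced (mult_coords c d)" for d
  proof -
    have "G.chi s (\<lambda>_. 1) (invariant_fun d, 0) = 0 \<longleftrightarrow> (\<Sum>r\<in>UNIV. lam (translate r s) (invariant_fun d)) = 0"
      using G.card_stab_nonzero[of s] by (simp add: G_chi)
    also have "(\<Sum>r\<in>UNIV. lam (translate r s) (invariant_fun d)) = of_int (\<Sum>r\<in>UNIV. sign_of (invariant_fun (mult_coords c d) r))"
      unfolding lam_convolution unfolding s convolution_invariant_fun by (simp only: of_int_sum)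
    finally show ?thesis by (simp only: of_int_eq_0_iff sum_invariant_fun_eq_0_iff)
  qed
  moreover have "(\<exists>x \<in> C.E \<times> C.Q. P x) \<longleftrightarrow> (\<exists>d. P (invariant_fun d, 0))" for P
    unfolding E C_Q by blast
  ultimately show ?thesis
    unfolding fixed_points_C by (simp only: exists_balanced_multiple)
qed

lemma card_counterexamples:
  "card {\<chi> \<in> Irr_inv C21 BV act. GI_correspondent C21 BV act \<chi> \<one>\<^bsub>BV\<^esub> = 1 \<and>
     (\<exists>c \<in> fixed_points (carrier C21) BV act. \<chi> c = 0)} = 2368"
proof -
  let ?chi = "\<lambda>s. G.chi s (\<lambda>_. 1)"
  have E: "C.E = range invariant_fun" unfolding C.E_def by (rule invariant_functions[OF \<omega> \<zeta>])
  have "{\<chi> \<in> Irr_inv C21 BV act. GI_correspondent C21 BV act \<chi> \<one>\<^bsub>BV\<^esub> = 1 \<and>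
      (\<exists>c \<in> fixed_points (carrier C21) BV act. \<chi> c = 0)} = ?chi ` invariant_fun ` {c. vanishing_criterion c}"
    (is "?L = _")
  proof -
    have "?L = ?chi ` {s \<in> C.E. \<exists>x \<in> fixed_points (carrier C21) BV act. ?chi s x = 0}"
      unfolding Irr_inv_eq using correspondent_linear by blast
    also have "{s \<in> C.E. \<exists>x \<in> fixed_points (carrier C21) BV act. ?chi s x = 0} = invariant_fun ` {c. vanishing_criterion c}"
      unfolding E using chi_zero_iff[OF refl] by blast
    finally show ?thesis .
  qed
  moreover have "card (?chi ` invariant_fun ` {c. vanishing_criterion c}) = card (invariant_fun ` {c. vanishing_criterion c})"
    by (rule card_image, rule inj_on_subset[OF inj_on_chi]) (auto simp only: E)
  moreover have "card (invariant_fun ` {c. vanishing_criterion c}) = 2368"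
    using card_image[OF inj_on_subset[OF inj_invariant_fun subset_UNIV]] card_vanishing_criterion by metis
  ultimately show ?thesis by (simp only:)
qed

lemma counterexample: "\<not> linear_iff_nonvanishing TYPE(int) TYPE(B \<times> V)"
proof
  assume "linear_iff_nonvanishing TYPE(int) TYPE(B \<times> V)"
  then have iff: "GI_correspondent C21 BV act \<chi> \<one>\<^bsub>BV\<^esub> = 1 \<longleftrightarrow>
      (\<forall>c \<in> fixed_points (carrier C21) BV act. \<chi> c \<noteq> 0)" if "\<chi> \<in> Irr_inv C21 BV act" for \<chi>
    unfolding linear_iff_nonvanishing_def using coprime_action_C21 that by blast
  have empty: "{\<chi> \<in> Irr_inv C21 BV act. GI_correspondent C21 BV act \<chi> \<one>\<^bsub>BV\<^esub> = 1 \<and>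
     (\<exists>c \<in> fixed_points (carrier C21) BV act. \<chi> c = 0)} = {}"
    using iff by blast
  from card_counterexamples show False unfolding empty by simp
qed

end

theorem corollary2:
  fixes \<omega> :: gf4 and \<zeta> :: gf8
  assumes "has_order \<omega> 3" and "has_order \<zeta> 7"
  shows "card {\<chi> \<in> Irr_inv C21 BV (act_BV \<omega> \<zeta>).
                 GI_correspondent C21 BV (act_BV \<omega> \<zeta>) \<chi> \<one>\<^bsub>BV\<^esub> = 1 \<and>
                 (\<exists>c \<in> fixed_points (carrier C21) BV (act_BV \<omega> \<zeta>). \<chi> c = 0)} = 2368
         \<and> \<not> linear_iff_nonvanishing TYPE(int) TYPE(B \<times> V)"
proof -
  interpret c21_action \<omega> \<zeta> by unfold_locales (fact assms)+
  show ?thesis using card_counterexamples counterexample by (rule conjI)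
qed

end
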